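(* Let $k$ be an uncountable algebraically closed field of characteristic zero. Let $X = \varinjlim X_n$ be an affine ind-variety over $k$ such that $X_n$ is normal for infinitely many $n$. Then the ind-topology and the Zariski topology on $X$ coincide if and only if for every $x \in X$ the local dimension $\dim_x X_n$ of $X_n$ at $x$ is bounded for all $n$ (i.e. bounded by a constant that may depend on $x$ but not on $n$).
   Context: Affine varieties over $k$ are reduced, of finite type, and not necessarily irreducible; such a variety is normal if all its local rings are normal. An affine ind-variety $X = \varinjlim X_n$ is given by a filtration, i.e. a countable sequence of closed embeddings of affine varieties $X_1 \hookrightarrow X_2 \hookrightarrow X_3 \hookrightarrow \cdots$. As a set, $X = \bigcup_{n} X_n$, and its ring of regular functions is $\mathcal{O}(X) = \varprojlim \mathcal{O}(X_n)$ (transition maps are restrictions), with the topology induced from the product topology of $\prod_n \mathcal{O}(X_n)$, each $\mathcal{O}(X_n)$ being discrete. Two topologies on $X$: in the ind-topology, a subset $Y \subseteq X$ is closed iff $Y \cap X_n$ is Zariski closed in the variety $X_n$ for every $n$. In the Zariski topology, the closed subsets of $X$ are the common zero sets in $X$ of subsets $E \subseteq \mathcal{O}(X)$. The local dimension $\dim_x X_n$ is the maximum of the dimensions of the irreducible components of $X_n$ containing $x$ (considered for $n$ with $x\in X_n$). *)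

theory Defs
  imports
    "HOL-Analysis.Abstract_Topology"
    "HOL-Algebra.Ring"
    "HOL-Computational_Algebra.Polynomial"
    "HOL-Library.Countable_Set"
    "HOL-Library.Extended_Nat"
begin

section \<open>Spaces with functions and their Zariski topology\<close>

text \<open>A set of points together with a set of \<open>'k\<close>-valued functions on it. Functions on
  \<open>points V\<close> are represented as elements of \<open>extensional (points V)\<close>, so that equality of
  such functions is equality of HOL functions.\<close>

record ('p, 'k) fun_space =
  points :: "'p set"
  regular :: "('p \<Rightarrow> 'k) set"

definition zeros :: "('p, 'k::zero) fun_space \<Rightarrow> ('p \<Rightarrow> 'k) set \<Rightarrow> 'p set" where
  "zeros V E = {x \<in> points V. \<forall>f\<in>E. f x = 0}"

text \<open>Characterized by \<open>closedin_zariski_topology\<close> below.\<close>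

definition zariski_topology :: "('p, 'k::zero) fun_space \<Rightarrow> 'p topology" where
  "zariski_topology V =
     topology (\<lambda>U. U \<subseteq> points V \<and> (\<exists>E \<subseteq> regular V. points V - U = zeros V E))"

definition fun_algebra :: "('p, 'k::comm_ring_1) fun_space \<Rightarrow> bool" where
  "fun_algebra V \<longleftrightarrow>
     regular V \<subseteq> extensional (points V) \<and>
     (\<forall>c. restrict (\<lambda>_. c) (points V) \<in> regular V) \<and>
     (\<forall>f\<in>regular V. \<forall>g\<in>regular V. restrict (\<lambda>x. f x + g x) (points V) \<in> regular V) \<and>
     (\<forall>f\<in>regular V. \<forall>g\<in>regular V. restrict (\<lambda>x. f x * g x) (points V) \<in> regular V)"

lemma istopology_zariski:
  fixes V :: "('p, 'k::idom) fun_space"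
  assumes V: "fun_algebra V"
  shows "istopology (\<lambda>U. U \<subseteq> points V \<and> (\<exists>E \<subseteq> regular V. points V - U = zeros V E))"
  unfolding istopology_def
proof (intro conjI allI impI, goal_cases)
  case (1 S T)
  then show ?case by blast
next
  case (2 S T)
  then obtain E F where E: "E \<subseteq> regular V" "points V - S = zeros V E"
    and F: "F \<subseteq> regular V" "points V - T = zeros V F" by blast
  let ?G = "{restrict (\<lambda>x. f x * g x) (points V) | f g. f \<in> E \<and> g \<in> F}"
  have "?G \<subseteq> regular V" using E(1) F(1) V unfolding fun_algebra_def by blast
  moreover have "zeros V ?G = zeros V E \<union> zeros V F"
  proof
    show "zeros V ?G \<subseteq> zeros V E \<union> zeros V F"
    proof
      fix x assume x: "x \<in> zeros V ?G"
      then have xV: "x \<in> points V" by (simp add: zeros_def)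
      have "f x * g x = 0" if "f \<in> E" "g \<in> F" for f g
      proof -
        have "restrict (\<lambda>x. f x * g x) (points V) \<in> ?G" using that by blast
        then have "restrict (\<lambda>x. f x * g x) (points V) x = 0"
          using x unfolding zeros_def by blast
        then show ?thesis using xV by simp
      qed
      then show "x \<in> zeros V E \<union> zeros V F" using xV by (auto simp: zeros_def)
    qed
  qed (auto simp: zeros_def)
  moreover have "points V - S \<inter> T = zeros V E \<union> zeros V F" using E F by blast
  ultimately show ?case by (metis (no_types, lifting))
next
  case (3 K)
  then show ?case by blast
next
  case (4 K)
  then obtain E where E: "\<And>U. U \<in> K \<Longrightarrow> E U \<subseteq> regular V \<and> points V - U = zeros V (E U)"
    by metis
  have "points V - \<Union>K = zeros V (\<Union>U\<in>K. E U)"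
  proof -
    have "x \<in> points V - \<Union>K \<longleftrightarrow> x \<in> points V \<and> (\<forall>U\<in>K. x \<in> points V - U)" for x by blast
    moreover have "x \<in> points V - U \<longleftrightarrow> x \<in> points V \<and> (\<forall>f\<in>E U. f x = 0)" if "U \<in> K" for x U
      using E[OF that] by (auto simp: zeros_def)
    ultimately show ?thesis unfolding zeros_def by blast
  qed
  moreover have "(\<Union>U\<in>K. E U) \<subseteq> regular V" using E by blast
  ultimately show ?case by blast
qed

lemma openin_zariski_topology:
  fixes V :: "('p, 'k::idom) fun_space"
  assumes "fun_algebra V"
  shows "openin (zariski_topology V) U \<longleftrightarrow>
           U \<subseteq> points V \<and> (\<exists>E \<subseteq> regular V. points V - U = zeros V E)"
  unfolding zariski_topology_def topology_inverse'[OF istopology_zariski[OF assms]] ..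

lemma topspace_zariski_topology:
  fixes V :: "('p, 'k::idom) fun_space"
  assumes V: "fun_algebra V"
  shows "topspace (zariski_topology V) = points V"
proof
  show "topspace (zariski_topology V) \<subseteq> points V"
    unfolding topspace_def openin_zariski_topology[OF V] by blast
  have "zeros V {restrict (\<lambda>_. 1) (points V)} = {}" by (auto simp: zeros_def)
  moreover have "{restrict (\<lambda>_. 1) (points V)} \<subseteq> regular V"
    using V by (simp add: fun_algebra_def)
  ultimately have "openin (zariski_topology V) (points V)"
    unfolding openin_zariski_topology[OF V] by (metis Diff_cancel order_refl)
  then show "points V \<subseteq> topspace (zariski_topology V)" by (rule openin_subset)
qed

lemma closedin_zariski_topology:
  fixes V :: "('p, 'k::idom) fun_space"
  assumes V: "fun_algebra V"
  shows "closedin (zariski_topology V) Y \<longleftrightarrow> (\<exists>E \<subseteq> regular V. Y = zeros V E)"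
proof -
  have "points V - (points V - Y) = Y" if "Y \<subseteq> points V" using that by blast
  moreover have "zeros V E \<subseteq> points V" for E by (auto simp: zeros_def)
  ultimately show ?thesis
    unfolding closedin_def topspace_zariski_topology[OF V] openin_zariski_topology[OF V]
    by (metis Diff_subset)
qed

section \<open>Affine varieties\<close>

definition affine_space :: "nat \<Rightarrow> (nat \<Rightarrow> 'k::zero) set" where
  "affine_space m = {v. \<forall>i\<ge>m. v i = 0}"

inductive_set polynomial_functions :: "nat \<Rightarrow> ((nat \<Rightarrow> 'k::comm_ring_1) \<Rightarrow> 'k) set"
  for m :: nat where
  const: "(\<lambda>v. c) \<in> polynomial_functions m"
| coord: "i < m \<Longrightarrow> (\<lambda>v. v i) \<in> polynomial_functions m"
| add: "p \<in> polynomial_functions m \<Longrightarrow> q \<in> polynomial_functions m \<Longrightarrow>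
    (\<lambda>v. p v + q v) \<in> polynomial_functions m"
| mult: "p \<in> polynomial_functions m \<Longrightarrow> q \<in> polynomial_functions m \<Longrightarrow>
    (\<lambda>v. p v * q v) \<in> polynomial_functions m"

definition algebraic_set :: "nat \<Rightarrow> (nat \<Rightarrow> 'k::comm_ring_1) set \<Rightarrow> bool" where
  "algebraic_set m Z \<longleftrightarrow>
     (\<exists>P \<subseteq> polynomial_functions m. Z = {v \<in> affine_space m. \<forall>p\<in>P. p v = 0})"

text \<open>Over an algebraically closed field, a reduced affine scheme of finite type is the same as
  a set of (closed) points with an algebra of functions that is isomorphic, as a space with
  functions, to an algebraic subset of some affine space with the restrictions of polynomial
  functions.\<close>

definition affine_variety :: "('p, 'k::field) fun_space \<Rightarrow> bool" where
  "affine_variety V \<longleftrightarrow>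
     (\<exists>m \<phi>. inj_on \<phi> (points V) \<and> algebraic_set m (\<phi> ` points V) \<and>
        regular V = {restrict (\<lambda>x. p (\<phi> x)) (points V) | p. p \<in> polynomial_functions m})"

lemma fun_algebra_affine_variety:
  assumes "affine_variety V"
  shows "fun_algebra V"
proof -
  from assms obtain m \<phi> where
    R: "regular V = {restrict (\<lambda>x. p (\<phi> x)) (points V) | p. p \<in> polynomial_functions m}"
    unfolding affine_variety_def by blast
  have "restrict (\<lambda>x. f x + g x) (points V) \<in> regular V \<and>
        restrict (\<lambda>x. f x * g x) (points V) \<in> regular V"
    if f: "f \<in> regular V" and g: "g \<in> regular V" for f g
  proof -
    obtain p where p: "f = restrict (\<lambda>x. p (\<phi> x)) (points V)" "p \<in> polynomial_functions m"
      using f unfolding R by blast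
    obtain q where q: "g = restrict (\<lambda>x. q (\<phi> x)) (points V)" "q \<in> polynomial_functions m"
      using g unfolding R by blast
    have "restrict (\<lambda>x. f x + g x) (points V) = restrict (\<lambda>x. p (\<phi> x) + q (\<phi> x)) (points V)"
      "restrict (\<lambda>x. f x * g x) (points V) = restrict (\<lambda>x. p (\<phi> x) * q (\<phi> x)) (points V)"
      by (auto simp: p(1) q(1) restrict_def)
    then show ?thesis
      unfolding R using polynomial_functions.add[OF p(2) q(2)]
        polynomial_functions.mult[OF p(2) q(2)] by auto
  qed
  moreover have "restrict (\<lambda>_. c) (points V) \<in> regular V" for c
    unfolding R using polynomial_functions.const[of c m] by auto
  moreover have "regular V \<subseteq> extensional (points V)" unfolding R by auto
  ultimately show ?thesis unfolding fun_algebra_def by blast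
qed

text \<open>The inclusion of \<open>V\<close> into \<open>W\<close> is a closed embedding.\<close>

definition closed_embedding :: "('p, 'k::field) fun_space \<Rightarrow> ('p, 'k) fun_space \<Rightarrow> bool" where
  "closed_embedding V W \<longleftrightarrow>
     closedin (zariski_topology W) (points V) \<and>
     regular V = (\<lambda>f. restrict f (points V)) ` regular W"

section \<open>Irreducible components and local dimension\<close>

definition irreducible_in :: "'p topology \<Rightarrow> 'p set \<Rightarrow> bool" where
  "irreducible_in T S \<longleftrightarrow> S \<subseteq> topspace T \<and> S \<noteq> {} \<and>
     (\<forall>A B. closedin T A \<longrightarrow> closedin T B \<longrightarrow> S \<subseteq> A \<union> B \<longrightarrow> S \<subseteq> A \<or> S \<subseteq> B)"

definition irreducible_components :: "'p topology \<Rightarrow> 'p set set" where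
  "irreducible_components T =
     {C. irreducible_in T C \<and> (\<forall>D. irreducible_in T D \<longrightarrow> C \<subseteq> D \<longrightarrow> D = C)}"

text \<open>The value for the empty space is \<open>0\<close>; irreducible components are never empty.\<close>

definition krull_dim :: "'p topology \<Rightarrow> enat" where
  "krull_dim T = Sup {enat n | n. \<exists>Z :: nat \<Rightarrow> 'p set.
     (\<forall>i\<le>n. closedin T (Z i) \<and> irreducible_in T (Z i)) \<and> (\<forall>i<n. Z i \<subset> Z (Suc i))}"

definition local_dim :: "('p, 'k::field) fun_space \<Rightarrow> 'p \<Rightarrow> enat" where
  "local_dim V x =
     Sup {krull_dim (subtopology (zariski_topology V) C) | C.
       C \<in> irreducible_components (zariski_topology V) \<and> x \<in> C}"

section \<open>Local rings and normality\<close>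

definition loc_rel :: "('a, 'b) ring_scheme \<Rightarrow> 'a set \<Rightarrow> (('a \<times> 'a) \<times> ('a \<times> 'a)) set" where
  "loc_rel R S = {((a, s), (b, t)). a \<in> carrier R \<and> s \<in> S \<and> b \<in> carrier R \<and> t \<in> S \<and>
     (\<exists>u\<in>S. u \<otimes>\<^bsub>R\<^esub> (t \<otimes>\<^bsub>R\<^esub> a \<ominus>\<^bsub>R\<^esub> s \<otimes>\<^bsub>R\<^esub> b) = \<zero>\<^bsub>R\<^esub>)}"

definition loc_frac :: "('a, 'b) ring_scheme \<Rightarrow> 'a set \<Rightarrow> 'a \<Rightarrow> 'a \<Rightarrow> ('a \<times> 'a) set" where
  "loc_frac R S a s = loc_rel R S `` {(a, s)}"

definition localization :: "('a, 'b) ring_scheme \<Rightarrow> 'a set \<Rightarrow> ('a \<times> 'a) set ring" where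
  "localization R S =
     \<lparr>carrier = (carrier R \<times> S) // loc_rel R S,
      monoid.mult = (\<lambda>X Y. \<Union>(a, s)\<in>X. \<Union>(b, t)\<in>Y. loc_frac R S (a \<otimes>\<^bsub>R\<^esub> b) (s \<otimes>\<^bsub>R\<^esub> t)),
      one = loc_frac R S \<one>\<^bsub>R\<^esub> \<one>\<^bsub>R\<^esub>,
      zero = loc_frac R S \<zero>\<^bsub>R\<^esub> \<one>\<^bsub>R\<^esub>,
      add = (\<lambda>X Y. \<Union>(a, s)\<in>X. \<Union>(b, t)\<in>Y.
               loc_frac R S (t \<otimes>\<^bsub>R\<^esub> a \<oplus>\<^bsub>R\<^esub> s \<otimes>\<^bsub>R\<^esub> b) (s \<otimes>\<^bsub>R\<^esub> t))\<rparr>"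

lemma (in cring) add_fractions_aux:
  assumes uc: "a \<in> carrier R" "a' \<in> carrier R" "b \<in> carrier R" "b' \<in> carrier R"
    "s \<in> carrier R" "s' \<in> carrier R" "u \<in> carrier R" "t \<in> carrier R"  "t' \<in> carrier R" "v \<in> carrier R"
  shows "(u \<otimes> v) \<otimes> ((s' \<otimes> t') \<otimes> (t \<otimes> a \<oplus> s \<otimes> b) \<ominus> (s \<otimes> t) \<otimes> (t' \<otimes> a' \<oplus> s' \<otimes> b')) =
      v \<otimes> t' \<otimes> t \<otimes> (u \<otimes> (s' \<otimes> a \<ominus> s \<otimes> a')) \<oplus> u \<otimes> s \<otimes> s' \<otimes> (v \<otimes> (t' \<otimes> b \<ominus> t \<otimes> b'))" (is "?l=?r")
proof -
  have 1: "(s' \<otimes> t') \<otimes> (t \<otimes> a \<oplus> s \<otimes> b) =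
      (t' \<otimes> t) \<otimes> (s' \<otimes> a) \<oplus> (s \<otimes> s') \<otimes> (t' \<otimes> b)"
    using uc by (simp add: r_distr m_ac)
  have 2: "(s \<otimes> t) \<otimes> (t' \<otimes> a' \<oplus> s' \<otimes> b') =
      (t' \<otimes> t) \<otimes> (s \<otimes> a') \<oplus> (s \<otimes> s') \<otimes> (t \<otimes> b')"
    using uc by (simp add: r_distr m_ac)
  have 3: "(X \<otimes> P \<oplus> Y \<otimes> P') \<ominus> (X \<otimes> Q \<oplus> Y \<otimes> Q') = X \<otimes> (P \<ominus> Q) \<oplus> Y \<otimes> (P' \<ominus> Q')"
    if "X \<in> carrier R" "Y \<in> carrier R" "P \<in> carrier R" "Q \<in> carrier R" "P' \<in> carrier R" "Q' \<in> carrier R" for X Y P Q P' Q'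
    using that by algebra
  have 4: "(u \<otimes> v) \<otimes> (X \<otimes> D \<oplus> Y \<otimes> E) = v \<otimes> X \<otimes> (u \<otimes> D) \<oplus> u \<otimes> Y \<otimes> (v \<otimes> E)"
    if "X \<in> carrier R" "Y \<in> carrier R" "D \<in> carrier R" "E \<in> carrier R" for X Y D E
    using that uc(7,10) by (simp add: r_distr m_ac)
  have "?l = (u \<otimes> v) \<otimes> (t' \<otimes> t \<otimes> (s' \<otimes> a \<ominus> s \<otimes> a') \<oplus> s \<otimes> s' \<otimes> (t' \<otimes> b \<ominus> t \<otimes> b'))"
    unfolding 1 2 using uc by (subst 3) simp_all
  also have "\<dots> = ?r" using uc by (subst 4) (simp_all add: m_assoc)
  finally show ?thesis .
qed

locale mult_set = cring R for R (structure) +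
  fixes S
  assumes S_sub: "S \<subseteq> carrier R"
    and one_S: "\<one> \<in> S"
    and mult_S: "\<lbrakk>s \<in> S; t \<in> S\<rbrakk> \<Longrightarrow> s \<otimes> t \<in> S"
begin

lemma S_carr: "s \<in> S \<Longrightarrow> s \<in> carrier R"
  using S_sub by blast

lemma equiv_loc_rel: "equiv (carrier R \<times> S) (loc_rel R S)"
proof (rule equivI)
  show "refl_on (carrier R \<times> S) (loc_rel R S)"
    using one_S by (auto simp: refl_on_def loc_rel_def S_carr m_comm r_neg minus_eq intro!: bexI[of _ \<one>])
  show "sym (loc_rel R S)"
  proof (rule symI, clarify)
    fix a s b t assume "((a, s), (b, t)) \<in> loc_rel R S"
    then obtain u where u: "a \<in> carrier R" "s \<in> S" "b \<in> carrier R" "t \<in> S" "u \<in> S"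
      "u \<otimes> (t \<otimes> a \<ominus> s \<otimes> b) = \<zero>" by (auto simp: loc_rel_def)
    have "u \<otimes> (s \<otimes> b \<ominus> t \<otimes> a) = \<ominus> (u \<otimes> (t \<otimes> a \<ominus> s \<otimes> b))"
      using u(1-5) S_carr by algebra
    then show "((b, t), (a, s)) \<in> loc_rel R S" using u by (auto simp: loc_rel_def)
  qed
  show "trans (loc_rel R S)"
  proof (rule transI, clarify)
    fix a s b t c r assume "((a, s), (b, t)) \<in> loc_rel R S" "((b, t), (c, r)) \<in> loc_rel R S"
    then obtain u v where u: "a \<in> carrier R" "s \<in> S" "b \<in> carrier R" "t \<in> S" "u \<in> S"
      "c \<in> carrier R" "r \<in> S" "v \<in> S"
      and e: "u \<otimes> (t \<otimes> a \<ominus> s \<otimes> b) = \<zero>" "v \<otimes> (r \<otimes> b \<ominus> t \<otimes> c) = \<zero>"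
      by (auto simp: loc_rel_def)
    note uc = u(1,3,6) S_carr[OF u(2)] S_carr[OF u(4)] S_carr[OF u(5)] S_carr[OF u(7)] S_carr[OF u(8)]
    have "(u \<otimes> v \<otimes> t) \<otimes> (r \<otimes> a \<ominus> s \<otimes> c) =
      v \<otimes> r \<otimes> (u \<otimes> (t \<otimes> a \<ominus> s \<otimes> b)) \<oplus> u \<otimes> s \<otimes> (v \<otimes> (r \<otimes> b \<ominus> t \<otimes> c))"
      using uc by algebra
    also have "\<dots> = \<zero>" unfolding e using uc by simp
    finally show "((a, s), (c, r)) \<in> loc_rel R S"
      using u mult_S by (auto simp: loc_rel_def)
  qed
qed (auto simp: loc_rel_def)

lemma loc_frac_eq_iff:
  assumes "a \<in> carrier R" "s \<in> S" "b \<in> carrier R" "t \<in> S"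
  shows "loc_frac R S a s = loc_frac R S b t \<longleftrightarrow> (\<exists>u\<in>S. u \<otimes> (t \<otimes> a \<ominus> s \<otimes> b) = \<zero>)"
  unfolding loc_frac_def using assms
  by (subst eq_equiv_class_iff[OF equiv_loc_rel]) (auto simp: loc_rel_def)

lemma carrier_localization:
  "carrier (localization R S) = {loc_frac R S a s | a s. a \<in> carrier R \<and> s \<in> S}"
  by (auto simp: localization_def quotient_def loc_frac_def)

lemma UN2_loc_frac:
  assumes "\<And>a s a' s' b t b' t'. \<lbrakk>((a, s), (a', s')) \<in> loc_rel R S; ((b, t), (b', t')) \<in> loc_rel R S\<rbrakk>
      \<Longrightarrow> loc_frac R S (p a s b t) (q a s b t) = loc_frac R S (p a' s' b' t') (q a' s' b' t')"
    and "a \<in> carrier R" "s \<in> S" "b \<in> carrier R" "t \<in> S"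
  shows "(\<Union>(a, s)\<in>loc_frac R S a s. \<Union>(b, t)\<in>loc_frac R S b t. loc_frac R S (p a s b t) (q a s b t))
    = loc_frac R S (p a s b t) (q a s b t)"
proof -
  have m: "(a, s) \<in> loc_frac R S a s" "(b, t) \<in> loc_frac R S b t"
    using assms(2-) equiv_class_self[OF equiv_loc_rel] by (auto simp: loc_frac_def)
  have eq: "loc_frac R S (p a' s' b' t') (q a' s' b' t') = loc_frac R S (p a s b t) (q a s b t)"
    if "(a', s') \<in> loc_frac R S a s" "(b', t') \<in> loc_frac R S b t" for a' s' b' t'
    using that assms(1)[of a s a' s' b t b' t'] by (auto simp: loc_frac_def)
  have "(\<Union>(b, t)\<in>loc_frac R S b t. loc_frac R S (p a' s' b t) (q a' s' b t)) =
      loc_frac R S (p a s b t) (q a s b t)" if "(a', s') \<in> loc_frac R S a s" for a' s'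
    by (rule UN_constant_eq[OF m(2)]) (use eq[OF that] in auto)
  then show ?thesis by (intro UN_constant_eq[OF m(1)]) auto
qed

lemma mult_localization:
  assumes "a \<in> carrier R" "s \<in> S" "b \<in> carrier R" "t \<in> S"
  shows "loc_frac R S a s \<otimes>\<^bsub>localization R S\<^esub> loc_frac R S b t = loc_frac R S (a \<otimes> b) (s \<otimes> t)"
proof -
  have "loc_frac R S (a \<otimes> b) (s \<otimes> t) = loc_frac R S (a' \<otimes> b') (s' \<otimes> t')"
    if "((a, s), (a', s')) \<in> loc_rel R S" "((b, t), (b', t')) \<in> loc_rel R S" for a s a' s' b t b' t'
  proof -
    from that obtain u v where u: "a \<in> carrier R" "s \<in> S" "a' \<in> carrier R" "s' \<in> S" "u \<in> S"
      "b \<in> carrier R" "t \<in> S" "b' \<in> carrier R" "t' \<in> S" "v \<in> S"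
      and e: "u \<otimes> (s' \<otimes> a \<ominus> s \<otimes> a') = \<zero>" "v \<otimes> (t' \<otimes> b \<ominus> t \<otimes> b') = \<zero>"
      by (auto simp: loc_rel_def)
    note uc = u(1,3,6,8) S_carr[OF u(2)] S_carr[OF u(4)] S_carr[OF u(5)] S_carr[OF u(7)]
      S_carr[OF u(9)] S_carr[OF u(10)]
    have "(u \<otimes> v) \<otimes> ((s' \<otimes> t') \<otimes> (a \<otimes> b) \<ominus> (s \<otimes> t) \<otimes> (a' \<otimes> b')) =
      v \<otimes> t' \<otimes> b \<otimes> (u \<otimes> (s' \<otimes> a \<ominus> s \<otimes> a')) \<oplus> u \<otimes> s \<otimes> a' \<otimes> (v \<otimes> (t' \<otimes> b \<ominus> t \<otimes> b'))"
      using uc by algebra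
    also have "\<dots> = \<zero>" unfolding e using uc by simp
    finally show ?thesis using u uc mult_S by (subst loc_frac_eq_iff) auto
  qed
  from UN2_loc_frac[of "\<lambda>a s b t. a \<otimes> b" "\<lambda>a s b t. s \<otimes> t", OF this assms]
  show ?thesis by (simp add: localization_def)
qed

lemma add_localization:
  assumes "a \<in> carrier R" "s \<in> S" "b \<in> carrier R" "t \<in> S"
  shows "loc_frac R S a s \<oplus>\<^bsub>localization R S\<^esub> loc_frac R S b t =
    loc_frac R S (t \<otimes> a \<oplus> s \<otimes> b) (s \<otimes> t)"
proof -
  have "loc_frac R S (t \<otimes> a \<oplus> s \<otimes> b) (s \<otimes> t) = loc_frac R S (t' \<otimes> a' \<oplus> s' \<otimes> b') (s' \<otimes> t')"
    if "((a, s), (a', s')) \<in> loc_rel R S" "((b, t), (b', t')) \<in> loc_rel R S" for a s a' s' b t b' t'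
  proof -
    from that obtain u v where u: "a \<in> carrier R" "s \<in> S" "a' \<in> carrier R" "s' \<in> S" "u \<in> S"
      "b \<in> carrier R" "t \<in> S" "b' \<in> carrier R" "t' \<in> S" "v \<in> S"
      and e: "u \<otimes> (s' \<otimes> a \<ominus> s \<otimes> a') = \<zero>" "v \<otimes> (t' \<otimes> b \<ominus> t \<otimes> b') = \<zero>"
      by (auto simp: loc_rel_def)
    note uc = u(1,3,6,8) S_carr[OF u(2)] S_carr[OF u(4)] S_carr[OF u(5)] S_carr[OF u(7)]
      S_carr[OF u(9)] S_carr[OF u(10)]
    have "(u \<otimes> v) \<otimes> ((s' \<otimes> t') \<otimes> (t \<otimes> a \<oplus> s \<otimes> b) \<ominus> (s \<otimes> t) \<otimes> (t' \<otimes> a' \<oplus> s' \<otimes> b')) =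
      v \<otimes> t' \<otimes> t \<otimes> (u \<otimes> (s' \<otimes> a \<ominus> s \<otimes> a')) \<oplus> u \<otimes> s \<otimes> s' \<otimes> (v \<otimes> (t' \<otimes> b \<ominus> t \<otimes> b'))"
      using uc by (intro add_fractions_aux)
    also have "\<dots> = \<zero>" unfolding e using uc by simp
    finally show ?thesis using u uc mult_S by (subst loc_frac_eq_iff) auto
  qed
  from UN2_loc_frac[of "\<lambda>a s b t. t \<otimes> a \<oplus> s \<otimes> b" "\<lambda>a s b t. s \<otimes> t", OF this assms]
  show ?thesis by (simp add: localization_def)
qed

lemma loc_frac_eqI:
  assumes "a \<in> carrier R" "s \<in> S" "b \<in> carrier R" "t \<in> S" "t \<otimes> a = s \<otimes> b"
  shows "loc_frac R S a s = loc_frac R S b t"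
  using assms one_S S_carr by (subst loc_frac_eq_iff) (auto simp: r_neg minus_eq intro!: bexI[of _ \<one>])

lemma cring_localization: "cring (localization R S)"
proof -
  let ?L = "localization R S"
  have one: "\<one>\<^bsub>?L\<^esub> = loc_frac R S \<one> \<one>" and zero: "\<zero>\<^bsub>?L\<^esub> = loc_frac R S \<zero> \<one>"
    by (simp_all add: localization_def)
  have E: "\<exists>a s. x = loc_frac R S a s \<and> a \<in> carrier R \<and> s \<in> S" if "x \<in> carrier ?L" for x
    using that by (auto simp: carrier_localization)
  have I: "loc_frac R S a s \<in> carrier ?L" if "a \<in> carrier R" "s \<in> S" for a s
    using that by (auto simp: carrier_localization)
  note L = mult_localization add_localization one zero I one_S mult_S S_carr
  show ?thesis
  proof (rule cringI[OF abelian_groupI comm_monoidI])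
    fix x y assume "x \<in> carrier ?L" "y \<in> carrier ?L"
    then obtain a s b t where x: "x = loc_frac R S a s" "a \<in> carrier R" "s \<in> S"
      and y: "y = loc_frac R S b t" "b \<in> carrier R" "t \<in> S" using E by meson
    note c = x(2) y(2) S_carr[OF x(3)] S_carr[OF y(3)]
    show "x \<oplus>\<^bsub>?L\<^esub> y \<in> carrier ?L" "x \<otimes>\<^bsub>?L\<^esub> y \<in> carrier ?L" using x y by (simp_all add: L)
    show "x \<otimes>\<^bsub>?L\<^esub> y = y \<otimes>\<^bsub>?L\<^esub> x" using x y by (simp add: L m_comm)
    show "x \<oplus>\<^bsub>?L\<^esub> y = y \<oplus>\<^bsub>?L\<^esub> x" using x y by (simp add: L m_comm a_comm)
  next
    fix x y z assume "x \<in> carrier ?L" "y \<in> carrier ?L" "z \<in> carrier ?L"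
    then obtain a s b t c r where x: "x = loc_frac R S a s" "a \<in> carrier R" "s \<in> S"
      and y: "y = loc_frac R S b t" "b \<in> carrier R" "t \<in> S"
      and z: "z = loc_frac R S c r" "c \<in> carrier R" "r \<in> S" using E by meson
    note c = x(2) y(2) z(2) S_carr[OF x(3)] S_carr[OF y(3)] S_carr[OF z(3)]
    show "x \<otimes>\<^bsub>?L\<^esub> y \<otimes>\<^bsub>?L\<^esub> z = x \<otimes>\<^bsub>?L\<^esub> (y \<otimes>\<^bsub>?L\<^esub> z)" using x y z by (simp add: L m_assoc)
    have "r \<otimes> (t \<otimes> a \<oplus> s \<otimes> b) \<oplus> s \<otimes> t \<otimes> c = t \<otimes> r \<otimes> a \<oplus> s \<otimes> (r \<otimes> b \<oplus> t \<otimes> c)"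
      using c by algebra
    then show "x \<oplus>\<^bsub>?L\<^esub> y \<oplus>\<^bsub>?L\<^esub> z = x \<oplus>\<^bsub>?L\<^esub> (y \<oplus>\<^bsub>?L\<^esub> z)"
      using x y z by (simp add: L m_assoc)
    have "(s \<otimes> r \<otimes> (t \<otimes> r)) \<otimes> ((t \<otimes> a \<oplus> s \<otimes> b) \<otimes> c) =
       (s \<otimes> t \<otimes> r) \<otimes> (t \<otimes> r \<otimes> (a \<otimes> c) \<oplus> s \<otimes> r \<otimes> (b \<otimes> c))"
    proof -
      have "s \<otimes> r \<otimes> (t \<otimes> r) = s \<otimes> t \<otimes> r \<otimes> r" using c by (simp add: m_ac)
      moreover have "t \<otimes> r \<otimes> (a \<otimes> c) \<oplus> s \<otimes> r \<otimes> (b \<otimes> c) = r \<otimes> ((t \<otimes> a \<oplus> s \<otimes> b) \<otimes> c)"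
        using c by algebra
      ultimately show ?thesis using c by (simp add: m_assoc)
    qed
    then have "loc_frac R S ((t \<otimes> a \<oplus> s \<otimes> b) \<otimes> c) (s \<otimes> t \<otimes> r) =
        loc_frac R S (t \<otimes> r \<otimes> (a \<otimes> c) \<oplus> s \<otimes> r \<otimes> (b \<otimes> c)) (s \<otimes> r \<otimes> (t \<otimes> r))"
      using x y z mult_S c by (intro loc_frac_eqI) simp_all
    then show "(x \<oplus>\<^bsub>?L\<^esub> y) \<otimes>\<^bsub>?L\<^esub> z = x \<otimes>\<^bsub>?L\<^esub> z \<oplus>\<^bsub>?L\<^esub> y \<otimes>\<^bsub>?L\<^esub> z"
      unfolding x(1) y(1) z(1) using x(2,3) y(2,3) z(2,3) mult_S c
      by (simp add: mult_localization add_localization)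
  next
    fix x assume "x \<in> carrier ?L"
    then obtain a s where x: "x = loc_frac R S a s" "a \<in> carrier R" "s \<in> S" using E by meson
    show "\<one>\<^bsub>?L\<^esub> \<otimes>\<^bsub>?L\<^esub> x = x" "\<zero>\<^bsub>?L\<^esub> \<oplus>\<^bsub>?L\<^esub> x = x" using x by (simp_all add: L)
    have "s \<otimes> (\<ominus> a) \<oplus> s \<otimes> a = \<zero>" using x(2) S_carr[OF x(3)] by algebra
    then have "loc_frac R S (s \<otimes> (\<ominus> a) \<oplus> s \<otimes> a) (s \<otimes> s) = loc_frac R S \<zero> \<one>"
      using x one_S mult_S S_carr by (intro loc_frac_eqI) simp_all
    then have "loc_frac R S (\<ominus> a) s \<oplus>\<^bsub>?L\<^esub> x = \<zero>\<^bsub>?L\<^esub>"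
      unfolding x(1) zero using x by (subst add_localization) simp_all
    then show "\<exists>y\<in>carrier ?L. y \<oplus>\<^bsub>?L\<^esub> x = \<zero>\<^bsub>?L\<^esub>" using I x by (meson a_inv_closed)
  qed (simp_all add: L)
qed

end

definition fraction_field :: "('a, 'b) ring_scheme \<Rightarrow> ('a \<times> 'a) set ring" where
  "fraction_field R = localization R (carrier R - {\<zero>\<^bsub>R\<^esub>})"

text \<open>The image of \<open>R\<close> in its field of fractions.\<close>

definition integral_fractions :: "('a, 'b) ring_scheme \<Rightarrow> ('a \<times> 'a) set set" where
  "integral_fractions R = (\<lambda>a. loc_frac R (carrier R - {\<zero>\<^bsub>R\<^esub>}) a \<one>\<^bsub>R\<^esub>) ` carrier R"

definition integral_over :: "('a, 'b) ring_scheme \<Rightarrow> 'a set \<Rightarrow> 'a \<Rightarrow> bool" where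
  "integral_over K A z \<longleftrightarrow>
     (\<exists>(n::nat) c. (\<forall>i<n. c i \<in> A) \<and>
        z [^]\<^bsub>K\<^esub> n \<oplus>\<^bsub>K\<^esub> (\<Oplus>\<^bsub>K\<^esub>i\<in>{..<n}. c i \<otimes>\<^bsub>K\<^esub> z [^]\<^bsub>K\<^esub> i) = \<zero>\<^bsub>K\<^esub>)"

definition normal_domain :: "('a, 'b) ring_scheme \<Rightarrow> bool" where
  "normal_domain R \<longleftrightarrow> domain R \<and>
     (\<forall>z \<in> carrier (fraction_field R).
        integral_over (fraction_field R) (integral_fractions R) z \<longrightarrow> z \<in> integral_fractions R)"

definition coordinate_ring :: "('p, 'k::field) fun_space \<Rightarrow> ('p \<Rightarrow> 'k) ring" where
  "coordinate_ring V =
     \<lparr>carrier = regular V,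
      monoid.mult = (\<lambda>f g. restrict (\<lambda>x. f x * g x) (points V)),
      one = restrict (\<lambda>_. 1) (points V),
      zero = restrict (\<lambda>_. 0) (points V),
      add = (\<lambda>f g. restrict (\<lambda>x. f x + g x) (points V))\<rparr>"

lemma cring_coordinate_ring:
  assumes V: "fun_algebra V"
  shows "cring (coordinate_ring V)"
proof -
  let ?p = "points V"
  have neg: "restrict (\<lambda>x. - f x) ?p \<in> regular V" if "f \<in> regular V" for f
  proof -
    have "restrict (\<lambda>x. restrict (\<lambda>_. - 1) ?p x * f x) ?p \<in> regular V"
      using V that unfolding fun_algebra_def by blast
    then show ?thesis by (simp cong: restrict_cong)
  qed
  have ext: "restrict f ?p = f" if "f \<in> regular V" for f
    using V that by (auto simp: fun_algebra_def extensional_restrict)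
  show ?thesis
    by (rule cringI[OF abelian_groupI comm_monoidI])
      (use V neg in \<open>auto simp: coordinate_ring_def fun_algebra_def algebra_simps ext cong: restrict_cong
        intro!: bexI[OF _ neg]\<close>)
qed

lemma mult_set_local_ring:
  assumes V: "fun_algebra V" and x: "x \<in> points V"
  shows "mult_set (coordinate_ring V) {f \<in> regular V. f x \<noteq> 0}"
  using V x unfolding mult_set_def mult_set_axioms_def
  by (auto simp: cring_coordinate_ring) (auto simp: coordinate_ring_def fun_algebra_def)

definition local_ring :: "('p, 'k::field) fun_space \<Rightarrow> 'p \<Rightarrow> (('p \<Rightarrow> 'k) \<times> ('p \<Rightarrow> 'k)) set ring"
  where "local_ring V x = localization (coordinate_ring V) {f \<in> regular V. f x \<noteq> 0}"

definition normal_variety :: "('p, 'k::field) fun_space \<Rightarrow> bool" where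
  "normal_variety V \<longleftrightarrow> (\<forall>x \<in> points V. normal_domain (local_ring V x))"

section \<open>Affine ind-varieties\<close>

text \<open>A filtration; the closed embeddings are taken to be inclusions of subsets of the limit.\<close>

definition affine_ind_variety :: "(nat \<Rightarrow> ('p, 'k::field) fun_space) \<Rightarrow> bool" where
  "affine_ind_variety X \<longleftrightarrow>
     (\<forall>n. affine_variety (X n)) \<and> (\<forall>n. closed_embedding (X n) (X (Suc n)))"

text \<open>Elements of the inverse limit of the rings \<open>regular (X n)\<close> are identified with the
  functions on the union they define; see \<open>bij_betw_inverse_limit\<close> below.\<close>

definition ind_limit :: "(nat \<Rightarrow> ('p, 'k::field) fun_space) \<Rightarrow> ('p, 'k) fun_space" where
  "ind_limit X =
     \<lparr>points = (\<Union>n. points (X n)),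
      regular = {f \<in> extensional (\<Union>n. points (X n)).
                   \<forall>n. restrict f (points (X n)) \<in> regular (X n)}\<rparr>"

text \<open>Characterized by \<open>closedin_ind_topology\<close> below.\<close>

definition ind_topology :: "(nat \<Rightarrow> ('p, 'k::field) fun_space) \<Rightarrow> 'p topology" where
  "ind_topology X =
     topology (\<lambda>U. U \<subseteq> points (ind_limit X) \<and>
       (\<forall>n. closedin (zariski_topology (X n)) ((points (ind_limit X) - U) \<inter> points (X n))))"

lemma points_mono_affine_ind_variety:
  assumes X: "affine_ind_variety X" and "m \<le> n"
  shows "points (X m) \<subseteq> points (X n)"
  using \<open>m \<le> n\<close>
proof (induction n rule: dec_induct)
  case (step n)
  have "fun_algebra (X (Suc n))"
    using X fun_algebra_affine_variety unfolding affine_ind_variety_def by blast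
  moreover have "closedin (zariski_topology (X (Suc n))) (points (X n))"
    using X unfolding affine_ind_variety_def closed_embedding_def by blast
  ultimately have "points (X n) \<subseteq> points (X (Suc n))"
    using closedin_subset topspace_zariski_topology by blast
  then show ?case using step by blast
qed simp

lemma bij_betw_inverse_limit:
  assumes X: "affine_ind_variety X"
  shows "bij_betw (\<lambda>f n. restrict f (points (X n))) (regular (ind_limit X))
           {g. (\<forall>n. g n \<in> regular (X n)) \<and>
               (\<forall>n. restrict (g (Suc n)) (points (X n)) = g n)}"
    (is "bij_betw ?r ?A ?B")
proof (intro bij_betw_imageI subset_antisym subsetI)
  note mono = points_mono_affine_ind_variety[OF X]
  have ext: "regular (X n) \<subseteq> extensional (points (X n))" for n
    using X fun_algebra_affine_variety unfolding affine_ind_variety_def fun_algebra_def by blast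
  show "inj_on ?r ?A"
  proof (rule inj_onI)
    fix f g assume fg: "f \<in> ?A" "g \<in> ?A" "?r f = ?r g"
    show "f = g"
    proof (rule extensionalityI[of _ "\<Union>n. points (X n)"])
      fix x assume "x \<in> (\<Union>n. points (X n))"
      then obtain n where "x \<in> points (X n)" by blast
      then show "f x = g x" using fun_cong[OF fun_cong[OF fg(3), of n], of x] by simp
    qed (use fg in \<open>auto simp: ind_limit_def\<close>)
  qed
  show "g \<in> ?B" if "g \<in> ?r ` ?A" for g
    using that mono[OF le_SucI[OF order_refl]] by (auto simp: ind_limit_def Int_absorb1)
  show "g \<in> ?r ` ?A" if g: "g \<in> ?B" for g
  proof -
    have comp: "g n x = g m x" if "m \<le> n" "x \<in> points (X m)" for m n x
      using that
    proof (induction n rule: dec_induct)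
      case (step n)
      have "g n x = restrict (g (Suc n)) (points (X n)) x" using g by simp
      then show ?case using step mono[of m n] by (auto split: if_splits)
    qed simp
    define f where "f = restrict (\<lambda>x. g (LEAST n. x \<in> points (X n)) x) (\<Union>n. points (X n))"
    have fg: "restrict f (points (X n)) = g n" for n
    proof (rule extensionalityI[of _ "points (X n)"])
      fix x assume x: "x \<in> points (X n)"
      have "g n x = g (LEAST n. x \<in> points (X n)) x"
        by (rule comp) (use x in \<open>auto intro: Least_le LeastI\<close>)
      then show "restrict f (points (X n)) x = g n x" using x by (auto simp: f_def)
    qed (use g ext in auto)
    have "f \<in> ?A" using fg g by (auto simp: ind_limit_def) (simp add: f_def)
    moreover have "g = ?r f" using fg by auto
    ultimately show ?thesis by blast
  qed
qed

lemma fun_algebra_ind_limit: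
  assumes X: "affine_ind_variety X"
  shows "fun_algebra (ind_limit X)"
proof -
  have A: "fun_algebra (X n)" for n
    using X fun_algebra_affine_variety unfolding affine_ind_variety_def by blast
  have "restrict (\<lambda>x. f x + g x) (points (X n)) \<in> regular (X n)"
       "restrict (\<lambda>x. f x * g x) (points (X n)) \<in> regular (X n)"
    if "restrict f (points (X n)) \<in> regular (X n)" "restrict g (points (X n)) \<in> regular (X n)"
    for f g n
  proof -
    have "restrict (\<lambda>x. restrict f (points (X n)) x + restrict g (points (X n)) x) (points (X n))
            = restrict (\<lambda>x. f x + g x) (points (X n))"
      "restrict (\<lambda>x. restrict f (points (X n)) x * restrict g (points (X n)) x) (points (X n))
            = restrict (\<lambda>x. f x * g x) (points (X n))"
      by (auto simp: restrict_def)
    then show "restrict (\<lambda>x. f x + g x) (points (X n)) \<in> regular (X n)"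
       "restrict (\<lambda>x. f x * g x) (points (X n)) \<in> regular (X n)"
      using A[of n] that unfolding fun_algebra_def by metis+
  qed
  moreover have "restrict (\<lambda>_. c) (points (X n)) \<in> regular (X n)" for c n
    using A[of n] unfolding fun_algebra_def by blast
  moreover have "(\<Union>n. points (X n)) \<inter> points (X n) = points (X n)" for n by blast
  ultimately show ?thesis unfolding fun_algebra_def ind_limit_def by (simp add: subset_iff)
qed

lemma istopology_ind_topology:
  assumes X: "affine_ind_variety X"
  shows "istopology (\<lambda>U. U \<subseteq> points (ind_limit X) \<and>
       (\<forall>n. closedin (zariski_topology (X n)) ((points (ind_limit X) - U) \<inter> points (X n))))"
    (is "istopology ?L")
proof -
  have eq: "closedin (zariski_topology (X n)) ((points (ind_limit X) - U) \<inter> points (X n)) \<longleftrightarrow>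
      openin (zariski_topology (X n)) (U \<inter> points (X n))" for n U
  proof -
    have T: "topspace (zariski_topology (X n)) = points (X n)"
      using X fun_algebra_affine_variety topspace_zariski_topology
      unfolding affine_ind_variety_def by blast
    have "points (X n) - (points (ind_limit X) - U) \<inter> points (X n) = U \<inter> points (X n)"
      by (auto simp: ind_limit_def)
    then show ?thesis unfolding closedin_def T by auto
  qed
  show ?thesis unfolding eq istopology_def
  proof (intro conjI allI impI, goal_cases)
    case (2 S T n)
    then have "openin (zariski_topology (X n)) ((S \<inter> points (X n)) \<inter> (T \<inter> points (X n)))"
      by blast
    then show ?case by (simp add: Int_ac)
  next
    case (4 K n)
    then have "openin (zariski_topology (X n)) (\<Union>U\<in>K. U \<inter> points (X n))" by blast
    then show ?case by (simp add: Int_commute Int_Union)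
  qed blast+
qed

lemma topspace_ind_topology:
  assumes X: "affine_ind_variety X"
  shows "topspace (ind_topology X) = points (ind_limit X)"
proof -
  have "openin (ind_topology X) (points (ind_limit X))"
    unfolding ind_topology_def topology_inverse'[OF istopology_ind_topology[OF X]] by simp
  moreover have "U \<subseteq> points (ind_limit X)" if "openin (ind_topology X) U" for U
    using that unfolding ind_topology_def topology_inverse'[OF istopology_ind_topology[OF X]]
    by blast
  ultimately show ?thesis unfolding topspace_def by blast
qed

lemma closedin_ind_topology:
  assumes X: "affine_ind_variety X"
  shows "closedin (ind_topology X) Y \<longleftrightarrow> Y \<subseteq> points (ind_limit X) \<and>
           (\<forall>n. closedin (zariski_topology (X n)) (Y \<inter> points (X n)))"
proof (cases "Y \<subseteq> points (ind_limit X)")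
  case True
  then have "points (ind_limit X) - (points (ind_limit X) - Y) = Y" by blast
  then show ?thesis
    unfolding closedin_def[of "ind_topology X"] topspace_ind_topology[OF X]
    unfolding ind_topology_def topology_inverse'[OF istopology_ind_topology[OF X]] by simp
qed (simp add: closedin_def topspace_ind_topology[OF X])

end

(* If the local dimension at x is bounded, the component of X_n through x becomes stationary; normality
   makes the components of X_n disjoint, hence clopen, so functions extend by zero from the stationary
   component and every ind-closed set is cut out by regular functions.

   Otherwise the components through x form a strictly increasing sequence V_0, V_1, ... Take an
   irreducible curve G in V_0 and let S_k be minimal among the irreducible closed subsets of X_{k+1} that
   contain G but are not contained in X_k. By Krull's principal ideal theorem G is a component of the zero
   set on S_k of some y_k that vanishes on X_k. As k is uncountable, G has a point p that is general for
   all k at once. For b in O(X) with b(p) = 0 and b not identically zero on G, the set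
   Y = {b = 0} u U_k {z in X_{k+1} : b^{N_k} + y_k = 0} is ind-closed. For N_k growing fast enough the k-th
   hypersurface is so tangent to G at p that each regular function vanishing on Y vanishes on G; but G is
   not contained in Y. *)
theory Submission
  imports Defs "HOL-Library.Function_Algebras"
begin

section \<open>Noetherian subrings\<close>

text \<open>No quotient or localization of a coordinate ring is formed for the dimension theory.
  Regular functions are total functions in a subring \<open>R\<close> of the ring of all functions;
  an ideal \<open>P0\<close> takes the place of zero in a quotient, and factors \<open>t\<close>
  outside a prime take the place of units in a localization. The Nullstellensatz is proved by the
  uncountability argument: uncountably many inverses cannot be independent in a space of countable
  dimension. Boundedness also follows back from stationarity, since the dimension of an affine
  variety is at most the number of its generators. The obstacle in the unbounded case is that the
  functions vanishing on Y are unknown when Y is built. On G, near p, such a function divides some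
  b^M, but M depends on the function. The exponents therefore diagonalize: let t_k be nonzero at p
  and let c_k be an exponent such that (t_k g)^{c_k} is a multiple of y_k on S_k for every g
  vanishing on G. Tangency at step k then gives N_k \<le> c_k M, and N_k = c_k k + 1 contradicts
  this at k = M. That p is general means that no t_k vanishes at p.\<close>

locale subring_of =
  fixes R :: "'a::comm_ring_1 set"
  assumes one_closed: "1 \<in> R"
    and diff_closed: "x \<in> R \<Longrightarrow> y \<in> R \<Longrightarrow> x - y \<in> R"
    and mult_closed: "x \<in> R \<Longrightarrow> y \<in> R \<Longrightarrow> x * y \<in> R"
begin

lemma zero_closed: "0 \<in> R"
  using diff_closed[OF one_closed one_closed] by simp

lemma uminus_closed: "x \<in> R \<Longrightarrow> - x \<in> R"
  using diff_closed[OF zero_closed] by simp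

lemma add_closed: "x \<in> R \<Longrightarrow> y \<in> R \<Longrightarrow> x + y \<in> R"
  using diff_closed[OF _ uminus_closed, of x y] by simp

lemma power_closed: "x \<in> R \<Longrightarrow> x ^ n \<in> R"
  by (induction n) (auto intro: one_closed mult_closed)

lemma sum_closed: "(\<And>i. i \<in> A \<Longrightarrow> f i \<in> R) \<Longrightarrow> sum f A \<in> R"
  by (induction A rule: infinite_finite_induct) (auto intro: zero_closed add_closed)

lemma prod_closed: "(\<And>i. i \<in> A \<Longrightarrow> f i \<in> R) \<Longrightarrow> prod f A \<in> R"
  by (induction A rule: infinite_finite_induct) (auto intro: one_closed mult_closed)

lemmas closed = zero_closed one_closed diff_closed mult_closed uminus_closed add_closed power_closed

end

section \<open>Ideals of a subring and their generators\<close>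

definition ideal_in :: "'a::comm_ring_1 set \<Rightarrow> 'a set \<Rightarrow> bool" where
  "ideal_in R I \<longleftrightarrow>
     I \<subseteq> R \<and> 0 \<in> I \<and> (\<forall>x\<in>I. \<forall>y\<in>I. x + y \<in> I) \<and> (\<forall>r\<in>R. \<forall>x\<in>I. r * x \<in> I)"

text \<open>The coefficient set need not be a ring: with an ideal \<open>Q\<close> in its place this
  is the product of \<open>Q\<close> with the ideal generated by \<open>B\<close>, the form needed
  for Nakayama's lemma and for powers of a prime.\<close>

inductive_set ideal_gen :: "'a::comm_ring_1 set \<Rightarrow> 'a set \<Rightarrow> 'a set" for R B where
  zero: "0 \<in> ideal_gen R B"
| step: "x \<in> ideal_gen R B \<Longrightarrow> r \<in> R \<Longrightarrow> b \<in> B \<Longrightarrow> r * b + x \<in> ideal_gen R B"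

definition noetherian :: "'a::comm_ring_1 set \<Rightarrow> bool" where
  "noetherian R \<longleftrightarrow> (\<forall>I. ideal_in R I \<longrightarrow> (\<exists>B. finite B \<and> B \<subseteq> I \<and> I \<subseteq> ideal_gen R B))"

definition prime_in :: "'a::comm_ring_1 set \<Rightarrow> 'a set \<Rightarrow> bool" where
  "prime_in R P \<longleftrightarrow> ideal_in R P \<and> 1 \<notin> P \<and> (\<forall>a\<in>R. \<forall>b\<in>R. a * b \<in> P \<longrightarrow> a \<in> P \<or> b \<in> P)"

lemma ideal_inD:
  assumes "ideal_in R I"
  shows "x \<in> I \<Longrightarrow> x \<in> R" "0 \<in> I" "x \<in> I \<Longrightarrow> y \<in> I \<Longrightarrow> x + y \<in> I"
    "r \<in> R \<Longrightarrow> x \<in> I \<Longrightarrow> r * x \<in> I"  "r \<in> R \<Longrightarrow> x \<in> I \<Longrightarrow> x * r \<in> I"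
  using assms by (auto simp: ideal_in_def mult.commute)

lemma ideal_gen_least:
  assumes "ideal_in R I" "B \<subseteq> I"
  shows "ideal_gen R B \<subseteq> I"
proof
  fix x assume "x \<in> ideal_gen R B"
  then show "x \<in> I"
    by induction (use assms in \<open>auto simp: ideal_in_def\<close>)
qed

lemma ideal_gen_mono:
  assumes "B \<subseteq> B'"
  shows "ideal_gen R B \<subseteq> ideal_gen R B'"
proof
  fix x assume "x \<in> ideal_gen R B"
  then show "x \<in> ideal_gen R B'"
    by induction (use assms in \<open>auto intro: ideal_gen.intros\<close>)
qed

text \<open>Only \<open>0\<close> and sums are required of \<open>R\<close>, so that the lemma also
  applies to coefficients from an ideal.\<close>

lemma ideal_gen_insertE:
  assumes "x \<in> ideal_gen R (insert b B)" "0 \<in> R" "\<And>x y. x \<in> R \<Longrightarrow> y \<in> R \<Longrightarrow> x + y \<in> R"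
  obtains r y where "r \<in> R" "y \<in> ideal_gen R B" "x = r * b + y"
proof -
  have "\<exists>r y. r \<in> R \<and> y \<in> ideal_gen R B \<and> x = r * b + y"
    using assms(1)
  proof induction
    case zero
    then show ?case by (intro exI[of _ 0]) (auto intro: assms ideal_gen.zero)
  next
    case (step x r b')
    then obtain s y where sy: "s \<in> R" "y \<in> ideal_gen R B" "x = s * b + y" by blast
    show ?case
    proof (cases "b' = b")
      case True
      then have "r * b' + x = (r + s) * b + y" by (simp add: sy algebra_simps)
      then show ?thesis using sy step assms(3) by blast
    next
      case False
      then have "r * b' + y \<in> ideal_gen R B"
        using sy step by (intro ideal_gen.step) auto
      moreover have "r * b' + x = s * b + (r * b' + y)" by (simp add: sy algebra_simps)
      ultimately show ?thesis using sy by blast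
    qed
  qed
  then show ?thesis using that by blast
qed

context subring_of
begin

lemma ideal_gen_ideal:
  assumes "B \<subseteq> R"
  shows "ideal_in R (ideal_gen R B)"
proof -
  have "x \<in> R" if "x \<in> ideal_gen R B" for x
    using that by induction (use assms in \<open>auto intro: closed\<close>)
  moreover have "x + y \<in> ideal_gen R B" if "x \<in> ideal_gen R B" "y \<in> ideal_gen R B" for x y
    using that by (induction) (auto simp: add.assoc intro: ideal_gen.intros)
  moreover have "r * x \<in> ideal_gen R B" if "x \<in> ideal_gen R B" "r \<in> R" for x r
    using that
  proof (induction)
    case (step x s b)
    then have "(r * s) * b + r * x \<in> ideal_gen R B"
      by (intro ideal_gen.step) (auto intro: closed)
    then show ?case by (simp add: algebra_simps)
  qed (auto intro: ideal_gen.intros)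
  ultimately show ?thesis unfolding ideal_in_def by (auto intro: ideal_gen.zero)
qed

lemma ideal_gen_incl: "b \<in> B \<Longrightarrow> b \<in> ideal_gen R B"
  using ideal_gen.step[OF ideal_gen.zero one_closed, of b B] by simp

lemma ideal_diff: "ideal_in R I \<Longrightarrow> x \<in> I \<Longrightarrow> y \<in> I \<Longrightarrow> x - y \<in> I"
  using ideal_inD(3)[of R I x "- y"] ideal_inD(4)[of R I "- 1" y] uminus_closed[OF one_closed]
  by simp

lemma ideal_sum: "ideal_in R I \<Longrightarrow> (\<And>i. i \<in> A \<Longrightarrow> f i \<in> I) \<Longrightarrow> sum f A \<in> I"
  by (induction A rule: infinite_finite_induct) (auto dest: ideal_inD)

lemma ideal_in_add_principal:
  assumes "ideal_in R I" "z \<in> R"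
  shows "ideal_in R {x + z * r | x r. x \<in> I \<and> r \<in> R}"
  unfolding ideal_in_def
proof (intro conjI ballI)
  show "{x + z * r | x r. x \<in> I \<and> r \<in> R} \<subseteq> R"
    using assms by (auto intro!: closed dest: ideal_inD)
  show "0 \<in> {x + z * r | x r. x \<in> I \<and> r \<in> R}"
    using ideal_inD(2)[OF assms(1)] zero_closed by force
next
  fix a b assume "a \<in> {x + z * r | x r. x \<in> I \<and> r \<in> R}" "b \<in> {x + z * r | x r. x \<in> I \<and> r \<in> R}"
  then obtain x r y s where "a = x + z * r" "b = y + z * s" "x \<in> I" "y \<in> I" "r \<in> R" "s \<in> R" by blast
  then have "a + b = (x + y) + z * (r + s)" "x + y \<in> I" "r + s \<in> R"
    using assms by (auto simp: algebra_simps intro: closed dest: ideal_inD)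
  then show "a + b \<in> {x + z * r | x r. x \<in> I \<and> r \<in> R}" by blast
next
  fix t a assume t: "t \<in> R" and "a \<in> {x + z * r | x r. x \<in> I \<and> r \<in> R}"
  then obtain x r where "a = x + z * r" "x \<in> I" "r \<in> R" by blast
  then have "t * a = t * x + z * (t * r)" "t * x \<in> I" "t * r \<in> R"
    using assms t by (auto simp: algebra_simps intro: closed dest: ideal_inD)
  then show "t * a \<in> {x + z * r | x r. x \<in> I \<and> r \<in> R}" by blast
qed

lemma add_principal_incl: "I \<subseteq> {x + z * r | x r. x \<in> I \<and> r \<in> R}"
proof
  fix x assume "x \<in> I"
  then have "x = x + z * 0 \<and> x \<in> I \<and> 0 \<in> R" using zero_closed by simp
  then show "x \<in> {x + z * r | x r. x \<in> I \<and> r \<in> R}" by blast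
qed

lemma add_principal_mem:
  assumes "ideal_in R I"
  shows "z \<in> {x + z * r | x r. x \<in> I \<and> r \<in> R}"
proof -
  have "z = 0 + z * 1 \<and> 0 \<in> I \<and> 1 \<in> R" using one_closed ideal_inD(2)[OF assms] by simp
  then show ?thesis by blast
qed

lemma ideal_power_mono:
  assumes "ideal_in R I" "x \<in> R" "x ^ m \<in> I" "m \<le> n"
  shows "x ^ n \<in> I"
  using ideal_inD(4)[OF assms(1) power_closed[OF assms(2), of "n - m"] assms(3)] assms(4)
  by (simp add: power_add[symmetric])

lemma ideal_power_add:
  assumes I: "ideal_in R I" and "x \<in> R" "y \<in> R" "x ^ m \<in> I" "y ^ n \<in> I"
  shows "(x + y) ^ (m + n) \<in> I"
  unfolding binomial_ring
proof (rule ideal_sum[OF I])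
  fix i
  have N: "of_nat j \<in> R" for j by (induction j) (auto intro: closed)
  show "of_nat (m + n choose i) * x ^ i * y ^ (m + n - i) \<in> I"
  proof (cases "i \<ge> m")
    case True
    then have "x ^ i \<in> I" using ideal_power_mono assms by blast
    then show ?thesis using N assms by (intro ideal_inD(5)[OF I] ideal_inD(4)[OF I]) (auto intro: closed)
  next
    case False
    then have "y ^ (m + n - i) \<in> I" using ideal_power_mono[OF I, of y n] assms by simp
    then show ?thesis using N assms by (intro ideal_inD(4)[OF I]) (auto intro: closed)
  qed
qed

text \<open>The exponents of finitely many generators add up to one that serves the whole ideal.
  This later yields an exponent that is independent of the function to which it is applied.\<close>

lemma uniform_power:
  assumes I: "ideal_in R I" and "finite B" "B \<subseteq> R" "\<And>b. b \<in> B \<Longrightarrow> \<exists>n. (s * b) ^ n \<in> I" and s: "s \<in> R"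
  shows "\<exists>n. \<forall>x\<in>ideal_gen R B. (s * x) ^ n \<in> I"
  using assms(2-4)
proof (induction B)
  case empty
  have "x = 0" if "x \<in> ideal_gen R {}" for x using that by induction auto
  \<comment> \<open>Exponent 1 and not 0, since the zeroth power is \<open>1\<close>, which may lie
    outside \<open>I\<close>.\<close>
  then show ?case using ideal_inD(2)[OF I] by (intro exI[of _ 1]) fastforce
next
  case (insert b B)
  then obtain n where n: "\<And>x. x \<in> ideal_gen R B \<Longrightarrow> (s * x) ^ n \<in> I" by auto
  obtain m where m: "(s * b) ^ m \<in> I" using insert.prems(2)[of b] by blast
  have "(s * x) ^ (m + n) \<in> I" if x: "x \<in> ideal_gen R (insert b B)" for x
  proof -
    obtain r y where ry: "r \<in> R" "y \<in> ideal_gen R B" "x = r * b + y"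
      using ideal_gen_insertE[OF x zero_closed add_closed] .
    have yR: "y \<in> R" using ideal_gen_ideal[of B] ry insert.prems ideal_inD by blast
    have "(r * (s * b)) ^ m \<in> I" unfolding power_mult_distrib[of r]
      using ideal_inD(4)[OF I power_closed[OF ry(1)] m] .
    then have "(r * (s * b) + s * y) ^ (m + n) \<in> I"
      using ry n s yR insert.prems by (intro ideal_power_add[OF I]) (auto intro: closed)
    then show ?thesis by (simp add: ry algebra_simps)
  qed
  then show ?case by blast
qed

lemma noetherian_chain:
  assumes "noetherian R" and I: "\<And>n::nat. ideal_in R (I n)" and inc: "\<And>n. I n \<subseteq> I (Suc n)"
  shows "\<exists>n. \<forall>m\<ge>n. I m = I n"
proof -
  have mono: "m \<le> n \<Longrightarrow> I m \<subseteq> I n" for m n using inc by (rule lift_Suc_mono_le)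
  have "ideal_in R (\<Union>n. I n)"
    unfolding ideal_in_def
  proof (intro conjI ballI)
    fix x y assume "x \<in> (\<Union>n. I n)" "y \<in> (\<Union>n. I n)"
    then obtain m n where "x \<in> I m" "y \<in> I n" by blast
    then have "x \<in> I (max m n)" "y \<in> I (max m n)"
      using mono[of m "max m n"] mono[of n "max m n"] by auto
    then show "x + y \<in> (\<Union>n. I n)" using ideal_inD(3)[OF I] by blast
  next
    fix r x assume "r \<in> R" "x \<in> (\<Union>n. I n)"
    then show "r * x \<in> (\<Union>n. I n)" using ideal_inD(4)[OF I] by fast
  next
    show "(\<Union>n. I n) \<subseteq> R" using ideal_inD(1)[OF I] by fast
    show "0 \<in> (\<Union>n. I n)" using ideal_inD(2)[OF I] by fast
  qed
  then obtain B where B: "finite B" "B \<subseteq> (\<Union>n. I n)" "(\<Union>n. I n) \<subseteq> ideal_gen R B"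
    using assms(1) unfolding noetherian_def by meson
  have "\<exists>n. B \<subseteq> I n" using B(1,2)
  proof (induction B)
    case (insert b B)
    then obtain m n where "B \<subseteq> I m" "b \<in> I n" by auto
    then have "insert b B \<subseteq> I (max m n)"
      using mono[of m "max m n"] mono[of n "max m n"] by auto
    then show ?case by blast
  qed auto
  then obtain n where "B \<subseteq> I n" by blast
  then have "(\<Union>n. I n) \<subseteq> I n" using ideal_gen_least[OF I] B(3) by (meson subset_trans)
  then have "I m = I n" if "m \<ge> n" for m using mono[OF that] by blast
  then show ?thesis by blast
qed

lemma noetherian_maximal:
  assumes "noetherian R" and F: "\<And>I. I \<in> F \<Longrightarrow> ideal_in R I" and "I0 \<in> F"
  obtains M where "M \<in> F" "\<And>I. I \<in> F \<Longrightarrow> M \<subseteq> I \<Longrightarrow> I = M"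
proof (rule ccontr)
  assume "\<not> thesis"
  then have "\<forall>M\<in>F. \<exists>I\<in>F. M \<subset> I" using that by blast
  then obtain g where g: "\<And>M. M \<in> F \<Longrightarrow> g M \<in> F \<and> M \<subset> g M" by metis
  define I where "I n = (g ^^ n) I0" for n
  have IF: "I n \<in> F" for n by (induction n) (auto simp: I_def assms g)
  have "I n \<subset> I (Suc n)" for n using g[OF IF[of n]] by (simp add: I_def)
  moreover have "\<exists>n. \<forall>m\<ge>n. I m = I n"
    by (rule noetherian_chain[OF assms(1)]) (use F IF calculation in auto)
  ultimately show False by (metis le_SucI order_refl psubset_eq)
qed

end

subsection \<open>Hilbert's basis theorem\<close>

text \<open>Generators of the preimage of an ideal map to generators of the ideal. Used to pass from
  polynomial functions to their pullbacks.\<close>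

lemma noetherian_image:
  assumes "subring_of R" "noetherian R"
    and h: "\<And>x y. x \<in> R \<Longrightarrow> y \<in> R \<Longrightarrow> h (x + y) = h x + h y"
      "\<And>x y. x \<in> R \<Longrightarrow> y \<in> R \<Longrightarrow> h (x * y) = h x * h y"
  shows "noetherian (h ` R)"
  unfolding noetherian_def
proof (intro allI impI)
  interpret subring_of R by fact
  have h0: "h 0 = 0" using h(1)[OF zero_closed zero_closed] by simp
  fix I assume I: "ideal_in (h ` R) I"
  have "ideal_in R {x \<in> R. h x \<in> I}"
    using I unfolding ideal_in_def by (auto simp: h h0 closed)
  then obtain B where B: "finite B" "B \<subseteq> {x \<in> R. h x \<in> I}" "{x \<in> R. h x \<in> I} \<subseteq> ideal_gen R B"
    using assms(2) unfolding noetherian_def by meson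
  have "x \<in> R \<and> h x \<in> ideal_gen (h ` R) (h ` B)" if "x \<in> ideal_gen R B" for x
    using that
  proof induction
    case (step x r b)
    moreover have "b \<in> R" using B step by auto
    ultimately show ?case by (auto simp: h closed intro!: ideal_gen.step)
  qed (auto simp: h0 closed intro: ideal_gen.zero)
  then have "I \<subseteq> ideal_gen (h ` R) (h ` B)"
    using B(3) ideal_inD(1)[OF I] by fastforce
  then show "\<exists>B. finite B \<and> B \<subseteq> I \<and> I \<subseteq> ideal_gen (h ` R) B"
    using B by (intro exI[of _ "h ` B"]) auto
qed

text \<open>The subring \<open>R[x]\<close> of the ambient ring. Since \<open>x\<close> may satisfy
  relations over \<open>R\<close>, the polynomial that represents an element is not unique.\<close>

definition adjoin :: "'a::comm_ring_1 set \<Rightarrow> 'a \<Rightarrow> 'a set" where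
  "adjoin R x = {poly p x | p. \<forall>i. coeff p i \<in> R}"

context subring_of
begin

lemma coeffs_mult_closed:
  "(\<And>i. coeff p i \<in> R) \<Longrightarrow> (\<And>i. coeff q i \<in> R) \<Longrightarrow> coeff (p * q) i \<in> R"
  by (auto simp: coeff_mult intro!: sum_closed closed)

lemma subring_of_adjoin: "subring_of (adjoin R x)"
proof
  show "1 \<in> adjoin R x"
    unfolding adjoin_def by (rule CollectI, rule exI[of _ 1]) (auto intro: closed simp: coeff_1)
next
  fix a b assume "a \<in> adjoin R x" "b \<in> adjoin R x"
  then obtain p q where pq: "a = poly p x" "b = poly q x" "\<And>i. coeff p i \<in> R" "\<And>i. coeff q i \<in> R"
    unfolding adjoin_def by blast
  show "a - b \<in> adjoin R x"
    unfolding adjoin_def by (rule CollectI, rule exI[of _ "p - q"]) (auto intro: closed simp: pq)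
  show "a * b \<in> adjoin R x"
    unfolding adjoin_def
    by (rule CollectI, rule exI[of _ "p * q"]) (auto intro: coeffs_mult_closed simp: pq)
qed

text \<open>Hilbert's argument with generators of minimal degree. As elements of
  \<open>adjoin R x\<close> have no degree, the argument runs over the representing polynomials in
  \<open>J\<close>, and only membership is tested on their values at \<open>x\<close>.\<close>

theorem noetherian_adjoin:
  assumes "noetherian R"
  shows "noetherian (adjoin R x)"
  unfolding noetherian_def
proof (intro allI impI, rule ccontr)
  fix I assume I: "ideal_in (adjoin R x) I"
    and nfg: "\<nexists>B. finite B \<and> B \<subseteq> I \<and> I \<subseteq> ideal_gen (adjoin R x) B"
  interpret A: subring_of "adjoin R x" by (rule subring_of_adjoin)
  define J where "J = {p. (\<forall>i. coeff p i \<in> R) \<and> poly p x \<in> I}"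
  define G where "G S = ideal_gen (adjoin R x) ((\<lambda>p. poly p x) ` S)" for S
  \<comment> \<open>The next generator: of least degree among the polynomials whose value is in
    \<open>I\<close> but not yet in the ideal generated by the values of \<open>S\<close>.\<close>
  define ok where
    "ok S p \<longleftrightarrow> p \<in> J \<and> poly p x \<notin> G S \<and> (\<forall>q\<in>J. poly q x \<notin> G S \<longrightarrow> degree p \<le> degree q)" for S p
  have ex: "\<exists>p. ok S p" if "finite S" "S \<subseteq> J" for S
  proof -
    have "(\<lambda>p. poly p x) ` S \<subseteq> I" using that by (auto simp: J_def)
    then have "\<not> I \<subseteq> G S" using nfg that unfolding G_def by blast
    then obtain y where y: "y \<in> I" "y \<notin> G S" by blast
    then have "y \<in> adjoin R x" using I by (auto dest: ideal_inD)
    then have "\<exists>p. p \<in> J \<and> poly p x \<notin> G S" using y unfolding adjoin_def J_def by blast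
    then show ?thesis unfolding ok_def
      using exists_least_iff[of "\<lambda>n. \<exists>p. p \<in> J \<and> poly p x \<notin> G S \<and> degree p = n"]
      by (metis not_less)
  qed
  \<comment> \<open>Each choice depends on all earlier ones, hence a recursion on the list of
    choices made so far, newest first.\<close>
  define P where "P = rec_nat [] (\<lambda>_ ps. (SOME p. ok (set ps) p) # ps)"
  define p where "p n = hd (P (Suc n))" for n
  have PS: "P (Suc n) = p n # P n" for n by (simp add: P_def p_def)
  have setP: "set (P n) = p ` {..<n}" for n
    by (induction n) (auto simp: PS lessThan_Suc, simp add: P_def)
  have okp: "ok (p ` {..<n}) (p n) \<and> p ` {..<n} \<subseteq> J" for n
  proof (induction n rule: less_induct)
    case (less n)
    have sub: "p ` {..<n} \<subseteq> J"
    proof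
      fix q assume "q \<in> p ` {..<n}"
      then obtain m where "m < n" "q = p m" by auto
      then show "q \<in> J" using less[of m] by (auto simp: ok_def)
    qed
    have "p n = (SOME q. ok (set (P n)) q)" by (simp add: p_def P_def)
    then show ?case using someI_ex[OF ex[OF _ sub]] sub by (auto simp: setP)
  qed
  define a where "a n = lead_coeff (p n)" for n
  have aR: "a n \<in> R" for n using okp[of n] by (auto simp: a_def J_def ok_def)
  define L where "L n = ideal_gen R (a ` {..<n})" for n
  have L: "ideal_in R (L n)" for n unfolding L_def by (rule ideal_gen_ideal) (use aR in auto)
  have "\<exists>n. \<forall>m\<ge>n. L m = L n"
  proof (rule noetherian_chain[OF assms L])
    show "L n \<subseteq> L (Suc n)" for n
      unfolding L_def by (rule ideal_gen_mono) auto
  qed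
  then obtain n where "L (Suc n) = L n" by (meson le_SucI order_refl)
  moreover have "a n \<in> L (Suc n)" unfolding L_def by (rule ideal_gen_incl) auto
  ultimately have an: "a n \<in> ideal_gen R (a ` {..<n})" unfolding L_def by simp
  define d where "d = degree (p n)"
  have degmono: "degree (p j) \<le> d" if "j < n" for j
  proof -
    have "G (p ` {..<j}) \<subseteq> G (p ` {..<n})"
      unfolding G_def by (rule ideal_gen_mono) (use that in auto)
    then show ?thesis using okp[of j] okp[of n] unfolding ok_def d_def by blast
  qed
  \<comment> \<open>A combination of the earlier leading coefficients is the coefficient in degree
    \<open>d\<close> of a combination of the earlier polynomials: \<open>degmono\<close> allows each
    \<open>p j\<close> to be raised to degree \<open>d\<close> by a monomial.\<close>
  have "\<exists>q. degree q \<le> d \<and> coeff q d = c \<and> (\<forall>i. coeff q i \<in> R) \<and> poly q x \<in> G (p ` {..<n})"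
    if "c \<in> ideal_gen R (a ` {..<n})" for c
    using that
  proof induction
    case zero
    then show ?case by (intro exI[of _ 0]) (auto simp: G_def closed intro: ideal_gen.zero)
  next
    case (step c r b)
    then obtain q where q: "degree q \<le> d" "coeff q d = c" "\<And>i. coeff q i \<in> R"
      "poly q x \<in> G (p ` {..<n})" by blast
    obtain j where j: "j < n" "b = a j" using step by auto
    define m where "m = monom r (d - degree (p j))"
    have mR: "coeff m i \<in> R" for i using step by (auto simp: m_def closed)
    have "degree (m * p j) \<le> d"
      using degree_mult_le[of m "p j"] degmono[OF j(1)] degree_monom_le[of r "d - degree (p j)"]
      unfolding m_def by linarith
    moreover have "coeff (m * p j) d = r * b"
      using degmono[OF j(1)] by (simp add: m_def j a_def coeff_monom_mult)
    moreover have "coeff (m * p j) i \<in> R" for i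
      by (rule coeffs_mult_closed) (use mR okp[of j] in \<open>auto simp: ok_def J_def\<close>)
    moreover have "poly (m * p j) x + poly q x \<in> G (p ` {..<n})"
      unfolding G_def poly_mult
      by (rule ideal_gen.step) (use q j mR in \<open>auto simp: G_def adjoin_def\<close>)
    ultimately show ?case using q
      by (intro exI[of _ "m * p j + q"]) (auto intro: degree_add_le closed)
  qed
  from this[OF an] obtain q where q: "degree q \<le> d" "coeff q d = a n" "\<And>i. coeff q i \<in> R"
    "poly q x \<in> G (p ` {..<n})" by blast
  have pn: "p n \<in> J" "poly (p n) x \<notin> G (p ` {..<n})" using okp[of n] by (auto simp: ok_def)
  have GI: "ideal_in (adjoin R x) (G (p ` {..<n}))"
    unfolding G_def by (rule A.ideal_gen_ideal) (use okp[of n] in \<open>auto simp: J_def adjoin_def\<close>)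
  have GsubI: "G (p ` {..<n}) \<subseteq> I"
    unfolding G_def by (rule ideal_gen_least[OF I]) (use okp[of n] in \<open>auto simp: J_def\<close>)
  \<comment> \<open>Subtracting \<open>q\<close> changes the value by an element of the ideal, so
    \<open>p n - q\<close> competes with \<open>p n\<close> for minimality; but its coefficient in
    degree \<open>d\<close> has cancelled.\<close>
  have "poly (p n - q) x \<notin> G (p ` {..<n})"
    using pn(2) q(4) ideal_inD(3)[OF GI, of "poly (p n - q) x" "poly q x"] by auto
  moreover have "p n - q \<in> J"
    using pn q GsubI A.ideal_diff[OF I] unfolding J_def by (auto intro: closed)
  ultimately have "d \<le> degree (p n - q)" using okp[of n] unfolding ok_def d_def by blast
  moreover have "degree (p n - q) \<le> d" by (rule degree_diff_le) (use q in \<open>auto simp: d_def\<close>)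
  moreover have "coeff (p n - q) d = 0" using q(2) by (simp add: a_def d_def)
  ultimately have "p n - q = 0" by (metis le_antisym leading_coeff_0_iff)
  then show False using \<open>poly (p n - q) x \<notin> _\<close> ideal_inD(2)[OF GI] by simp
qed

end

section \<open>Krull's principal ideal theorem\<close>

text \<open>The contraction to \<open>R\<close> of the extension of \<open>K\<close> to the
  localization at \<open>Q\<close>. Saturated ideals thus stand for the ideals of the local ring at
  \<open>Q\<close>.\<close>

definition saturation :: "'a::comm_ring_1 set \<Rightarrow> 'a set \<Rightarrow> 'a set \<Rightarrow> 'a set" where
  "saturation R Q K = {x \<in> R. \<exists>t\<in>R - Q. t * x \<in> K}"

definition saturated :: "'a::comm_ring_1 set \<Rightarrow> 'a set \<Rightarrow> 'a set \<Rightarrow> bool" where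
  "saturated R Q K \<longleftrightarrow> ideal_in R K \<and> (\<forall>x\<in>R. \<forall>t\<in>R - Q. t * x \<in> K \<longrightarrow> x \<in> K)"

lemma saturatedD: "saturated R Q K \<Longrightarrow> t \<in> R - Q \<Longrightarrow> x \<in> R \<Longrightarrow> t * x \<in> K \<Longrightarrow> x \<in> K"
  by (auto simp: saturated_def)

lemma saturationI: "t \<in> R - Q \<Longrightarrow> x \<in> R \<Longrightarrow> t * x \<in> K \<Longrightarrow> x \<in> saturation R Q K"
  by (auto simp: saturation_def)

lemma prime_inD:
  assumes "prime_in R P"
  shows "ideal_in R P" "1 \<notin> P" "a \<in> R \<Longrightarrow> b \<in> R \<Longrightarrow> a * b \<in> P \<Longrightarrow> a \<in> P \<or> b \<in> P"
    "a \<in> R - P \<Longrightarrow> b \<in> R - P \<Longrightarrow> a * b \<notin> P"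
  using assms by (auto simp: prime_in_def)

lemma ideal_gen_coeff_subset:
  assumes "R \<subseteq> R'"
  shows "ideal_gen R B \<subseteq> ideal_gen R' B"
proof
  fix x assume "x \<in> ideal_gen R B"
  then show "x \<in> ideal_gen R' B"
    by induction (use assms in \<open>auto intro: ideal_gen.intros\<close>)
qed

lemma ideal_gen_add:
  assumes "x \<in> ideal_gen R B" "y \<in> ideal_gen R B"
  shows "x + y \<in> ideal_gen R B"
  using assms by (induction) (auto simp: add.assoc intro: ideal_gen.intros)

lemma ideal_gen_mult:
  assumes "ideal_in R Q" "r \<in> R" "x \<in> ideal_gen Q B"
  shows "r * x \<in> ideal_gen Q B"
  using assms(3)
proof induction
  case (step x s b)
  then have "(r * s) * b + r * x \<in> ideal_gen Q B"
    using assms by (intro ideal_gen.step) (auto dest: ideal_inD)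
  then show ?case by (simp add: algebra_simps)
qed (auto intro: ideal_gen.zero)

lemma ideal_gen_mult_ideal:
  assumes "ideal_in R Q" "q \<in> Q" "x \<in> ideal_gen R B"
  shows "q * x \<in> ideal_gen Q B"
  using assms(3)
proof induction
  case (step x s b)
  then have "(s * q) * b + q * x \<in> ideal_gen Q B"
    using assms by (intro ideal_gen.step) (auto dest: ideal_inD)
  then show ?case by (simp add: algebra_simps)
qed (auto intro: ideal_gen.zero)

context subring_of
begin

lemma prime_inD_power:
  assumes "prime_in R P" "a \<in> R" "a ^ n \<in> P"
  shows "a \<in> P"
  using assms(3)
proof (induction n)
  case 0
  then show ?case using assms by (simp add: prime_inD)
next
  case (Suc n)
  then show ?case using prime_inD(3)[OF assms(1,2), of "a ^ n"] assms by (auto simp: closed)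
qed

lemma saturated_saturation:
  assumes Q: "prime_in R Q" and K: "ideal_in R K"
  shows "saturated R Q (saturation R Q K)"
  unfolding saturated_def ideal_in_def
proof (intro conjI ballI impI)
  show "0 \<in> saturation R Q K"
    using K one_closed zero_closed prime_inD(2)[OF Q] by (auto simp: saturation_def dest: ideal_inD)
next
  fix x y assume "x \<in> saturation R Q K" "y \<in> saturation R Q K"
  then obtain s t where st: "x \<in> R" "y \<in> R" "s \<in> R - Q" "t \<in> R - Q" "s * x \<in> K" "t * y \<in> K"
    by (auto simp: saturation_def)
  have "t * (s * x) + s * (t * y) \<in> K"
    using st by (intro ideal_inD(3)[OF K] ideal_inD(4)[OF K _ st(5)] ideal_inD(4)[OF K _ st(6)]) auto
  then have "(s * t) * (x + y) \<in> K" by (simp add: algebra_simps)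
  then show "x + y \<in> saturation R Q K"
    using st prime_inD(4)[OF Q, of s t] by (auto simp: saturation_def closed)
next
  fix r x assume "r \<in> R" "x \<in> saturation R Q K"
  then obtain s where s: "x \<in> R" "s \<in> R - Q" "s * x \<in> K" by (auto simp: saturation_def)
  then have "s * (r * x) \<in> K" using ideal_inD(4)[OF K \<open>r \<in> R\<close>, of "s * x"] by (simp add: mult_ac)
  then show "r * x \<in> saturation R Q K" using s \<open>r \<in> R\<close> by (auto simp: saturation_def closed)
next
  fix x t assume x: "x \<in> R" and t: "t \<in> R - Q" and "t * x \<in> saturation R Q K"
  then obtain s where "s \<in> R - Q" "s * (t * x) \<in> K" by (auto simp: saturation_def)
  then show "x \<in> saturation R Q K"
    using x t prime_inD(4)[OF Q, of s t]
    by (intro saturationI[of "s * t"]) (auto simp: closed mult.assoc)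
qed (auto simp: saturation_def)

lemma saturation_incl:
  assumes "prime_in R Q" "ideal_in R K"
  shows "K \<subseteq> saturation R Q K"
proof
  fix x assume "x \<in> K"
  then show "x \<in> saturation R Q K"
    using ideal_inD(1)[OF assms(2)] one_closed prime_inD(2)[OF assms(1)]
    by (intro saturationI[of 1]) auto
qed

lemma saturation_mono: "K \<subseteq> K' \<Longrightarrow> saturation R Q K \<subseteq> saturation R Q K'"
  by (auto simp: saturation_def)

text \<open>In other words, the localization of \<open>R / J\<close> at \<open>Q\<close> is artinian.\<close>

lemma saturated_chain_stabilizes:
  assumes noeth: "noetherian R" and Q: "prime_in R Q" and J: "saturated R Q J"
    and pow: "\<And>g. g \<in> Q \<Longrightarrow> \<exists>c. g ^ c \<in> J"
    and M: "\<And>n::nat. saturated R Q (M n)" "\<And>n. J \<subseteq> M n" "\<And>n. M (Suc n) \<subseteq> M n"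
  shows "\<exists>n. M (Suc n) = M n"
proof -
  have dec: "M n \<subseteq> M m" if "m \<le> n" for m n using lift_Suc_antimono_le[of M, OF M(3) that] .
  have Mi: "ideal_in R (M n)" for n using M by (simp add: saturated_def)
  \<comment> \<open>A maximal \<open>K\<close> on which the chain becomes stationary is sought; it
    will turn out to be all of \<open>R\<close>.\<close>
  define F where
    "F = {K. saturated R Q K \<and> J \<subseteq> K \<and> (\<exists>n. \<forall>m\<ge>n. M (Suc m) \<inter> K = M m \<inter> K)}"
  have "J \<in> F" using M J by (auto simp: F_def)
  moreover have "ideal_in R K" if "K \<in> F" for K using that by (auto simp: F_def saturated_def)
  ultimately obtain K where KF: "K \<in> F" and max: "\<And>K'. K' \<in> F \<Longrightarrow> K \<subseteq> K' \<Longrightarrow> K' = K"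
    using noetherian_maximal[OF noeth, of F J] by metis
  then have Ks: "saturated R Q K" and JK: "J \<subseteq> K" by (auto simp: F_def)
  have Ki: "ideal_in R K" using Ks by (simp add: saturated_def)
  obtain n0 where n0: "\<And>m. m \<ge> n0 \<Longrightarrow> M (Suc m) \<inter> K = M m \<inter> K" using KF by (auto simp: F_def)
  have "1 \<in> K"
  proof (rule ccontr)
    assume "1 \<notin> K"
    obtain B where B: "finite B" "B \<subseteq> Q" "Q \<subseteq> ideal_gen R B"
      using noeth prime_inD(1)[OF Q] by (auto simp: noetherian_def)
    \<comment> \<open>A socle element modulo \<open>K\<close>: outside \<open>K\<close>, but carried
      into \<open>K\<close> by all of \<open>Q\<close>. For each generator \<open>g\<close> it is
      multiplied by the highest power of \<open>g\<close> that keeps it outside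
      \<open>K\<close>.\<close>
    from B(1,2) have "\<exists>x\<in>R. x \<notin> K \<and> (\<forall>g\<in>B. g * x \<in> K)"
    proof (induction B)
      case empty
      then show ?case using \<open>1 \<notin> K\<close> one_closed by auto
    next
      case (insert g B)
      then obtain x where x: "x \<in> R" "x \<notin> K" "\<And>g. g \<in> B \<Longrightarrow> g * x \<in> K" by auto
      have g: "g \<in> R" using insert.prems prime_inD(1)[OF Q] by (auto dest: ideal_inD)
      have BR: "B \<subseteq> R" using insert.prems prime_inD(1)[OF Q] by (auto dest: ideal_inD)
      obtain c where "g ^ c \<in> J" using pow[of g] insert.prems by auto
      then have "g ^ c * x \<in> K" using JK x ideal_inD(5)[OF Ki] by blast
      then have ex: "\<exists>c. g ^ c * x \<in> K" ..
      define j where "j = (LEAST c. g ^ c * x \<in> K)"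
      have j: "g ^ j * x \<in> K" unfolding j_def using ex by (rule LeastI_ex)
      have "j \<noteq> 0" using j x by (metis mult_1 power_0)
      then obtain i where i: "j = Suc i" by (cases j) auto
      have "g ^ i * x \<notin> K" using not_less_Least[of i "\<lambda>c. g ^ c * x \<in> K"] i by (simp add: j_def)
      moreover have "h * (g ^ i * x) \<in> K" if "h \<in> B" for h
        using ideal_inD(4)[OF Ki power_closed[OF g, of i] x(3)[OF that]] by (simp add: mult_ac)
      moreover have "g * (g ^ i * x) \<in> K" using j i by (simp add: mult_ac)
      ultimately show ?case using x g by (intro bexI[of _ "g ^ i * x"]) (auto simp: closed)
    qed
    then obtain x where x: "x \<in> R" "x \<notin> K" "\<And>g. g \<in> B \<Longrightarrow> g * x \<in> K" by auto
    have Qx: "g * x \<in> K" if "g \<in> Q" for g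
    proof -
      have "g \<in> ideal_gen R B" using B that by blast
      then show ?thesis
        by induction (use x ideal_inD[OF Ki] in \<open>auto simp: distrib_right mult.assoc\<close>)
    qed
    let ?A = "{k + x * r | k r. k \<in> K \<and> r \<in> R}"
    have A: "ideal_in R ?A" by (rule ideal_in_add_principal[OF Ki x(1)])
    define K' where "K' = saturation R Q ?A"
    have K's: "saturated R Q K'" unfolding K'_def by (rule saturated_saturation[OF Q A])
    have "K \<subseteq> ?A" using zero_closed by force
    then have KK': "K \<subseteq> K'" using saturation_incl[OF Q A] by (auto simp: K'_def)
    have "x \<in> ?A" using ideal_inD(2)[OF Ki] one_closed by force
    then have "x \<in> K'" using saturation_incl[OF Q A] by (auto simp: K'_def)
    then have "K' \<notin> F" using max KK' x by blast
    then have nst: "\<nexists>n. \<forall>m\<ge>n. M (Suc m) \<inter> K' = M m \<inter> K'"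
      using K's KK' JK by (auto simp: F_def)
    \<comment> \<open>Locally at \<open>Q\<close>, \<open>K'\<close> modulo \<open>K\<close> is
      one-dimensional over the residue field, because \<open>Q\<close> carries \<open>x\<close> into
      \<open>K\<close>. By \<open>nst\<close> there is always some \<open>w\<close> in
      \<open>M (Suc n) \<inter> K'\<close> outside \<open>K\<close>. Up to factors outside
      \<open>Q\<close>, each \<open>y\<close> in \<open>M n \<inter> K'\<close> is a multiple of
      \<open>w\<close> modulo \<open>K\<close>, and the difference is handled by stationarity on
      \<open>K\<close>.\<close>
    have "M (Suc n) \<inter> K' = M n \<inter> K'" if "n \<ge> n0" for n
    proof
      show "M (Suc n) \<inter> K' \<subseteq> M n \<inter> K'" using M(3) by blast
      have "\<not> M (Suc n) \<inter> K' \<subseteq> K"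
      proof
        assume "M (Suc n) \<inter> K' \<subseteq> K"
        then have "M m \<inter> K' = M m \<inter> K" if "m \<ge> Suc n" for m using dec[OF that] KK' by blast
        then have "\<forall>m\<ge>Suc n. M (Suc m) \<inter> K' = M m \<inter> K'" using n0 \<open>n \<ge> n0\<close> by simp
        then show False using nst by blast
      qed
      then obtain w where w: "w \<in> M (Suc n)" "w \<in> K'" "w \<notin> K" by blast
      then obtain t k r where t: "t \<in> R - Q" "k \<in> K" "r \<in> R" "t * w = k + x * r" "w \<in> R"
        by (auto simp: K'_def saturation_def)
      have rQ: "r \<notin> Q"
      proof
        assume "r \<in> Q"
        then have "t * w \<in> K" using Qx[of r] t ideal_inD(3)[OF Ki] by (simp add: mult.commute)
        then show False using saturatedD[OF Ks t(1) t(5)] w by blast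
      qed
      show "M n \<inter> K' \<subseteq> M (Suc n) \<inter> K'"
      proof
        fix y assume y: "y \<in> M n \<inter> K'"
        then obtain t' k' r' where t': "t' \<in> R - Q" "k' \<in> K" "r' \<in> R" "t' * y = k' + x * r'" "y \<in> R"
          by (auto simp: K'_def saturation_def)
        have "r * (t' * y) - r' * (t * w) = r * k' - r' * k"
          by (simp only: t(4) t'(4)) (simp add: algebra_simps)
        moreover have "r * k' - r' * k \<in> K"
          by (intro ideal_diff[OF Ki] ideal_inD(4)[OF Ki] t t')
        moreover have "r * (t' * y) - r' * (t * w) \<in> M n"
          using t(1) t'(1) y w(1) M(3)
          by (intro ideal_diff[OF Mi] ideal_inD(4)[OF Mi] t(3) t'(3)) auto
        ultimately have "r * (t' * y) - r' * (t * w) \<in> M (Suc n)" using n0 \<open>n \<ge> n0\<close> by auto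
        moreover have "r' * (t * w) \<in> M (Suc n)"
          using t(1) by (intro ideal_inD(4)[OF Mi] t'(3) w(1)) auto
        ultimately have "(r * (t' * y) - r' * (t * w)) + r' * (t * w) \<in> M (Suc n)"
          by (rule ideal_inD(3)[OF Mi])
        then have "r * (t' * y) \<in> M (Suc n)" by simp
        then have "(r * t') * y \<in> M (Suc n)" by (simp add: mult.assoc)
        moreover have "r * t' \<in> R - Q" using t t' rQ prime_inD(4)[OF Q, of r t'] by (auto simp: closed)
        ultimately show "y \<in> M (Suc n) \<inter> K'" using saturatedD[OF M(1) _ t'(5)] y by blast
      qed
    qed
    then show False using nst by blast
  qed
  then have "K = R" using ideal_inD(4)[OF Ki _ \<open>1 \<in> K\<close>] ideal_inD(1)[OF Ki] by auto
  then show ?thesis using n0[of n0] ideal_inD(1)[OF Mi] by blast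
qed

text \<open>Nakayama's lemma in the localization at \<open>Q\<close>, with denominators
  \<open>t\<close> cleared. The generators are eliminated one at a time, without
  determinants.\<close>

lemma nakayama:
  assumes Q: "prime_in R Q" and N: "ideal_in R N" and "finite B" "B \<subseteq> R"
    and "\<And>b. b \<in> B \<Longrightarrow> \<exists>t\<in>R - Q. \<exists>w\<in>ideal_gen Q B. t * b - w \<in> N"
  shows "\<exists>t\<in>R - Q. \<forall>b\<in>B. t * b \<in> N"
  using assms(3-)
proof (induction B)
  case empty
  then show ?case using one_closed prime_inD(2)[OF Q] by blast
next
  case (insert b B)
  note Qi = prime_inD(1)[OF Q]
  note Q0 = ideal_inD(2,3)[OF Qi]
  obtain t w where t: "t \<in> R - Q" "w \<in> ideal_gen Q (insert b B)" "t * b - w \<in> N"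
    using insert.prems(2)[of b] by auto
  obtain q w' where q: "q \<in> Q" "w' \<in> ideal_gen Q B" "w = q * b + w'"
    using ideal_gen_insertE[OF t(2) Q0] by blast
  \<comment> \<open>The unit \<open>1 - q\<close> of the usual proof, with cleared denominator: it
    avoids \<open>Q\<close> since \<open>t\<close> does and \<open>q\<close> lies in
    \<open>Q\<close>.\<close>
  define s where "s = t - q"
  have sR: "s \<in> R" using t q ideal_inD(1)[OF Qi] by (auto simp: s_def closed)
  have "s \<notin> Q" using t q ideal_inD(3)[OF Qi, of s q] by (auto simp: s_def)
  then have s: "s \<in> R - Q" using sR by blast
  have sb: "s * b - w' \<in> N" using t(3) by (simp add: q s_def algebra_simps)
  have "\<exists>t\<in>R - Q. \<exists>w\<in>ideal_gen Q B. t * c - w \<in> N" if c: "c \<in> B" for c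
  proof -
    obtain t' v where t': "t' \<in> R - Q" "v \<in> ideal_gen Q (insert b B)" "t' * c - v \<in> N"
      using insert.prems(2)[of c] c by auto
    obtain q' v' where q': "q' \<in> Q" "v' \<in> ideal_gen Q B" "v = q' * b + v'"
      using ideal_gen_insertE[OF t'(2) Q0] by blast
    have q'R: "q' \<in> R" using q' ideal_inD(1)[OF Qi] by blast
    have "(s * t') * c - (q' * w' + s * v') = s * (t' * c - v) + q' * (s * b - w')"
      by (simp add: q' algebra_simps)
    also have "\<dots> \<in> N" by (intro ideal_inD(3)[OF N] ideal_inD(4)[OF N] sR q'R t' sb)
    finally have "(s * t') * c - (q' * w' + s * v') \<in> N" .
    moreover have "q' * w' + s * v' \<in> ideal_gen Q B"
      using q q' q'R sR by (auto intro!: ideal_gen_add ideal_gen_mult[OF Qi])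
    moreover have "s * t' \<in> R - Q" using s t' prime_inD(4)[OF Q, of s t'] by (auto simp: closed)
    ultimately show ?thesis by blast
  qed
  then obtain t' where t': "t' \<in> R - Q" "\<And>c. c \<in> B \<Longrightarrow> t' * c \<in> N" using insert by auto
  have tw: "t' * x \<in> N" if "x \<in> ideal_gen Q B" for x
    using that
  proof induction
    case zero
    then show ?case using ideal_inD(2)[OF N] by simp
  next
    case (step x r c)
    have "r * (t' * c) + t' * x \<in> N"
      using step(2,3,4) t' ideal_inD(1)[OF Qi] ideal_inD(3,4)[OF N] by blast
    then show ?case by (simp add: algebra_simps)
  qed
  have "t' * (s * b - w') + t' * w' \<in> N"
    using t' tw[OF q(2)] sb ideal_inD(3,4)[OF N] by blast
  then have "(s * t') * b \<in> N" by (simp add: algebra_simps)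
  moreover have "(s * t') * c \<in> N" if "c \<in> B" for c
    using ideal_inD(4)[OF N sR t'(2)[OF that]] by (simp add: mult.assoc)
  moreover have "s * t' \<in> R - Q" using s t' prime_inD(4)[OF Q, of s t'] by (auto simp: closed)
  ultimately show ?case by blast
qed

text \<open>The classical proof: the symbolic powers \<open>K n\<close> of \<open>P\<close> become stationary modulo \<open>z\<close>,
  and then Nakayama's lemma shows that a power of \<open>P\<close> lies in \<open>P0\<close>.\<close>

theorem principal_ideal_theorem:
  assumes noeth: "noetherian R" and P0: "prime_in R P0" and P: "prime_in R P" and Q: "prime_in R Q"
    and sub: "P0 \<subset> P" "P \<subset> Q" and z: "z \<in> Q"
    and min: "\<And>g. g \<in> Q \<Longrightarrow> \<exists>t\<in>R - Q. \<exists>c. \<exists>x\<in>P0. \<exists>r\<in>R. t * g ^ c = x + z * r"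
  shows False
proof -
  note P0i = prime_inD(1)[OF P0] and Pi = prime_inD(1)[OF P] and Qi = prime_inD(1)[OF Q]
  have zR: "z \<in> R" using ideal_inD(1)[OF Qi] z by blast
  have QR: "Q \<subseteq> R" and PR: "P \<subseteq> R" using ideal_inD(1)[OF Qi] ideal_inD(1)[OF Pi] by auto
  \<comment> \<open>By \<open>min\<close>, a prime between \<open>P0\<close> and \<open>Q\<close>
    that contains \<open>z\<close> contains all of \<open>Q\<close>.\<close>
  have zP: "z \<notin> P"
  proof
    assume "z \<in> P"
    have "g \<in> P" if "g \<in> Q" for g
    proof -
      obtain t c x r where t: "t \<in> R - Q" "x \<in> P0" "r \<in> R" "t * g ^ c = x + z * r"
        using min[OF \<open>g \<in> Q\<close>] by blast
      have "x + z * r \<in> P"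
        using t(2) sub(1) by (intro ideal_inD(3)[OF Pi] ideal_inD(5)[OF Pi] t(3) \<open>z \<in> P\<close>) auto
      moreover have gR: "g \<in> R" using QR \<open>g \<in> Q\<close> by blast
      moreover have "t \<in> R" "t \<notin> P" using t(1) sub(2) by auto
      ultimately have "g ^ c \<in> P"
        using prime_inD(3)[OF P, of t "g ^ c"] power_closed[OF gR] t(4) by metis
      then show ?thesis by (rule prime_inD_power[OF P gR])
    qed
    then show False using sub by blast
  qed
  \<comment> \<open>With \<open>P0\<close> regarded as zero, \<open>L n\<close> is the
    \<open>n\<close>-th power of \<open>P\<close>, and its saturation \<open>K n\<close> below is
    the \<open>n\<close>-th symbolic power.\<close>
  define L where "L = rec_nat R (\<lambda>_ L. {x + y | x y. x \<in> P0 \<and> y \<in> ideal_gen P L})"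
  have L0: "L 0 = R" and LS: "L (Suc n) = {x + y | x y. x \<in> P0 \<and> y \<in> ideal_gen P (L n)}" for n
    by (simp_all add: L_def)
  have Li: "ideal_in R (L n)" for n
  proof (induction n)
    case 0
    show ?case by (auto simp: L0 ideal_in_def closed)
  next
    case (Suc n)
    have *: "ideal_gen P (L n) \<subseteq> R"
      using ideal_gen_coeff_subset[OF PR, of "L n"] ideal_gen_ideal[of "L n"] ideal_inD(1)[OF Suc]
      by (meson ideal_inD(1) subset_iff)
    show ?case
      unfolding LS ideal_in_def
    proof (intro conjI ballI)
      fix a b assume "a \<in> {x + y | x y. x \<in> P0 \<and> y \<in> ideal_gen P (L n)}"
        "b \<in> {x + y | x y. x \<in> P0 \<and> y \<in> ideal_gen P (L n)}"
      then obtain x y x' y' where "a = x + y" "b = x' + y'" "x \<in> P0" "x' \<in> P0"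
        "y \<in> ideal_gen P (L n)" "y' \<in> ideal_gen P (L n)" by blast
      then have "a + b = (x + x') + (y + y')" "x + x' \<in> P0" "y + y' \<in> ideal_gen P (L n)"
        using ideal_inD(3)[OF P0i] ideal_gen_add by auto
      then show "a + b \<in> {x + y | x y. x \<in> P0 \<and> y \<in> ideal_gen P (L n)}" by blast
    next
      fix r a assume r: "r \<in> R" and "a \<in> {x + y | x y. x \<in> P0 \<and> y \<in> ideal_gen P (L n)}"
      then obtain x y where "a = x + y" "x \<in> P0" "y \<in> ideal_gen P (L n)" by blast
      then have "r * a = r * x + r * y" "r * x \<in> P0" "r * y \<in> ideal_gen P (L n)"
        using r ideal_inD(4)[OF P0i] ideal_gen_mult[OF Pi] by (auto simp: distrib_left)
      then show "r * a \<in> {x + y | x y. x \<in> P0 \<and> y \<in> ideal_gen P (L n)}" by blast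
    next
      show "{x + y | x y. x \<in> P0 \<and> y \<in> ideal_gen P (L n)} \<subseteq> R"
        using * ideal_inD(1)[OF P0i] by (auto simp: closed subset_iff)
      show "0 \<in> {x + y | x y. x \<in> P0 \<and> y \<in> ideal_gen P (L n)}"
        using ideal_inD(2)[OF P0i] ideal_gen.zero by force
    qed
  qed
  have Ldec: "L (Suc n) \<subseteq> L n" for n
  proof (induction n)
    case 0
    show ?case using ideal_inD(1)[OF Li[of 1]] by (auto simp: L0)
  next
    case (Suc n)
    then have "ideal_gen P (L (Suc n)) \<subseteq> ideal_gen P (L n)" by (rule ideal_gen_mono)
    then show ?case unfolding LS[of n] LS[of "Suc n"] by blast
  qed
  have P0L: "P0 \<subseteq> L n" for n
  proof (cases n)
    case 0
    then show ?thesis using ideal_inD(1)[OF P0i] by (auto simp: L0)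
  next
    case (Suc m)
    then show ?thesis unfolding Suc LS using ideal_gen.zero by force
  qed
  define K where "K n = saturation R P (L n)" for n
  have Ks: "saturated R P (K n)" for n unfolding K_def by (rule saturated_saturation[OF P Li])
  then have Ki: "ideal_in R (K n)" for n by (simp add: saturated_def)
  have Kdec: "K (Suc n) \<subseteq> K n" for n unfolding K_def by (rule saturation_mono[OF Ldec])
  have P0K: "P0 \<subseteq> K n" for n using P0L saturation_incl[OF P Li] unfolding K_def by blast
  define A where "A I = {x + z * r | x r. x \<in> I \<and> r \<in> R}" for I
  have Ai: "ideal_in R (A I)" if "ideal_in R I" for I
    unfolding A_def by (rule ideal_in_add_principal[OF that zR])
  have Amono: "I \<subseteq> I' \<Longrightarrow> A I \<subseteq> A I'" for I I' unfolding A_def by blast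
  have "\<exists>n. saturation R Q (A (K (Suc n))) = saturation R Q (A (K n))"
  proof (rule saturated_chain_stabilizes[OF noeth Q])
    show "saturated R Q (saturation R Q (A P0))" by (rule saturated_saturation[OF Q Ai[OF P0i]])
    show "\<exists>c. g ^ c \<in> saturation R Q (A P0)" if "g \<in> Q" for g
    proof -
      obtain t c x r where t: "t \<in> R - Q" "x \<in> P0" "r \<in> R" "t * g ^ c = x + z * r"
        using min[OF \<open>g \<in> Q\<close>] by blast
      then have "g ^ c \<in> saturation R Q (A P0)"
        using that QR by (auto simp: saturation_def A_def closed)
      then show ?thesis ..
    qed
    show "saturated R Q (saturation R Q (A (K n)))" for n
      by (rule saturated_saturation[OF Q Ai[OF Ki]])
    show "saturation R Q (A P0) \<subseteq> saturation R Q (A (K n))" for n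
      by (intro saturation_mono Amono P0K)
    show "saturation R Q (A (K (Suc n))) \<subseteq> saturation R Q (A (K n))" for n
      by (intro saturation_mono Amono Kdec)
  qed
  then obtain n where n: "saturation R Q (A (K (Suc n))) = saturation R Q (A (K n))" ..
  \<comment> \<open>Locally at \<open>Q\<close>, an element of \<open>K n\<close> is an element of
    \<open>K (Suc n)\<close> plus some \<open>z * r\<close>. Then \<open>z * r \<in> K n\<close>,
    and \<open>z \<notin> P\<close> gives \<open>r \<in> K n\<close>; so \<open>K n\<close> is
    contained in \<open>K (Suc n) + Q K n\<close>, and Nakayama at \<open>Q\<close> applies.\<close>
  have "K n \<subseteq> K (Suc n)"
  proof -
    obtain B where B: "finite B" "B \<subseteq> K n" "K n \<subseteq> ideal_gen R B"
      using noeth Ki[of n] unfolding noetherian_def by blast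
    have "\<exists>t\<in>R - Q. \<exists>w\<in>ideal_gen Q B. t * b - w \<in> K (Suc n)" if "b \<in> B" for b
    proof -
      have bK: "b \<in> K n" using B that by blast
      then have "b \<in> A (K n)" using zero_closed unfolding A_def by force
      then have "b \<in> saturation R Q (A (K (Suc n)))"
        using saturation_incl[OF Q Ai[OF Ki]] n by blast
      then obtain t k r where t: "t \<in> R - Q" "k \<in> K (Suc n)" "r \<in> R" "t * b = k + z * r"
        by (auto simp: saturation_def A_def)
      have "z * r = t * b - k" using t by (simp add: algebra_simps)
      also have "\<dots> \<in> K n"
        using t(1,2) Kdec by (intro ideal_diff[OF Ki] ideal_inD(4)[OF Ki] bK) auto
      finally have "r \<in> K n" using saturatedD[OF Ks, of z r n] zP zR t by blast
      then have "z * r \<in> ideal_gen Q B" using B ideal_gen_mult_ideal[OF Qi z] by blast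
      moreover have "t * b - z * r \<in> K (Suc n)" using t by simp
      ultimately show ?thesis using t by blast
    qed
    then obtain t where t: "t \<in> R - Q" "\<And>b. b \<in> B \<Longrightarrow> t * b \<in> K (Suc n)"
      using nakayama[OF Q Ki B(1), of "Suc n"] B(2) ideal_inD(1)[OF Ki] by blast
    have "B \<subseteq> K (Suc n)"
    proof
      fix b assume "b \<in> B"
      then have "t * b \<in> K (Suc n)" "b \<in> R" "t \<in> R - P"
        using t B ideal_inD(1)[OF Ki] sub by auto
      then show "b \<in> K (Suc n)" using saturatedD[OF Ks] by blast
    qed
    then show ?thesis using B ideal_gen_least[OF Ki] by blast
  qed
  \<comment> \<open>Since \<open>L n\<close> lies in \<open>K (Suc n)\<close>, it is locally at
    \<open>P\<close> contained in \<open>P0 + P L n\<close>; this time Nakayama is applied at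
    \<open>P\<close>.\<close>
  have "L n \<subseteq> P0"
  proof -
    obtain B where B: "finite B" "B \<subseteq> L n" "L n \<subseteq> ideal_gen R B"
      using noeth Li[of n] unfolding noetherian_def by blast
    have LB: "w \<in> ideal_gen P B" if "w \<in> ideal_gen P (L n)" for w
      using that
    proof induction
      case (step x r b)
      then show ?case using ideal_gen_mult_ideal[OF Pi, of r b B] B ideal_gen_add by blast
    qed (rule ideal_gen.zero)
    have "\<exists>t\<in>R - P. \<exists>w\<in>ideal_gen P B. t * b - w \<in> P0" if "b \<in> B" for b
    proof -
      have "b \<in> K (Suc n)"
        using that B saturation_incl[OF P Li] \<open>K n \<subseteq> K (Suc n)\<close> unfolding K_def by blast
      then obtain t x y where "t \<in> R - P" "x \<in> P0" "y \<in> ideal_gen P (L n)" "t * b = x + y"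
        by (auto simp: K_def saturation_def LS)
      then show ?thesis using LB by force
    qed
    then obtain t where t: "t \<in> R - P" "\<And>b. b \<in> B \<Longrightarrow> t * b \<in> P0"
      using nakayama[OF P P0i B(1)] B(2) ideal_inD(1)[OF Li] by blast
    have "B \<subseteq> P0"
    proof
      fix b assume "b \<in> B"
      then have "t * b \<in> P0" "b \<in> R" "t \<in> R - P0"
        using t B ideal_inD(1)[OF Li] sub by auto
      then show "b \<in> P0" using prime_inD(3)[OF P0, of t b] by blast
    qed
    then show ?thesis using B ideal_gen_least[OF P0i] by blast
  qed
  moreover have "p ^ m \<in> L m" if "p \<in> P" for p m
  proof (induction m)
    case 0
    then show ?case by (simp add: L0 closed)
  next
    case (Suc m)
    then have "p * p ^ m + 0 \<in> ideal_gen P (L m)"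
      using that by (intro ideal_gen.step ideal_gen.zero) auto
    then have "0 + p ^ Suc m \<in> L (Suc m)"
      unfolding LS using ideal_inD(2)[OF P0i] by fastforce
    then show ?case by simp
  qed
  ultimately have "P \<subseteq> P0" using prime_inD_power[OF P0] PR by blast
  then show False using sub by blast
qed

end

section \<open>Algebras of functions\<close>

interpretation fun_vs: vector_space "\<lambda>(c::'k::field) (f::'p \<Rightarrow> 'k) x. c * f x"
  by standard (auto simp: fun_eq_iff algebra_simps)

lemma sum_fun_apply: "sum f A x = (\<Sum>a\<in>A. f a x)"
  by (induction A rule: infinite_finite_induct) auto

lemma prod_fun_apply: "prod f A x = (\<Prod>a\<in>A. f a x)"
  by (induction A rule: infinite_finite_induct) auto

lemma power_fun_apply: "(f ^ n) x = f x ^ n"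
  by (induction n) auto

lemmas fun_apply = sum_fun_apply prod_fun_apply power_fun_apply

locale function_algebra = subring_of R
  for R :: "('p \<Rightarrow> 'k::field) set" +
  assumes const_closed: "(\<lambda>_. c) \<in> R"
begin

lemma poly_closed:
  assumes "f \<in> R"
  shows "(\<lambda>x. poly q (f x)) \<in> R"
proof (induction q)
  case 0
  show ?case using const_closed[of 0] by simp
next
  case (pCons a q)
  have "(\<lambda>x. poly (pCons a q) (f x)) = (\<lambda>_. a) + f * (\<lambda>x. poly q (f x))" by auto
  then show ?case using pCons.IH assms const_closed by (simp add: closed)
qed

lemma scale_ideal: "ideal_in R I \<Longrightarrow> f \<in> I \<Longrightarrow> (\<lambda>x. c * f x) \<in> I"
  using ideal_inD(4)[of R I "\<lambda>_. c" f] const_closed by (simp add: times_fun_def)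

lemma const_in_ideal:
  assumes "ideal_in R I" "(\<lambda>_. c) \<in> I" "c \<noteq> 0"
  shows "1 \<in> I"
  using scale_ideal[OF assms(1,2), of "inverse c"] assms(3) by (simp add: one_fun_def)

end

text \<open>Stated for an indexed family, as the image set forgets repetitions: two equal members
  already form a relation.\<close>

lemma family_dependent:
  fixes g :: "'a \<Rightarrow> 'p \<Rightarrow> 'k::field"
  assumes fin: "finite A" "finite T" and card: "card T < card A" and span: "g ` A \<subseteq> fun_vs.span T"
  shows "\<exists>c. (\<exists>a\<in>A. c a \<noteq> 0) \<and> (\<forall>x. (\<Sum>a\<in>A. c a * g a x) = 0)"
proof (cases "inj_on g A")
  case True
  have "card (g ` A) = card A" using True by (simp add: card_image)
  then have "fun_vs.dependent (g ` A)"
    using fun_vs.independent_span_bound[OF fin(2), of "g ` A"] span card by auto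
  then obtain u where u: "\<exists>v\<in>g ` A. u v \<noteq> 0" "(\<Sum>v\<in>g ` A. (\<lambda>x. u v * v x)) = 0"
    using fun_vs.dependent_finite[of "g ` A"] fin by auto
  have "(\<Sum>a\<in>A. u (g a) * g a x) = 0" for x
    using fun_cong[OF u(2), of x] by (simp add: sum.reindex[OF True] fun_apply)
  then show ?thesis using u by (intro exI[of _ "\<lambda>a. u (g a)"]) auto
next
  case False
  then obtain a b where ab: "a \<in> A" "b \<in> A" "a \<noteq> b" "g a = g b" by (auto simp: inj_on_def)
  define c :: "'a \<Rightarrow> 'k" where "c z = (if z = a then 1 else if z = b then - 1 else 0)" for z
  have "(\<Sum>z\<in>A. c z * g z x) = (\<Sum>z\<in>{a, b}. c z * g z x)" for x
    using ab fin by (intro sum.mono_neutral_right) (auto simp: c_def)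
  then have "(\<Sum>z\<in>A. c z * g z x) = 0" for x using ab by (simp add: c_def)
  moreover have "c a \<noteq> 0" by (simp add: c_def)
  ultimately show ?thesis using ab by blast
qed

text \<open>By the pigeonhole principle a single finite \<open>F n\<close> spans infinitely many
  members, more than its cardinality.\<close>

lemma uncountable_family_dependent:
  fixes g :: "'a \<Rightarrow> 'p \<Rightarrow> 'k::field" and F :: "nat \<Rightarrow> ('p \<Rightarrow> 'k) set"
  assumes unc: "uncountable L" and fin: "\<And>n. finite (F n)"
    and g: "\<And>a. a \<in> L \<Longrightarrow> \<exists>n. g a \<in> fun_vs.span (F n)"
  shows "\<exists>A c. finite A \<and> A \<subseteq> L \<and> (\<exists>a\<in>A. c a \<noteq> 0) \<and> (\<forall>x. (\<Sum>a\<in>A. c a * g a x) = 0)"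
proof -
  have "L = (\<Union>n. {a \<in> L. g a \<in> fun_vs.span (F n)})" using g by blast
  moreover have "countable (\<Union>n. {a \<in> L. g a \<in> fun_vs.span (F n)})"
    if "\<And>n. finite {a \<in> L. g a \<in> fun_vs.span (F n)}"
    using that by (intro countable_UN) (auto intro: countable_finite)
  ultimately obtain n where "infinite {a \<in> L. g a \<in> fun_vs.span (F n)}" using unc by metis
  from infinite_arbitrarily_large[OF this, of "Suc (card (F n))"]
  obtain A where A: "finite A" "card A = Suc (card (F n))"
    "A \<subseteq> {a \<in> L. g a \<in> fun_vs.span (F n)}" by blast
  have "\<exists>c. (\<exists>a\<in>A. c a \<noteq> 0) \<and> (\<forall>x. (\<Sum>a\<in>A. c a * g a x) = 0)"
    by (rule family_dependent[OF A(1) fin]) (use A in auto)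
  then show ?thesis using A by blast
qed

text \<open>If \<open>w / (f - a)\<close> exists modulo \<open>M\<close> for uncountably many \<open>a\<close>, then clearing denominators in
  a linear relation between these elements gives a polynomial relation for \<open>f\<close>.\<close>

lemma (in function_algebra) polynomial_relation:
  fixes F :: "nat \<Rightarrow> ('p \<Rightarrow> 'k) set"
  assumes M: "ideal_in R M" and f: "f \<in> R" and unc: "uncountable L" and fin: "\<And>n. finite (F n)"
    and span: "\<And>r. r \<in> R \<Longrightarrow> \<exists>n. r \<in> fun_vs.span (F n)"
    and r: "\<And>a. a \<in> L \<Longrightarrow> r a \<in> R \<and> w - r a * (f - (\<lambda>_. a)) \<in> M"
  obtains q where "q \<noteq> 0" "(\<lambda>x. poly q (f x)) * w \<in> M"
proof -
  have rspan: "\<exists>n. r a \<in> fun_vs.span (F n)" if "a \<in> L" for a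
    using span r[OF that] by blast
  have "\<exists>A c. finite A \<and> A \<subseteq> L \<and> (\<exists>a\<in>A. c a \<noteq> 0) \<and> (\<forall>x. (\<Sum>a\<in>A. c a * r a x) = 0)"
    by (rule uncountable_family_dependent[where F = F]) (use unc fin rspan in auto)
  then obtain A c where A: "finite A" "A \<subseteq> L" "\<exists>a\<in>A. c a \<noteq> 0" "\<And>x. (\<Sum>a\<in>A. c a * r a x) = 0"
    by blast
  \<comment> \<open>\<open>q\<close> is the numerator of the sum of all \<open>c a / (T - a)\<close>
    over the common denominator. Evaluated at some \<open>a\<close> in \<open>A\<close>, it retains
    only the summand belonging to \<open>a\<close>, so it is nonzero.\<close>
  define p where "p a = (\<Prod>b\<in>A - {a}. [:- b, 1:])" for a
  define q where "q = (\<Sum>a\<in>A. smult (c a) (p a))"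
  have p0: "poly (p a) b = 0" if "a \<in> A" "b \<in> A" "a \<noteq> b" for a b
    using that A(1) by (auto simp: p_def poly_prod)
  have pn0: "poly (p a) a \<noteq> 0" for a
    using A(1) by (auto simp: p_def poly_prod)
  have pfull: "poly (p a) t * (t - a) = (\<Prod>b\<in>A. t - b)" if "a \<in> A" for a t
    using A(1) that by (simp add: p_def poly_prod prod.remove[of A a] mult.commute)
  obtain a where a: "a \<in> A" "c a \<noteq> 0" using A by blast
  have "poly q a = (\<Sum>b\<in>A. c b * poly (p b) a)" by (simp add: q_def poly_sum)
  also have "\<dots> = c a * poly (p a) a"
    using A(1) a p0 by (subst sum.remove[OF A(1) a(1)]) (auto intro!: sum.neutral)
  finally have "q \<noteq> 0" using a pn0 by auto
  moreover have "(\<lambda>x. poly q (f x)) * w =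
      (\<Sum>a\<in>A. (\<lambda>x. poly (smult (c a) (p a)) (f x)) * (w - r a * (f - (\<lambda>_. a))))"
  proof
    fix x
    have "(\<Sum>a\<in>A. c a * poly (p a) (f x) * (r a x * (f x - a))) =
        (\<Sum>a\<in>A. (\<Prod>b\<in>A. f x - b) * (c a * r a x))"
      using pfull by (intro sum.cong) (auto simp: mult_ac)
    also have "\<dots> = 0" by (simp add: sum_distrib_left[symmetric] A)
    finally show "((\<lambda>x. poly q (f x)) * w) x =
      (\<Sum>a\<in>A. (\<lambda>x. poly (smult (c a) (p a)) (f x)) * (w - r a * (f - (\<lambda>_. a)))) x"
      by (simp add: fun_apply q_def poly_sum sum_distrib_right right_diff_distrib sum_subtractf)
  qed
  moreover have "\<dots> \<in> M"
    using A r by (intro ideal_sum[OF M] ideal_inD(4)[OF M] poly_closed[OF f]) auto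
  ultimately show thesis using that by metis
qed

text \<open>Over an algebraically closed field \<open>q\<close> splits into linear factors, and a
  prime ideal that contains the product contains one of them.\<close>

lemma prime_in_root:
  fixes q :: "'k::alg_closed_field poly"
  assumes "function_algebra R" and M: "prime_in R M" and f: "f \<in> R"
    and "q \<noteq> 0" "(\<lambda>x. poly q (f x)) \<in> M"
  shows "\<exists>a. f - (\<lambda>_. a) \<in> M"
  using assms(4,5)
proof (induction "degree q" arbitrary: q)
  case 0
  interpret function_algebra R by fact
  obtain c where "q = [:c:]" "c \<noteq> 0" using 0 by (metis degree_eq_zeroE pCons_0_0)
  then show ?case using 0 const_in_ideal[OF prime_inD(1)[OF M]] prime_inD(2)[OF M] by auto
next
  case (Suc n)
  interpret function_algebra R by fact
  obtain a where "poly q a = 0" using Suc by (metis alg_closed_imp_poly_has_root zero_less_Suc)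
  then obtain q' where q': "q = [:- a, 1:] * q'" by (metis dvdE poly_eq_0_iff_dvd)
  have ne: "q' \<noteq> 0" using q' Suc by auto
  then have "degree q = Suc (degree q')"
    unfolding q' by (subst degree_mult_eq) auto
  have "(\<lambda>x. poly q (f x)) = (f - (\<lambda>_. a)) * (\<lambda>x. poly q' (f x))"
    by (auto simp: q' algebra_simps)
  then have "f - (\<lambda>_. a) \<in> M \<or> (\<lambda>x. poly q' (f x)) \<in> M"
    using prime_inD(3)[OF M, of "f - (\<lambda>_. a)" "\<lambda>x. poly q' (f x)"] Suc.prems f poly_closed const_closed
    by (auto simp: closed)
  then show ?case using Suc.hyps ne \<open>degree q = Suc (degree q')\<close> by auto
qed

section \<open>Polynomial functions and the Nullstellensatz\<close>

lemma function_algebra_polynomial_functions: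
  "function_algebra (polynomial_functions m :: ((nat \<Rightarrow> 'k::field) \<Rightarrow> 'k) set)"
proof
  show "(\<lambda>_. c) \<in> polynomial_functions m" for c :: 'k by (rule polynomial_functions.const)
  then show "1 \<in> (polynomial_functions m :: ((nat \<Rightarrow> 'k) \<Rightarrow> 'k) set)" by (simp add: one_fun_def)
next
  fix x y :: "(nat \<Rightarrow> 'k) \<Rightarrow> 'k"
  assume xy: "x \<in> polynomial_functions m" "y \<in> polynomial_functions m"
  then show "x * y \<in> polynomial_functions m" by (simp add: times_fun_def polynomial_functions.mult)
  have "(\<lambda>v. x v + (\<lambda>_. - 1) v * y v) \<in> polynomial_functions m"
    by (intro polynomial_functions.intros xy)
  then show "x - y \<in> polynomial_functions m" by (simp add: fun_diff_def)
qed

lemma polynomial_functions_mono: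
  assumes "m \<le> n"
  shows "polynomial_functions m \<subseteq> polynomial_functions n"
proof
  fix p assume "p \<in> polynomial_functions m"
  then show "p \<in> polynomial_functions n"
    by induction (use assms in \<open>auto intro: polynomial_functions.intros\<close>)
qed

text \<open>Opens the way to the basis theorem by induction on the number of variables.\<close>

lemma polynomial_functions_Suc:
  "polynomial_functions (Suc m) =
     adjoin (polynomial_functions m :: ((nat \<Rightarrow> 'k::field) \<Rightarrow> 'k) set) (\<lambda>v. v m)"
  (is "?L = ?A")
proof
  interpret P: function_algebra "polynomial_functions m :: ((nat \<Rightarrow> 'k) \<Rightarrow> 'k) set"
    by (rule function_algebra_polynomial_functions)
  interpret P': function_algebra "polynomial_functions (Suc m) :: ((nat \<Rightarrow> 'k) \<Rightarrow> 'k) set"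
    by (rule function_algebra_polynomial_functions)
  interpret A: subring_of ?A by (rule P.subring_of_adjoin)
  have base: "p \<in> ?A" if "p \<in> polynomial_functions m" for p
    using that unfolding adjoin_def
    by (intro CollectI exI[of _ "[:p:]"])
      (auto simp: coeff_pCons intro: P.zero_closed split: nat.splits)
  have var: "(\<lambda>v. v m) \<in> ?A"
    unfolding adjoin_def
    by (intro CollectI exI[of _ "[:0, 1:]"])
      (auto simp: coeff_pCons intro: P.zero_closed P.one_closed split: nat.splits)
  show "?L \<subseteq> ?A"
  proof
    fix p assume "p \<in> ?L"
    then show "p \<in> ?A"
    proof induction
      case (coord i)
      then show ?case using var base polynomial_functions.coord[of i m] by (cases "i = m") auto
    next
      case (add p q)
      then show ?case using A.add_closed[of p q] by (simp add: plus_fun_def)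
    next
      case (mult p q)
      then show ?case using A.mult_closed[of p q] by (simp add: times_fun_def)
    qed (auto intro: base polynomial_functions.const)
  qed
  have "poly p (\<lambda>v. v m) \<in> ?L" if "\<forall>i. coeff p i \<in> polynomial_functions m"
    for p :: "((nat \<Rightarrow> 'k) \<Rightarrow> 'k) poly"
    using that
  proof (induction p)
    case (pCons a p)
    have a: "a \<in> ?L" using spec[OF pCons.prems, of 0] polynomial_functions_mono[of m "Suc m"] by auto
    have "\<forall>i. coeff p i \<in> polynomial_functions m"
    proof
      show "coeff p i \<in> polynomial_functions m" for i using spec[OF pCons.prems, of "Suc i"] by simp
    qed
    then have "a + (\<lambda>v. v m) * poly p (\<lambda>v. v m) \<in> ?L"
      using a pCons.IH polynomial_functions.coord[of m "Suc m"]
      by (intro P'.add_closed P'.mult_closed) auto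
    then show ?case by (simp only: poly_pCons)
  qed (use P'.zero_closed in simp)
  then show "?A \<subseteq> ?L" by (auto simp: adjoin_def)
qed

lemma noetherian_polynomial_functions:
  "noetherian (polynomial_functions m :: ((nat \<Rightarrow> 'k::field) \<Rightarrow> 'k) set)"
proof (induction m)
  case 0
  interpret P: function_algebra "polynomial_functions 0 :: ((nat \<Rightarrow> 'k) \<Rightarrow> 'k) set"
    by (rule function_algebra_polynomial_functions)
  have const: "\<exists>c. p = (\<lambda>_. c)" if "p \<in> polynomial_functions 0" for p :: "(nat \<Rightarrow> 'k) \<Rightarrow> 'k"
    using that by induction auto
  have "\<exists>B. finite B \<and> B \<subseteq> I \<and> I \<subseteq> ideal_gen (polynomial_functions 0) B"
    if I: "ideal_in (polynomial_functions 0 :: ((nat \<Rightarrow> 'k) \<Rightarrow> 'k) set) I" for I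
  proof (cases "1 \<in> I")
    case True
    have "x \<in> ideal_gen (polynomial_functions 0) {1}" if "x \<in> I" for x
      using ideal_gen.step[OF ideal_gen.zero, of x "polynomial_functions 0" 1 "{1}"]
        ideal_inD(1)[OF I that] by auto
    then show ?thesis using True by (intro exI[of _ "{1}"]) auto
  next
    case False
    have "I \<subseteq> {0}"
    proof
      fix x assume x: "x \<in> I"
      then obtain c where c: "x = (\<lambda>_. c)" using const ideal_inD(1)[OF I] by blast
      then have "c = 0" using P.const_in_ideal[OF I] x False by auto
      then show "x \<in> {0}" by (simp add: c zero_fun_def)
    qed
    then show ?thesis by (intro exI[of _ "{}"]) (auto intro: ideal_gen.zero)
  qed
  then show ?case by (simp add: noetherian_def)
next
  case (Suc m)
  interpret P: function_algebra "polynomial_functions m :: ((nat \<Rightarrow> 'k) \<Rightarrow> 'k) set"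
    by (rule function_algebra_polynomial_functions)
  show ?case unfolding polynomial_functions_Suc by (rule P.noetherian_adjoin[OF Suc])
qed

text \<open>Every single exponent is bounded, not the total degree: there are then at most
  \<open>(D + 1) ^ m\<close> monomials, and bounds add under products.\<close>

definition monomials :: "nat \<Rightarrow> nat \<Rightarrow> ((nat \<Rightarrow> 'k::field) \<Rightarrow> 'k) set" where
  "monomials m D = (\<lambda>e v. \<Prod>i<m. v i ^ e i) ` (PiE {..<m} (\<lambda>_. {..D}))"

lemma finite_monomials: "finite (monomials m D)"
  by (simp add: monomials_def finite_PiE)

lemma card_monomials: "card (monomials m D) \<le> (D + 1) ^ m"
proof -
  have "card (monomials m D) \<le> card (PiE {..<m} (\<lambda>_. {..D}))"
    unfolding monomials_def by (rule card_image_le) (simp add: finite_PiE)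
  then show ?thesis by (simp add: card_PiE)
qed

lemma monomials_mult:
  assumes "f \<in> monomials m D" "g \<in> monomials m D'"
  shows "f * g \<in> monomials m (D + D')"
proof -
  obtain e e' where e: "f = (\<lambda>v. \<Prod>i<m. v i ^ e i)" "e \<in> PiE {..<m} (\<lambda>_. {..D})"
    "g = (\<lambda>v. \<Prod>i<m. v i ^ e' i)" "e' \<in> PiE {..<m} (\<lambda>_. {..D'})"
    using assms unfolding monomials_def by blast
  have "f * g = (\<lambda>v. \<Prod>i<m. v i ^ (restrict (\<lambda>i. e i + e' i) {..<m}) i)"
    by (auto simp: e power_add prod.distrib fun_eq_iff)
  moreover have "restrict (\<lambda>i. e i + e' i) {..<m} \<in> PiE {..<m} (\<lambda>_. {..D + D'})"
    using e by (auto simp: PiE_iff add_mono)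
  ultimately show ?thesis unfolding monomials_def by blast
qed

lemma span_mult:
  assumes "f \<in> fun_vs.span A" "g \<in> fun_vs.span B" "\<And>a b. a \<in> A \<Longrightarrow> b \<in> B \<Longrightarrow> a * b \<in> C"
  shows "f * g \<in> fun_vs.span C"
proof -
  have 1: "a * g \<in> fun_vs.span C" if "a \<in> A" for a
    using assms(2)
  proof (induction rule: fun_vs.span_induct_alt)
    case base
    show ?case unfolding mult_zero_right by (rule fun_vs.span_zero)
  next
    case (step c x y)
    have eq: "a * ((\<lambda>t. c * x t) + y) = (\<lambda>t. c * (a * x) t) + a * y"
      by (auto simp: algebra_simps)
    show ?case
      unfolding eq
      by (intro fun_vs.span_add fun_vs.span_scale fun_vs.span_base step assms(3)[OF that step(1)])
  qed
  show ?thesis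
    using assms(1)
  proof (induction rule: fun_vs.span_induct_alt)
    case base
    show ?case unfolding mult_zero_left by (rule fun_vs.span_zero)
  next
    case (step c x y)
    have eq: "((\<lambda>t. c * x t) + y) * g = (\<lambda>t. c * (x * g) t) + y * g" by (auto simp: algebra_simps)
    show ?case
      unfolding eq by (intro fun_vs.span_add fun_vs.span_scale step 1[OF step(1)])
  qed
qed

lemma monomials_mono: "D \<le> D' \<Longrightarrow> monomials m D \<subseteq> monomials m D'"
  unfolding monomials_def by (intro image_mono PiE_mono) auto

lemma polynomial_functions_span:
  assumes "p \<in> polynomial_functions m"
  shows "\<exists>D. p \<in> fun_vs.span (monomials m D)"
  using assms
proof induction
  case (const c)
  have "(\<lambda>_. 1) \<in> monomials m 0"
    unfolding monomials_def by (intro image_eqI[of _ _ "restrict (\<lambda>_. 0) {..<m}"]) auto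
  from fun_vs.span_scale[OF fun_vs.span_base[OF this], of c] show ?case by auto
next
  case (coord i)
  have "(\<lambda>v. v i) \<in> monomials m 1"
    unfolding monomials_def
  proof (rule image_eqI)
    show "(\<lambda>v. v i) = (\<lambda>v. \<Prod>j<m. v j ^ (restrict (\<lambda>j. if j = i then 1 else 0) {..<m}) j)"
    proof
      fix v
      have "(\<Prod>j<m. v j ^ (restrict (\<lambda>j. if j = i then 1 else 0) {..<m}) j) =
          (\<Prod>j<m. if j = i then v j else 1)"
        by (rule prod.cong) auto
      then show "v i = (\<Prod>j<m. v j ^ (restrict (\<lambda>j. if j = i then 1 else 0) {..<m}) j)"
        using coord by simp
    qed
  qed (auto simp: PiE_iff extensional_def)
  then show ?case by (blast intro: fun_vs.span_base)
next
  case (add p q)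
  then obtain D D' where "p \<in> fun_vs.span (monomials m D)" "q \<in> fun_vs.span (monomials m D')" by blast
  moreover have "monomials m D \<subseteq> monomials m (max D D')" "monomials m D' \<subseteq> monomials m (max D D')"
    by (rule monomials_mono, simp)+
  ultimately have "p \<in> fun_vs.span (monomials m (max D D'))" "q \<in> fun_vs.span (monomials m (max D D'))"
    using fun_vs.span_mono by blast+
  from fun_vs.span_add[OF this] show ?case by (auto simp: plus_fun_def)
next
  case (mult p q)
  then obtain D D' where "p \<in> fun_vs.span (monomials m D)" "q \<in> fun_vs.span (monomials m D')" by blast
  then have "p * q \<in> fun_vs.span (monomials m (D + D'))" by (rule span_mult) (rule monomials_mult)
  then show ?case by (auto simp: times_fun_def)
qed

text \<open>An ideal \<open>M\<close> that is maximal among those containing \<open>I\<close> but no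
  power of \<open>g\<close> becomes maximal once \<open>g\<close> is inverted. Uncountability of the
  field shows that each coordinate is constant modulo \<open>M\<close>, so \<open>M\<close> has a
  zero, at which \<open>g\<close> does not vanish.\<close>

theorem nullstellensatz:
  fixes I :: "((nat \<Rightarrow> 'k::alg_closed_field) \<Rightarrow> 'k) set"
  assumes unc: "uncountable (UNIV :: 'k set)"
    and I: "ideal_in (polynomial_functions m) I" and g: "g \<in> polynomial_functions m"
    and zero: "\<And>v. v \<in> affine_space m \<Longrightarrow> (\<forall>f\<in>I. f v = 0) \<Longrightarrow> g v = 0"
  shows "\<exists>n. g ^ n \<in> I"
proof (rule ccontr)
  assume neg: "\<nexists>n. g ^ n \<in> I"
  let ?R = "polynomial_functions m :: ((nat \<Rightarrow> 'k) \<Rightarrow> 'k) set"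
  interpret function_algebra ?R by (rule function_algebra_polynomial_functions)
  define F where "F = {J. ideal_in ?R J \<and> I \<subseteq> J \<and> (\<forall>n. g ^ n \<notin> J)}"
  have "I \<in> F" using I neg by (auto simp: F_def)
  then obtain M where MF: "M \<in> F" and max: "\<And>J. J \<in> F \<Longrightarrow> M \<subseteq> J \<Longrightarrow> J = M"
    using noetherian_maximal[OF noetherian_polynomial_functions, of F I] by (auto simp: F_def)
  then have M: "ideal_in ?R M" and IM: "I \<subseteq> M" and gM: "\<And>n. g ^ n \<notin> M" by (auto simp: F_def)
  \<comment> \<open>By maximality every \<open>a\<close> outside \<open>M\<close> divides a power of
    \<open>g\<close> modulo \<open>M\<close>, that is, becomes invertible together with
    \<open>g\<close>.\<close>
  have hit: "\<exists>n r. r \<in> ?R \<and> g ^ n - r * a \<in> M" if a: "a \<in> ?R" "a \<notin> M" for a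
  proof -
    let ?J = "{x + a * r | x r. x \<in> M \<and> r \<in> ?R}"
    have J: "ideal_in ?R ?J" by (rule ideal_in_add_principal[OF M a(1)])
    have "M \<subseteq> ?J" by (rule add_principal_incl)
    moreover have "a \<in> ?J" by (rule add_principal_mem[OF M])
    ultimately have "?J \<notin> F" using max a by blast
    then obtain n where "g ^ n \<in> ?J" using J \<open>M \<subseteq> ?J\<close> IM by (auto simp: F_def)
    then obtain x r where "x \<in> M" "r \<in> ?R" "g ^ n = x + a * r" by blast
    then have "g ^ n - r * a \<in> M" by (simp add: mult.commute)
    then show ?thesis using \<open>r \<in> ?R\<close> by blast
  qed
  have prime: "prime_in ?R M"
    unfolding prime_in_def
  proof (intro conjI ballI impI M)
    show "1 \<notin> M" using gM[of 0] by simp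
    fix a b assume a: "a \<in> ?R" and b: "b \<in> ?R" and ab: "a * b \<in> M"
    show "a \<in> M \<or> b \<in> M"
    proof (rule ccontr)
      assume "\<not> (a \<in> M \<or> b \<in> M)"
      then obtain i r j s where r: "r \<in> ?R" "g ^ i - r * a \<in> M" and s: "s \<in> ?R" "g ^ j - s * b \<in> M"
        using hit a b by blast
      have "g ^ j * (g ^ i - r * a) + (r * a) * (g ^ j - s * b) + (r * s) * (a * b) \<in> M"
        using g a r(1) s(1) by (intro ideal_inD(3)[OF M] ideal_inD(4)[OF M] r(2) s(2) ab) (auto intro: closed)
      also have "g ^ j * (g ^ i - r * a) + (r * a) * (g ^ j - s * b) + (r * s) * (a * b) = g ^ (i + j)"
        by (simp add: algebra_simps power_add)
      finally show False using gM by blast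
    qed
  qed
  \<comment> \<open>Otherwise every difference of the coordinate and a constant divides a power of
    \<open>g\<close> modulo \<open>M\<close>. One exponent \<open>j\<close> serves uncountably many
    constants, so \<open>polynomial_relation\<close> with \<open>g ^ j\<close> for \<open>w\<close>
    makes the coordinate algebraic modulo \<open>M\<close>, hence constant.\<close>
  have "\<exists>a. (\<lambda>v. v i) - (\<lambda>_. a) \<in> M" if i: "i < m" for i
  proof (rule ccontr)
    assume no: "\<nexists>a. (\<lambda>v. v i) - (\<lambda>_. a) \<in> M"
    have x: "(\<lambda>v. v i) \<in> ?R" using i by (rule polynomial_functions.coord)
    have "\<exists>n r. r \<in> ?R \<and> g ^ n - r * ((\<lambda>v. v i) - (\<lambda>_. a)) \<in> M" for a
      using no x const_closed by (intro hit) (auto intro!: closed)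
    then obtain n r where nr: "\<And>a. r a \<in> ?R \<and> g ^ n a - r a * ((\<lambda>v. v i) - (\<lambda>_. a)) \<in> M" by metis
    have "\<exists>j. uncountable {a. n a = j}"
    proof (rule ccontr)
      assume "\<nexists>j. uncountable {a. n a = j}"
      then have "countable (\<Union>j. {a. n a = j})" by (intro countable_UN) auto
      moreover have "(\<Union>j. {a. n a = j}) = UNIV" by auto
      ultimately show False using unc by simp
    qed
    then obtain j where j: "uncountable {a. n a = j}" by blast
    have r: "r a \<in> ?R \<and> g ^ j - r a * ((\<lambda>v. v i) - (\<lambda>_. a)) \<in> M" if "a \<in> {a. n a = j}" for a
      using nr[of a] that by simp
    obtain q where q: "q \<noteq> 0" "(\<lambda>v. poly q (v i)) * g ^ j \<in> M"
      by (rule polynomial_relation[OF M x j finite_monomials polynomial_functions_span r])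
    then have "(\<lambda>v. poly q (v i)) \<in> M"
      using prime_inD(3)[OF prime poly_closed[OF x, of q] power_closed[OF g, of j]] gM by blast
    then show False using prime_in_root[OF function_algebra_axioms prime x q(1)] no by blast
  qed
  then obtain a where a: "\<And>i. i < m \<Longrightarrow> (\<lambda>v. v i) - (\<lambda>_. a i) \<in> M" by metis
  \<comment> \<open>The entries from \<open>m\<close> on are zero as \<open>affine_space m\<close>
    demands. Modulo \<open>M\<close> each polynomial function equals its value at \<open>v\<close>,
    which makes \<open>v\<close> a zero of \<open>M\<close>.\<close>
  define v where "v = (\<lambda>i. if i < m then a i else 0)"
  have eval: "p - (\<lambda>_. p v) \<in> M" if "p \<in> ?R" for p
    using that
  proof induction
    case (const c)
    then show ?case using ideal_inD(2)[OF M] by (simp add: zero_fun_def fun_diff_def)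
  next
    case (coord i)
    then show ?case using a[OF coord] by (simp add: v_def fun_diff_def)
  next
    case (add p q)
    have "(p - (\<lambda>_. p v)) + (q - (\<lambda>_. q v)) \<in> M" using add by (intro ideal_inD(3)[OF M])
    also have "(p - (\<lambda>_. p v)) + (q - (\<lambda>_. q v)) = (\<lambda>x. p x + q x) - (\<lambda>_. p v + q v)" by auto
    finally show ?case .
  next
    case (mult p q)
    have "q * (p - (\<lambda>_. p v)) + (\<lambda>_. p v) * (q - (\<lambda>_. q v)) \<in> M"
      using mult const_closed by (intro ideal_inD(3)[OF M] ideal_inD(4)[OF M])
    also have "q * (p - (\<lambda>_. p v)) + (\<lambda>_. p v) * (q - (\<lambda>_. q v)) = (\<lambda>x. p x * q x) - (\<lambda>_. p v * q v)"
      by (auto simp: algebra_simps)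
    finally show ?case .
  qed
  have vanish: "p v = 0" if "p \<in> M" for p
  proof (rule ccontr)
    assume "p v \<noteq> 0"
    have "p - (p - (\<lambda>_. p v)) \<in> M"
      using eval[OF ideal_inD(1)[OF M that]] by (rule ideal_diff[OF M that])
    moreover have "p - (p - (\<lambda>_. p v)) = (\<lambda>_. p v)" by auto
    ultimately have "(\<lambda>_. p v) \<in> M" by (simp only:)
    then show False using const_in_ideal[OF M, of "p v"] \<open>p v \<noteq> 0\<close> gM[of 0] by simp
  qed
  have "g v = 0" by (rule zero) (use vanish IM in \<open>auto simp: v_def affine_space_def\<close>)
  then have "g \<in> M" using eval[OF g] by (simp add: fun_diff_def)
  then show False using gM[of 1] by simp
qed

section \<open>The Zariski topology of an affine variety\<close>

text \<open>It is convenient to represent the regular functions on \<open>V\<close> by a ring \<open>R\<close> of total functions,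
  for which the ring operations are those of the function type. The sets \<open>F D\<close> span the functions of
  degree at most \<open>D\<close> in each of \<open>m\<close> generators.\<close>

locale affine_functions = function_algebra R
  for R :: "('p \<Rightarrow> 'k::alg_closed_field) set" +
  fixes V :: "('p, 'k) fun_space" and m :: nat and F :: "nat \<Rightarrow> ('p \<Rightarrow> 'k) set"
  assumes fun_algebra: "fun_algebra V"
    and regular: "regular V = (\<lambda>f. restrict f (points V)) ` R"
    and noetherian: "noetherian R"
    and zero_locus: "\<lbrakk>ideal_in R I; g \<in> R; \<And>f. f \<in> R \<Longrightarrow> \<forall>x\<in>points V. f x = 0 \<Longrightarrow> f \<in> I;
        \<And>x. x \<in> points V \<Longrightarrow> \<forall>f\<in>I. f x = 0 \<Longrightarrow> g x = 0\<rbrakk> \<Longrightarrow> \<exists>n. g ^ n \<in> I"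
    and separating: "\<lbrakk>x \<in> points V; y \<in> points V; x \<noteq> y\<rbrakk> \<Longrightarrow> \<exists>f\<in>R. f x \<noteq> f y"
    and finite_F: "finite (F D)"
    and card_F: "card (F D) \<le> (D + 1) ^ m"
    and F_mult: "f \<in> F D \<Longrightarrow> g \<in> F D' \<Longrightarrow> f * g \<in> F (D + D')"
    and F_mono: "D \<le> D' \<Longrightarrow> F D \<subseteq> F D'"
    and F_one: "1 \<in> F 0"
    and F_span: "f \<in> R \<Longrightarrow> \<exists>D. f \<in> fun_vs.span (F D)"

lemma irreducible_in_Un:
  "irreducible_in T S \<Longrightarrow> closedin T A \<Longrightarrow> closedin T B \<Longrightarrow> S \<subseteq> A \<union> B \<Longrightarrow> S \<subseteq> A \<or> S \<subseteq> B"
  by (simp add: irreducible_in_def)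

text \<open>\<open>R\<close> consists of polynomial functions composed with the embedding, as total
  functions; elements of \<open>R\<close> can agree on \<open>V\<close> and differ elsewhere. For
  this reason \<open>zero_locus\<close> concerns ideals that contain every element of
  \<open>R\<close> vanishing on \<open>V\<close>.\<close>

lemma affine_functions_exist:
  fixes V :: "('p, 'k::alg_closed_field) fun_space"
  assumes unc: "uncountable (UNIV :: 'k set)" and V: "affine_variety V"
  shows "\<exists>R m F. affine_functions R V m F"
proof -
  obtain m \<phi> where inj: "inj_on \<phi> (points V)" and alg: "algebraic_set m (\<phi> ` points V)"
    and reg: "regular V = {restrict (\<lambda>x. p (\<phi> x)) (points V) | p. p \<in> polynomial_functions m}"
    using V unfolding affine_variety_def by blast
  obtain P where P: "P \<subseteq> polynomial_functions m"
    "\<phi> ` points V = {v \<in> affine_space m. \<forall>p\<in>P. p v = 0}"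
    using alg unfolding algebraic_set_def by blast
  define pull where "pull p = (\<lambda>x. p (\<phi> x))" for p :: "(nat \<Rightarrow> 'k) \<Rightarrow> 'k"
  interpret P: function_algebra "polynomial_functions m :: ((nat \<Rightarrow> 'k) \<Rightarrow> 'k) set"
    by (rule function_algebra_polynomial_functions)
  have pull: "pull (p + q) = pull p + pull q" "pull (p - q) = pull p - pull q"
    "pull (p * q) = pull p * pull q" "pull 1 = 1" "pull (\<lambda>_. c) = (\<lambda>_. c)" "pull 0 = 0" for p q c
    by (auto simp: pull_def)
  have pull_power: "pull (p ^ n) = pull p ^ n" for p n
    by (auto simp: pull_def power_fun_apply)
  define R where "R = pull ` polynomial_functions m"
  have fa: "function_algebra R"
  proof
    show "1 \<in> R" unfolding R_def by (rule image_eqI[where x = 1]) (rule pull(4)[symmetric], rule P.one_closed)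
    show "(\<lambda>_. c) \<in> R" for c 
      unfolding R_def by (rule image_eqI[where x = "\<lambda>_. c"]) (rule pull(5)[symmetric], rule P.const_closed)
    show "x - y \<in> R" "x * y \<in> R" if "x \<in> R" "y \<in> R" for x y
      using that unfolding R_def
      by (auto simp: pull(2,3)[symmetric] intro!: imageI P.diff_closed P.mult_closed)
  qed
  interpret R: function_algebra R by (rule fa)
  have span: "pull p \<in> fun_vs.span (pull ` A)" if "p \<in> fun_vs.span A" for p A
    using that
  proof (induction rule: fun_vs.span_induct_alt)
    case base
    show ?case unfolding pull(6) by (rule fun_vs.span_zero)
  next
    case (step c x y)
    have eq: "pull ((\<lambda>t. c * x t) + y) = (\<lambda>t. c * pull x t) + pull y" by (auto simp: pull_def)
    show ?case
      unfolding eq by (intro fun_vs.span_add fun_vs.span_scale fun_vs.span_base imageI step)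
  qed
  have "affine_functions R V m (\<lambda>D. pull ` monomials m D)"
  proof
    show "fun_algebra V" by (rule fun_algebra_affine_variety[OF V])
    show "regular V = (\<lambda>f. restrict f (points V)) ` R"
      unfolding reg R_def pull_def by auto
    show "noetherian R"
      unfolding R_def
      by (rule noetherian_image[OF P.subring_of_axioms noetherian_polynomial_functions]) (rule pull)+
    show "\<exists>f\<in>R. f x \<noteq> f y" if xy: "x \<in> points V" "y \<in> points V" "x \<noteq> y" for x y
    proof -
      have "\<phi> x \<noteq> \<phi> y" using inj xy by (auto simp: inj_on_def)
      then obtain i where i: "\<phi> x i \<noteq> \<phi> y i" by auto
      moreover have "\<phi> x \<in> affine_space m" "\<phi> y \<in> affine_space m" using P xy by auto
      ultimately have "i < m" unfolding affine_space_def by (metis (mono_tags) mem_Collect_eq not_le)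
      then have "pull (\<lambda>v. v i) \<in> R" unfolding R_def by (intro imageI polynomial_functions.coord)
      then show ?thesis using i by (intro bexI[of _ "pull (\<lambda>v. v i)"]) (auto simp: pull_def)
    qed
    show "finite (pull ` monomials m D)" for D by (simp add: finite_monomials)
    show "card (pull ` monomials m D) \<le> (D + 1) ^ m" for D
      by (rule order_trans[OF card_image_le[OF finite_monomials] card_monomials])
    show "f * g \<in> pull ` monomials m (D + D')"
      if "f \<in> pull ` monomials m D" "g \<in> pull ` monomials m D'" for f g D D'
      using that by (auto simp: pull(3)[symmetric] intro!: imageI monomials_mult)
    show "pull ` monomials m D \<subseteq> pull ` monomials m D'" if "D \<le> D'" for D D'
      by (intro image_mono monomials_mono that)
    have "1 \<in> (monomials m 0 :: ((nat \<Rightarrow> 'k) \<Rightarrow> 'k) set)"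
      unfolding monomials_def one_fun_def
      by (intro image_eqI[of _ _ "restrict (\<lambda>_. 0) {..<m}"]) auto
    then show "1 \<in> pull ` monomials m 0" by (rule image_eqI[where x = 1, rotated]) (rule pull(4)[symmetric])
    show "\<exists>D. f \<in> fun_vs.span (pull ` monomials m D)" if "f \<in> R" for f
      using that polynomial_functions_span span unfolding R_def by blast
    show "\<exists>n. g ^ n \<in> I"
      if I: "ideal_in R I" and g: "g \<in> R"
        and V0: "\<And>f. f \<in> R \<Longrightarrow> \<forall>x\<in>points V. f x = 0 \<Longrightarrow> f \<in> I"
        and zero: "\<And>x. x \<in> points V \<Longrightarrow> \<forall>f\<in>I. f x = 0 \<Longrightarrow> g x = 0" for I g
    proof -
      obtain p where p: "p \<in> polynomial_functions m" "g = pull p" using g by (auto simp: R_def)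
      define J where "J = {q \<in> polynomial_functions m. pull q \<in> I}"
      have J: "ideal_in (polynomial_functions m) J"
        unfolding ideal_in_def J_def
        using ideal_inD[OF I] by (auto simp: pull P.closed R_def)
      have "\<exists>n. p ^ n \<in> J"
      proof (rule nullstellensatz[OF unc J p(1)])
        fix v :: "nat \<Rightarrow> 'k" assume v: "v \<in> affine_space m" "\<forall>f\<in>J. f v = 0"
        \<comment> \<open>The equations of the embedded variety pull back to functions that vanish
          on \<open>V\<close>, which belong to \<open>I\<close>; so a zero of \<open>J\<close> is
          the image of a point of \<open>V\<close>.\<close>
        have "q \<in> J" if "q \<in> P" for q
        proof -
          have "pull q x = 0" if "x \<in> points V" for x
            using P \<open>q \<in> P\<close> that unfolding pull_def by blast
          then have "pull q \<in> I" using P(1) \<open>q \<in> P\<close> by (intro V0) (auto simp: R_def)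
          then show ?thesis using P(1) \<open>q \<in> P\<close> by (auto simp: J_def)
        qed
        then have "v \<in> \<phi> ` points V" unfolding P(2) using v by blast
        then obtain x where x: "x \<in> points V" "v = \<phi> x" by blast
        have "f x = 0" if "f \<in> I" for f
        proof -
          obtain q where "q \<in> polynomial_functions m" "f = pull q"
            using ideal_inD(1)[OF I \<open>f \<in> I\<close>] by (auto simp: R_def)
          then show ?thesis using v(2) that x by (auto simp: J_def pull_def)
        qed
        then have "g x = 0" using zero x by blast
        then show "p v = 0" by (simp add: p pull_def x)
      qed
      then show ?thesis by (auto simp: J_def p pull_power)
    qed
  qed
  then show ?thesis by blast
qed

context affine_functions
begin

abbreviation "Pt \<equiv> points V"
abbreviation "Zar \<equiv> zariski_topology V"

section \<open>Vanishing ideals, irreducible closed sets and decomposition\<close>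

definition vanishing :: "'p set \<Rightarrow> ('p \<Rightarrow> 'k) set" where
  "vanishing S = {f \<in> R. \<forall>x\<in>S. f x = 0}"

lemma topspace_Zar: "topspace Zar = Pt"
  by (rule topspace_zariski_topology[OF fun_algebra])

lemma closedin_iff: "closedin Zar C \<longleftrightarrow> (\<exists>E\<subseteq>R. C = {x \<in> Pt. \<forall>f\<in>E. f x = 0})"
proof -
  have 1: "zeros V ((\<lambda>f. restrict f Pt) ` E) = {x \<in> Pt. \<forall>f\<in>E. f x = 0}" for E
    by (auto simp: zeros_def)
  have 2: "E \<subseteq> regular V \<longleftrightarrow> (\<exists>E'\<subseteq>R. E = (\<lambda>f. restrict f Pt) ` E')" for E
    unfolding regular by (simp add: subset_image_iff)
  show ?thesis unfolding closedin_zariski_topology[OF fun_algebra] 2 using 1 by auto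
qed

lemma closedin_zeros: "E \<subseteq> R \<Longrightarrow> closedin Zar {x \<in> Pt. \<forall>f\<in>E. f x = 0}"
  unfolding closedin_iff by blast

lemma closedin_zero: "f \<in> R \<Longrightarrow> closedin Zar {x \<in> Pt. f x = 0}"
  using closedin_zeros[of "{f}"] by simp

lemma closedin_Int_zero:
  assumes "closedin Zar S" "f \<in> R"
  shows "closedin Zar {x \<in> S. f x = 0}"
proof -
  have "{x \<in> S. f x = 0} = S \<inter> {x \<in> Pt. f x = 0}"
    using closedin_subset[OF assms(1)] topspace_Zar by auto
  then show ?thesis using closedin_Int[OF assms(1) closedin_zero[OF assms(2)]] by simp
qed

lemma closedin_sub: "closedin Zar S \<Longrightarrow> S \<subseteq> Pt"
  using closedin_subset topspace_Zar by blast

lemma vanishing_ideal: "ideal_in R (vanishing S)"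
  by (auto simp: ideal_in_def vanishing_def closed)

lemma vanishing_antimono: "S \<subseteq> T \<Longrightarrow> vanishing T \<subseteq> vanishing S"
  by (auto simp: vanishing_def)

lemma closedin_separate:
  assumes "closedin Zar C" "x \<in> Pt" "x \<notin> C"
  shows "\<exists>f\<in>vanishing C. f x \<noteq> 0"
  using assms unfolding closedin_iff vanishing_def by fastforce

lemma closedin_vanishing_subset:
  assumes "closedin Zar C" "S \<subseteq> Pt" "vanishing C \<subseteq> vanishing S"
  shows "S \<subseteq> C"
proof
  fix x assume "x \<in> S"
  then show "x \<in> C" using closedin_separate[OF assms(1), of x] assms by (auto simp: vanishing_def)
qed

lemma vanishing_psubset:
  assumes "closedin Zar C" "closedin Zar D" "C \<subset> D"
  shows "vanishing D \<subset> vanishing C"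
  using vanishing_antimono[of C D] closedin_vanishing_subset[OF assms(1), of D] closedin_sub assms
  by blast

lemma irreducible_mult_zero:
  assumes S: "irreducible_in Zar S" and "f \<in> R" "g \<in> R" "\<And>x. x \<in> S \<Longrightarrow> f x * g x = 0"
  shows "(\<forall>x\<in>S. f x = 0) \<or> (\<forall>x\<in>S. g x = 0)"
proof -
  have SP: "S \<subseteq> Pt" using S topspace_Zar by (simp add: irreducible_in_def)
  have "S \<subseteq> {x \<in> Pt. f x = 0} \<union> {x \<in> Pt. g x = 0}" using assms(4) SP by auto
  then have "S \<subseteq> {x \<in> Pt. f x = 0} \<or> S \<subseteq> {x \<in> Pt. g x = 0}"
    by (rule irreducible_in_Un[OF S closedin_zero[OF assms(2)] closedin_zero[OF assms(3)]])
  then show ?thesis by auto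
qed

lemma prime_vanishing:
  assumes S: "irreducible_in Zar S"
  shows "prime_in R (vanishing S)"
  unfolding prime_in_def
proof (intro conjI ballI impI vanishing_ideal)
  show "1 \<notin> vanishing S" using S by (auto simp: vanishing_def irreducible_in_def)
  show "a \<in> vanishing S \<or> b \<in> vanishing S" if "a \<in> R" "b \<in> R" "a * b \<in> vanishing S" for a b
    using that irreducible_mult_zero[OF S, of a b] by (auto simp: vanishing_def)
qed

text \<open>Closed sets are determined by their vanishing ideals with inclusions reversed, so
  maximal ideals of the family give minimal sets.\<close>

lemma closedin_minimal:
  assumes "\<And>C. C \<in> \<C> \<Longrightarrow> closedin Zar C" "C0 \<in> \<C>"
  shows "\<exists>C\<in>\<C>. \<forall>D\<in>\<C>. D \<subseteq> C \<longrightarrow> D = C"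
proof -
  have "\<And>I. I \<in> vanishing ` \<C> \<Longrightarrow> ideal_in R I" using vanishing_ideal by blast
  then obtain M where M: "M \<in> vanishing ` \<C>" "\<And>I. I \<in> vanishing ` \<C> \<Longrightarrow> M \<subseteq> I \<Longrightarrow> I = M"
    using noetherian_maximal[OF noetherian, of "vanishing ` \<C>" "vanishing C0"] assms(2) by blast
  then obtain C where C: "C \<in> \<C>" "M = vanishing C" by blast
  have "D = C" if D: "D \<in> \<C>" "D \<subseteq> C" for D
    using vanishing_psubset[of D C] assms(1) D C M(2)[of "vanishing D"] by blast
  then show ?thesis using C by blast
qed

lemma irreducible_decomposition:
  assumes "closedin Zar C"
  shows "\<exists>\<T>. finite \<T> \<and> (\<forall>T\<in>\<T>. closedin Zar T \<and> irreducible_in Zar T) \<and> C = \<Union>\<T>"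
proof (rule ccontr)
  define ok where
    "ok C \<longleftrightarrow> (\<exists>\<T>. finite \<T> \<and> (\<forall>T\<in>\<T>. closedin Zar T \<and> irreducible_in Zar T) \<and> C = \<Union>\<T>)" for C
  assume "\<not> (\<exists>\<T>. finite \<T> \<and> (\<forall>T\<in>\<T>. closedin Zar T \<and> irreducible_in Zar T) \<and> C = \<Union>\<T>)"
  then have "\<not> ok C" by (simp only: ok_def not_False_eq_True)
  then have "C \<in> {D. closedin Zar D \<and> \<not> ok D}" using assms by simp
  from closedin_minimal[OF _ this] obtain D where D: "closedin Zar D" "\<not> ok D"
    and min: "\<And>E. closedin Zar E \<Longrightarrow> \<not> ok E \<Longrightarrow> E \<subseteq> D \<Longrightarrow> E = D" by auto
  have "ok {}" unfolding ok_def by (intro exI[of _ "{}"]) auto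
  then have "D \<noteq> {}" using D(2) by blast
  moreover have "\<not> irreducible_in Zar D"
  proof
    assume "irreducible_in Zar D"
    then have "ok D" unfolding ok_def using D(1) by (intro exI[of _ "{D}"]) auto
    then show False using D(2) by blast
  qed
  ultimately obtain A B where AB: "closedin Zar A" "closedin Zar B" "D \<subseteq> A \<union> B" "\<not> D \<subseteq> A" "\<not> D \<subseteq> B"
    using closedin_subset[OF D(1)] unfolding irreducible_in_def by blast
  have smaller: "ok (D \<inter> E)" if "closedin Zar E" "\<not> D \<subseteq> E" for E
  proof (rule ccontr)
    assume "\<not> ok (D \<inter> E)"
    then have "D \<inter> E = D" using closedin_Int[OF D(1) that(1)] by (intro min) auto
    then show False using that(2) by blast
  qed
  obtain \<T> where \<T>: "finite \<T>" "\<forall>T\<in>\<T>. closedin Zar T \<and> irreducible_in Zar T" "D \<inter> A = \<Union>\<T>"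
    using smaller[OF AB(1,4)] unfolding ok_def by blast
  obtain \<T>' where \<T>': "finite \<T>'" "\<forall>T\<in>\<T>'. closedin Zar T \<and> irreducible_in Zar T" "D \<inter> B = \<Union>\<T>'"
    using smaller[OF AB(2,5)] unfolding ok_def by blast
  have "D = \<Union>(\<T> \<union> \<T>')" using AB(3) \<T>(3) \<T>'(3) by (simp only: Union_Un_distrib) blast
  moreover have "finite (\<T> \<union> \<T>')" "\<forall>T\<in>\<T> \<union> \<T>'. closedin Zar T \<and> irreducible_in Zar T"
    using \<T> \<T>' by auto
  ultimately show False using D(2) unfolding ok_def by blast
qed

lemma irreducible_finite_union:
  assumes S: "irreducible_in Zar S" and "finite \<T>" "\<And>T. T \<in> \<T> \<Longrightarrow> closedin Zar T" "S \<subseteq> \<Union>\<T>"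
  shows "\<exists>T\<in>\<T>. S \<subseteq> T"
  using assms(2-)
proof (induction \<T>)
  case empty
  then show ?case using S by (auto simp: irreducible_in_def)
next
  case (insert T \<T>)
  then have "S \<subseteq> T \<or> S \<subseteq> \<Union>\<T>"
    using S unfolding irreducible_in_def by (metis Union_insert closedin_Union insert_iff)
  then show ?case using insert by auto
qed

lemma closedin_point: "p \<in> Pt \<Longrightarrow> closedin Zar {p}"
proof -
  assume p: "p \<in> Pt"
  let ?E = "{f - (\<lambda>_. f p) | f. f \<in> R}"
  have "{p} = {x \<in> Pt. \<forall>f\<in>?E. f x = 0}"
  proof (intro equalityI subsetI)
    fix x assume x: "x \<in> {x \<in> Pt. \<forall>f\<in>?E. f x = 0}"
    have "f x = f p" if "f \<in> R" for f
    proof -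
      have "(f - (\<lambda>_. f p)) x = 0" using x that by blast
      then show ?thesis by simp
    qed
    then show "x \<in> {p}" using separating[OF _ p, of x] x by auto
  qed (use p in auto)
  moreover have "?E \<subseteq> R" by (auto intro: closed const_closed)
  ultimately show ?thesis unfolding closedin_iff by blast
qed

lemma irreducible_point: "p \<in> Pt \<Longrightarrow> irreducible_in Zar {p}"
  by (auto simp: irreducible_in_def topspace_Zar)

section \<open>Irreducible components of a closed set, within the topology of the whole
  variety\<close>

definition component_of :: "'p set \<Rightarrow> 'p set \<Rightarrow> bool" where
  "component_of D T \<longleftrightarrow> closedin Zar T \<and> irreducible_in Zar T \<and> T \<subseteq> D \<and>
     (\<forall>S. irreducible_in Zar S \<longrightarrow> T \<subseteq> S \<longrightarrow> S \<subseteq> D \<longrightarrow> S = T)"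

lemma component_ofD:
  assumes "component_of D T"
  shows "closedin Zar T" "irreducible_in Zar T" "T \<subseteq> D"
    "irreducible_in Zar S \<Longrightarrow> T \<subseteq> S \<Longrightarrow> S \<subseteq> D \<Longrightarrow> S = T"
  using assms by (auto simp: component_of_def)

lemma component_exists:
  assumes D: "closedin Zar D" and S: "irreducible_in Zar S" "S \<subseteq> D"
  obtains T where "component_of D T" "S \<subseteq> T"
proof -
  obtain \<T> where \<T>: "finite \<T>" "\<And>T. T \<in> \<T> \<Longrightarrow> closedin Zar T \<and> irreducible_in Zar T" "D = \<Union>\<T>"
    using irreducible_decomposition[OF D] by blast
  have "{T \<in> \<T>. S \<subseteq> T} \<noteq> {}" using irreducible_finite_union[OF S(1) \<T>(1)] \<T> S(2) by blast
  then obtain T where T: "T \<in> {T \<in> \<T>. S \<subseteq> T}" "\<And>T'. T' \<in> {T \<in> \<T>. S \<subseteq> T} \<Longrightarrow> T \<subseteq> T' \<Longrightarrow> T = T'"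
    using finite_has_maximal[of "{T \<in> \<T>. S \<subseteq> T}"] \<T>(1) by auto
  have "S' = T" if S': "irreducible_in Zar S'" "T \<subseteq> S'" "S' \<subseteq> D" for S'
  proof -
    obtain T' where T': "T' \<in> \<T>" "S' \<subseteq> T'"
      using irreducible_finite_union[OF S'(1) \<T>(1)] \<T> S'(3) by blast
    then have "T = T'" using T(1) S'(2) by (intro T(2)) auto
    then show ?thesis using T' S' by blast
  qed
  then have "component_of D T" using T(1) \<T> by (auto simp: component_of_def)
  then show thesis using that T(1) by blast
qed

lemma finite_components:
  assumes D: "closedin Zar D"
  shows "finite {T. component_of D T}"
proof -
  obtain \<T> where \<T>: "finite \<T>" "\<And>T. T \<in> \<T> \<Longrightarrow> closedin Zar T \<and> irreducible_in Zar T" "D = \<Union>\<T>"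
    using irreducible_decomposition[OF D] by blast
  have "T \<in> \<T>" if T: "component_of D T" for T
  proof -
    obtain T' where T': "T' \<in> \<T>" "T \<subseteq> T'"
      using irreducible_finite_union[OF component_ofD(2)[OF T] \<T>(1)] \<T> component_ofD(3)[OF T] by blast
    then have "T' = T" using \<T> by (intro component_ofD(4)[OF T]) auto
    then show ?thesis using T' by simp
  qed
  then show ?thesis using \<T>(1) by (metis finite_subset mem_Collect_eq subsetI)
qed

lemma component_through_point:
  assumes "closedin Zar D" "x \<in> D"
  obtains T where "component_of D T" "x \<in> T"
proof -
  have "x \<in> Pt" using closedin_sub[OF assms(1)] assms(2) by blast
  from component_exists[OF assms(1) irreducible_point[OF this]] that assms(2) show thesis by auto
qed

lemma irreducible_components_eq: "irreducible_components Zar = {T. component_of Pt T}"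
proof -
  have P: "closedin Zar Pt" using topspace_Zar by (metis closedin_topspace)
  have "component_of Pt C" if C: "C \<in> irreducible_components Zar" for C
  proof -
    have irr: "irreducible_in Zar C" and max: "\<And>D. irreducible_in Zar D \<Longrightarrow> C \<subseteq> D \<Longrightarrow> D = C"
      using C by (auto simp: irreducible_components_def)
    have "C \<subseteq> Pt" using irr topspace_Zar by (simp add: irreducible_in_def)
    then obtain T where T: "component_of Pt T" "C \<subseteq> T" using component_exists[OF P irr] by blast
    then show ?thesis using max[OF component_ofD(2)] by metis
  qed
  moreover have "C \<in> irreducible_components Zar" if C: "component_of Pt C" for C
    using component_ofD[OF C] topspace_Zar
    by (auto simp: irreducible_components_def irreducible_in_def)
  ultimately show ?thesis by blast
qed

text \<open>The Nullstellensatz on a closed subvariety: the ideals above \<open>vanishing S\<close>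
  represent the ideals of its coordinate ring.\<close>

lemma zero_locus_closed:
  assumes S: "closedin Zar S" and E: "ideal_in R E" "vanishing S \<subseteq> E" and g: "g \<in> R"
    and zero: "\<And>x. x \<in> S \<Longrightarrow> \<forall>f\<in>E. f x = 0 \<Longrightarrow> g x = 0"
  shows "\<exists>n. g ^ n \<in> E"
proof (rule zero_locus[OF E(1) g])
  show "f \<in> E" if "f \<in> R" "\<forall>x\<in>Pt. f x = 0" for f
    using that E(2) closedin_sub[OF S] by (auto simp: vanishing_def)
  fix x assume x: "x \<in> Pt" "\<forall>f\<in>E. f x = 0"
  then have "x \<in> S" using closedin_separate[OF S x(1)] E(2) by blast
  then show "g x = 0" using zero x by blast
qed

text \<open>Choose \<open>t\<close> zero on the other components but not on all of \<open>T\<close>.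
  Then \<open>t * g\<close> vanishes on the whole zero set of \<open>z\<close> on \<open>S\<close>,
  and the Nullstellensatz applies. One \<open>t\<close> serves all \<open>g\<close>: away from its
  zeros, \<open>T\<close> is the entire zero set.\<close>

lemma component_radical:
  assumes S: "closedin Zar S" and z: "z \<in> R" and T: "component_of {x \<in> S. z x = 0} T"
  shows "\<exists>t\<in>R - vanishing T. \<forall>g\<in>vanishing T. \<exists>n. (t * g) ^ n \<in> {x + z * r | x r. x \<in> vanishing S \<and> r \<in> R}"
proof -
  let ?D = "{x \<in> S. z x = 0}"
  let ?E = "{x + z * r | x r. x \<in> vanishing S \<and> r \<in> R}"
  have D: "closedin Zar ?D" by (rule closedin_Int_zero[OF S z])
  define \<T> where "\<T> = {T'. component_of ?D T'} - {T}"
  have fin: "finite \<T>" using finite_components[OF D] by (simp add: \<T>_def)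
  have cl: "closedin Zar (\<Union>\<T>)"
    using fin component_ofD(1) by (intro closedin_Union) (auto simp: \<T>_def)
  have "\<not> T \<subseteq> \<Union>\<T>"
  proof
    assume "T \<subseteq> \<Union>\<T>"
    then obtain T' where "T' \<in> \<T>" "T \<subseteq> T'"
      using irreducible_finite_union[OF component_ofD(2)[OF T] fin] component_ofD(1)
      by (auto simp: \<T>_def)
    then show False using component_ofD(4)[OF T, of T'] component_ofD(2,3)[of ?D T']
      by (auto simp: \<T>_def)
  qed
  then obtain x where x: "x \<in> T" "x \<notin> \<Union>\<T>" by blast
  then obtain t where t: "t \<in> vanishing (\<Union>\<T>)" "t x \<noteq> 0"
    using closedin_separate[OF cl, of x] closedin_sub[OF component_ofD(1)[OF T]] by blast
  have tR: "t \<in> R" using t by (simp add: vanishing_def)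
  have E: "ideal_in R ?E" by (rule ideal_in_add_principal[OF vanishing_ideal z])
  have "\<exists>n. (t * g) ^ n \<in> ?E" if g: "g \<in> vanishing T" for g
  proof (rule zero_locus_closed[OF S E add_principal_incl])
    have gR: "g \<in> R" using g by (simp add: vanishing_def)
    show "t * g \<in> R" using tR gR by (rule mult_closed)
    fix y assume y: "y \<in> S" "\<forall>f\<in>?E. f y = 0"
    have "z y = 0" using y(2) add_principal_mem[OF vanishing_ideal[of S], of z] by blast
    then have "y \<in> ?D" using y by simp
    then obtain T' where T': "component_of ?D T'" "y \<in> T'" using component_through_point[OF D] by blast
    show "(t * g) y = 0"
    proof (cases "T' = T")
      case True
      then show ?thesis using g T' by (simp add: vanishing_def)
    next
      case False
      then have "y \<in> \<Union>\<T>" using T' by (auto simp: \<T>_def)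
      then have "t y = 0" using t(1) unfolding vanishing_def by blast
      then show ?thesis by simp
    qed
  qed
  moreover have "t \<in> R - vanishing T" using t x tR by (auto simp: vanishing_def)
  ultimately show ?thesis by blast
qed

text \<open>Krull's theorem read geometrically: the chain of closed sets is a chain of vanishing
  ideals, and \<open>component_radical\<close> expresses that the prime of \<open>T\<close> is
  minimal over \<open>z\<close>.\<close>

theorem hypersurface_codim_one:
  assumes S: "closedin Zar S" "irreducible_in Zar S" and z: "z \<in> R"
    and T: "component_of {x \<in> S. z x = 0} T"
    and S': "closedin Zar S'" "irreducible_in Zar S'" "T \<subset> S'" "S' \<subset> S"
  shows False
proof (rule principal_ideal_theorem[OF noetherian])
  show "prime_in R (vanishing S)" "prime_in R (vanishing S')" "prime_in R (vanishing T)"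
    using S S' component_ofD(2)[OF T] by (auto intro: prime_vanishing)
  show "vanishing S \<subset> vanishing S'" "vanishing S' \<subset> vanishing T"
    using S S' component_ofD(1)[OF T] by (simp_all only: vanishing_psubset)
  show "z \<in> vanishing T" using z component_ofD(3)[OF T] by (auto simp: vanishing_def)
  fix g assume g: "g \<in> vanishing T"
  obtain t where t: "t \<in> R - vanishing T"
    "\<And>g. g \<in> vanishing T \<Longrightarrow> \<exists>n. (t * g) ^ n \<in> {x + z * r | x r. x \<in> vanishing S \<and> r \<in> R}"
    using component_radical[OF S(1) z T] by blast
  then obtain n x r where n: "(t * g) ^ n = x + z * r" "x \<in> vanishing S" "r \<in> R" using g by blast
  have "t ^ n \<in> R - vanishing T"
    using t(1) power_closed prime_inD_power[OF prime_vanishing[OF component_ofD(2)[OF T]], of t n] by blast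
  moreover have "t ^ n * g ^ n = x + z * r" using n(1) by (simp add: power_mult_distrib)
  ultimately show "\<exists>t\<in>R - vanishing T. \<exists>c. \<exists>x\<in>vanishing S. \<exists>r\<in>R. t * g ^ c = x + z * r"
    using n by blast
qed

end

section \<open>Curves\<close>

text \<open>When points are closed, this is Krull dimension one; the form chosen speaks of no
  chains.\<close>

definition irreducible_curve :: "'p topology \<Rightarrow> 'p set \<Rightarrow> bool" where
  "irreducible_curve T \<Gamma> \<longleftrightarrow> closedin T \<Gamma> \<and> irreducible_in T \<Gamma> \<and> (\<forall>p. \<Gamma> \<noteq> {p}) \<and>
     (\<forall>S. closedin T S \<longrightarrow> irreducible_in T S \<longrightarrow> S \<subset> \<Gamma> \<longrightarrow> (\<exists>p. S = {p}))"

lemma irreducible_curveD: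
  assumes "irreducible_curve T \<Gamma>"
  shows "closedin T \<Gamma>" "irreducible_in T \<Gamma>" "\<Gamma> \<noteq> {p}"
proof -
  note * = assms[unfolded irreducible_curve_def]
  show "closedin T \<Gamma>" by (rule conjunct1[OF *])
  show "irreducible_in T \<Gamma>" by (rule conjunct1[OF conjunct2[OF *]])
  show "\<Gamma> \<noteq> {p}" by (rule spec[OF conjunct1[OF conjunct2[OF conjunct2[OF *]]]])
qed

lemma irreducible_curve_subsetD:
  assumes "irreducible_curve T \<Gamma>" "closedin T S" "irreducible_in T S" "S \<subset> \<Gamma>"
  shows "\<exists>p. S = {p}"
proof -
  have "\<forall>S. closedin T S \<longrightarrow> irreducible_in T S \<longrightarrow> S \<subset> \<Gamma> \<longrightarrow> (\<exists>p. S = {p})"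
    using assms(1) unfolding irreducible_curve_def by (elim conjE)
  then show ?thesis using assms(2-) by (elim allE[of _ S]) (elim impE; assumption)
qed

context affine_functions
begin

abbreviation "curve \<equiv> irreducible_curve Zar"

text \<open>A minimal irreducible closed set among those that are not points is a curve.\<close>

lemma curve_exists:
  assumes S: "closedin Zar S" "irreducible_in Zar S" "\<And>p. S \<noteq> {p}"
  shows "\<exists>\<Gamma>\<subseteq>S. curve \<Gamma>"
proof -
  define \<C> where "\<C> = {T. closedin Zar T \<and> irreducible_in Zar T \<and> (\<forall>p. T \<noteq> {p}) \<and> T \<subseteq> S}"
  have "S \<in> \<C>" using S by (simp add: \<C>_def)
  moreover have "closedin Zar T" if "T \<in> \<C>" for T using that by (simp add: \<C>_def)
  ultimately have "\<exists>C\<in>\<C>. \<forall>D\<in>\<C>. D \<subseteq> C \<longrightarrow> D = C" by (intro closedin_minimal)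
  then obtain \<Gamma> where \<Gamma>: "\<Gamma> \<in> \<C>" "\<forall>T\<in>\<C>. T \<subseteq> \<Gamma> \<longrightarrow> T = \<Gamma>" by (rule bexE)
  then have \<Gamma>c: "closedin Zar \<Gamma>" "irreducible_in Zar \<Gamma>" "\<forall>p. \<Gamma> \<noteq> {p}" "\<Gamma> \<subseteq> S"
    by (simp_all add: \<C>_def)
  have "\<exists>p. T = {p}" if T: "closedin Zar T" "irreducible_in Zar T" "T \<subset> \<Gamma>" for T
  proof (rule ccontr)
    assume "\<nexists>p. T = {p}"
    then have "T \<in> \<C>" using T \<Gamma>c(4) by (auto simp: \<C>_def)
    then show False using \<Gamma>(2) T(3) by blast
  qed
  then have "curve \<Gamma>" using \<Gamma>c by (simp add: irreducible_curve_def)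
  then show ?thesis using \<Gamma>c(4) by blast
qed

lemma curve_Int_finite:
  assumes \<Gamma>: "curve \<Gamma>" and D: "closedin Zar D" "\<not> \<Gamma> \<subseteq> D"
  shows "finite (\<Gamma> \<inter> D)"
proof -
  have "closedin Zar (\<Gamma> \<inter> D)" by (rule closedin_Int[OF irreducible_curveD(1)[OF \<Gamma>] D(1)])
  from irreducible_decomposition[OF this] obtain \<T> where
    \<T>: "finite \<T>" "\<And>T. T \<in> \<T> \<Longrightarrow> closedin Zar T \<and> irreducible_in Zar T" "\<Gamma> \<inter> D = \<Union>\<T>" by blast
  have "finite T" if "T \<in> \<T>" for T
  proof -
    have "T \<subset> \<Gamma>" using that \<T>(3) D(2) by blast
    then obtain p where "T = {p}" using irreducible_curve_subsetD[OF \<Gamma>, of T] \<T>(2)[OF \<open>T \<in> \<T>\<close>] by blast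
    then show ?thesis by simp
  qed
  then show ?thesis using \<T> by simp
qed

text \<open>If \<open>S\<close> is countable, a function \<open>f\<close> takes countably many
  values on it, and for every other \<open>a\<close> the difference \<open>f - a\<close> is
  invertible on \<open>S\<close>. These uncountably many inverses are dependent, so \<open>f\<close>
  is algebraic over the field and hence constant on \<open>S\<close>; but \<open>f\<close> was
  chosen to separate two points.\<close>

lemma uncountable_irreducible:
  assumes unc: "uncountable (UNIV :: 'k set)"
    and S: "closedin Zar S" "irreducible_in Zar S" "\<And>p. S \<noteq> {p}"
  shows "uncountable S"
proof
  assume "countable S"
  obtain x where x: "x \<in> S" using S(2) by (auto simp: irreducible_in_def)
  then obtain y where y: "y \<in> S" "x \<noteq> y" using S(3)[of x] by auto
  have "x \<in> Pt" "y \<in> Pt" using x y closedin_sub[OF S(1)] by auto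
  then obtain f where f: "f \<in> R" "f x \<noteq> f y" using separating y(2) by blast
  define L where "L = - (f ` S)"
  have "countable (f ` S)" using \<open>countable S\<close> by simp
  moreover have "UNIV = L \<union> f ` S" by (auto simp: L_def)
  ultimately have L: "uncountable L" using unc by (metis countable_Un)
  have "\<exists>r. r \<in> R \<and> 1 - r * (f - (\<lambda>_. a)) \<in> vanishing S" if "a \<in> L" for a
  proof -
    let ?h = "f - (\<lambda>_. a)"
    let ?E = "{x + ?h * r | x r. x \<in> vanishing S \<and> r \<in> R}"
    have h: "?h \<in> R" using f(1) const_closed by (rule diff_closed)
    have "\<exists>n. 1 ^ n \<in> ?E"
    proof (rule zero_locus_closed[OF S(1) _ add_principal_incl one_closed])
      show "ideal_in R ?E" by (rule ideal_in_add_principal[OF vanishing_ideal h])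
      fix z assume z: "z \<in> S" "\<forall>g\<in>?E. g z = 0"
      then have "?h z = 0" using add_principal_mem[OF vanishing_ideal[of S], of ?h] by blast
      then have "f z = a" by simp
      then show "(1 :: 'p \<Rightarrow> 'k) z = 0" using \<open>a \<in> L\<close> z by (auto simp: L_def)
    qed
    then obtain g r where g: "1 = g + ?h * r" "g \<in> vanishing S" "r \<in> R" by auto
    have "1 - r * ?h = g" unfolding g(1) by (simp add: algebra_simps)
    then show ?thesis using g by metis
  qed
  then obtain r where r: "\<And>a. a \<in> L \<Longrightarrow> r a \<in> R \<and> 1 - r a * (f - (\<lambda>_. a)) \<in> vanishing S" by metis
  obtain q where q: "q \<noteq> 0" "(\<lambda>x. poly q (f x)) * 1 \<in> vanishing S"
    by (rule polynomial_relation[OF vanishing_ideal f(1) L finite_F F_span r])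
  then have "(\<lambda>x. poly q (f x)) \<in> vanishing S" by (simp only: mult_1_right)
  then obtain a where "f - (\<lambda>_. a) \<in> vanishing S"
    using prime_in_root[OF function_algebra_axioms prime_vanishing[OF S(2)] f(1) q(1)] by blast
  then show False using f(2) x y by (auto simp: vanishing_def)
qed

text \<open>Prime avoidance for points: in the induction, \<open>z + a w\<close> is suitable for all
  but finitely many scalars \<open>a\<close>.\<close>

lemma vanishing_avoiding_points:
  assumes C: "closedin Zar C" and unc: "infinite (UNIV :: 'k set)"
    and Q: "finite Q" "Q \<subseteq> Pt - C"
  shows "\<exists>z\<in>vanishing C. \<forall>q\<in>Q. z q \<noteq> 0"
  using Q
proof (induction Q)
  case empty
  then show ?case using ideal_inD(2)[OF vanishing_ideal] by blast
next
  case (insert q Q)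
  then obtain z where z: "z \<in> vanishing C" "\<And>q. q \<in> Q \<Longrightarrow> z q \<noteq> 0" by auto
  obtain w where w: "w \<in> vanishing C" "w q \<noteq> 0"
    using closedin_separate[OF C, of q] insert.prems by blast
  have "finite (insert (- z q / w q) ((\<lambda>p. - z p / w p) ` Q))" using insert.hyps by simp
  then obtain a where a: "a \<notin> insert (- z q / w q) ((\<lambda>p. - z p / w p) ` Q)"
    using ex_new_if_finite[OF unc] by blast
  let ?u = "z + (\<lambda>_. a) * w"
  have "?u \<in> vanishing C"
    using z w const_closed by (intro ideal_inD(3)[OF vanishing_ideal] ideal_inD(4)[OF vanishing_ideal])
  moreover have "?u p \<noteq> 0" if "p \<in> insert q Q" for p
  proof
    assume *: "?u p = 0"
    show False
    proof (cases "w p = 0")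
      case True
      then have "p \<in> Q" using that w by auto
      then show False using z(2) * True by auto
    next
      case False
      then have "a = - z p / w p" using * by (simp add: field_simps eq_neg_iff_add_eq_0)
      then show False using a that by auto
    qed
  qed
  ultimately show ?case by blast
qed

text \<open>The witness \<open>S\<close> is minimal among the irreducible closed sets containing \<open>\<Gamma>\<close> but not contained
  in \<open>U\<close>; Krull's theorem shows that \<open>\<Gamma>\<close> is then a component of \<open>S \<inter> U\<close>, hence of the zero set of
  \<open>y\<close> on \<open>S\<close>.\<close>

lemma transversal_hypersurface:
  assumes unc: "infinite (UNIV :: 'k set)"
    and U: "closedin Zar U" and \<Gamma>: "closedin Zar \<Gamma>" "irreducible_in Zar \<Gamma>" "\<Gamma> \<subseteq> U"
    and W: "closedin Zar W" "irreducible_in Zar W" "\<Gamma> \<subseteq> W" "\<not> W \<subseteq> U"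
  shows "\<exists>S y t c. closedin Zar S \<and> irreducible_in Zar S \<and> \<Gamma> \<subset> S \<and> y \<in> vanishing U \<and>
      t \<in> R - vanishing \<Gamma> \<and>
      (\<forall>g\<in>vanishing \<Gamma>. \<exists>e\<in>R. \<forall>x\<in>S. (t x * g x) ^ c = y x * e x)"
proof -
  define \<C> where "\<C> = {S. closedin Zar S \<and> irreducible_in Zar S \<and> \<Gamma> \<subseteq> S \<and> \<not> S \<subseteq> U}"
  have "W \<in> \<C>" using W by (simp add: \<C>_def)
  moreover have "closedin Zar T" if "T \<in> \<C>" for T using that by (simp add: \<C>_def)
  ultimately have "\<exists>C\<in>\<C>. \<forall>D\<in>\<C>. D \<subseteq> C \<longrightarrow> D = C" by (intro closedin_minimal)
  then obtain S where SC: "S \<in> \<C>" and min: "\<forall>T\<in>\<C>. T \<subseteq> S \<longrightarrow> T = S" by (rule bexE)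
  then have S: "closedin Zar S" "irreducible_in Zar S" "\<Gamma> \<subseteq> S" "\<not> S \<subseteq> U"
    by (simp_all add: \<C>_def)
  \<comment> \<open>What minimality of \<open>S\<close> provides: everything irreducible and closed
    strictly between has to stay inside \<open>U\<close>.\<close>
  have inU: "T \<subseteq> S \<inter> U" if "closedin Zar T" "irreducible_in Zar T" "\<Gamma> \<subseteq> T" "T \<subset> S" for T
  proof (rule ccontr)
    assume "\<not> T \<subseteq> S \<inter> U"
    then have "T \<in> \<C>" using that by (auto simp: \<C>_def)
    then show False using min that(4) by blast
  qed
  let ?D = "S \<inter> U"
  have D: "closedin Zar ?D" using S(1) U by blast
  have \<Gamma>D: "\<Gamma> \<subseteq> ?D" using S(3) \<Gamma>(3) by blast
  have comp: "component_of ?D \<Gamma>"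
  proof (rule ccontr)
    assume no: "\<not> component_of ?D \<Gamma>"
    \<comment> \<open>If all components \<open>T\<close> of \<open>S \<inter> U\<close> around
      \<open>\<Gamma>\<close> are larger than \<open>\<Gamma>\<close>, take a point
      \<open>q T\<close> of each outside \<open>\<Gamma>\<close> and a \<open>z\<close> vanishing on
      \<open>\<Gamma>\<close> but at none of these points. A component of \<open>z = 0\<close> on
      \<open>S\<close> around \<open>\<Gamma>\<close> is then strictly inside some \<open>T\<close>,
      which is strictly inside \<open>S\<close>, against Krull.\<close>
    define \<T> where "\<T> = {T. component_of ?D T \<and> \<Gamma> \<subseteq> T}"
    have fin: "finite \<T>" using finite_components[OF D] by (simp add: \<T>_def)
    have "\<exists>q. q \<in> T - \<Gamma>" if "T \<in> \<T>" for T
    proof -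
      have "T \<noteq> \<Gamma>" "\<Gamma> \<subseteq> T" using that no by (auto simp: \<T>_def)
      then show ?thesis by blast
    qed
    then obtain q where q: "\<And>T. T \<in> \<T> \<Longrightarrow> q T \<in> T - \<Gamma>" by metis
    have "q ` \<T> \<subseteq> Pt - \<Gamma>" using q closedin_sub component_ofD(1) by (fastforce simp: \<T>_def)
    then obtain z where z: "z \<in> vanishing \<Gamma>" "\<And>T. T \<in> \<T> \<Longrightarrow> z (q T) \<noteq> 0"
      using vanishing_avoiding_points[OF \<Gamma>(1) unc, of "q ` \<T>"] fin by auto
    have zR: "z \<in> R" using z by (simp add: vanishing_def)
    have "\<Gamma> \<subseteq> {x \<in> S. z x = 0}" using z(1) S(3) by (auto simp: vanishing_def)
    then obtain T' where T': "component_of {x \<in> S. z x = 0} T'" "\<Gamma> \<subseteq> T'"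
      using component_exists[OF closedin_Int_zero[OF S(1) zR] \<Gamma>(2)] by blast
    note T'c = component_ofD[OF T'(1)]
    \<comment> \<open>Supplies a point of \<open>S\<close> at which \<open>z\<close> is nonzero, so
      that \<open>T'\<close> is a proper subset of \<open>S\<close>.\<close>
    obtain T0 where T0: "component_of ?D T0" "\<Gamma> \<subseteq> T0" using component_exists[OF D \<Gamma>(2) \<Gamma>D] by blast
    then have "q T0 \<in> S" "z (q T0) \<noteq> 0" using q z(2) component_ofD(3)[OF T0(1)] by (auto simp: \<T>_def)
    then have "T' \<subset> S" using T'c(3) by blast
    then have "T' \<subseteq> ?D" using inU T'c T'(2) by blast
    then obtain T where T: "component_of ?D T" "T' \<subseteq> T" using component_exists[OF D T'c(2)] by blast
    have "T \<in> \<T>" using T T'(2) by (auto simp: \<T>_def)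
    then have "q T \<in> T" "z (q T) \<noteq> 0" using q z(2) by auto
    then have "T' \<subset> T" using T'c(3) T(2) by blast
    moreover have "T \<subset> S" using component_ofD(3)[OF T(1)] S(4) by blast
    ultimately show False
      using hypersurface_codim_one[OF S(1,2) zR T'(1)] component_ofD(1,2)[OF T(1)] by blast
  qed
  \<comment> \<open>Any \<open>y\<close> that vanishes on \<open>U\<close> but not on
    \<open>S\<close> will do: its component around \<open>\<Gamma>\<close> is proper in
    \<open>S\<close>, hence inside \<open>U\<close> by \<open>inU\<close>, hence
    \<open>\<Gamma>\<close> itself by \<open>comp\<close>.\<close>
  obtain x where x: "x \<in> S" "x \<notin> U" using S(4) by blast
  then obtain y where y: "y \<in> vanishing U" "y x \<noteq> 0"
    using closedin_separate[OF U, of x] closedin_sub[OF S(1)] by blast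
  have yR: "y \<in> R" using y by (simp add: vanishing_def)
  let ?Y = "{x \<in> S. y x = 0}"
  have "\<Gamma> \<subseteq> ?Y" using S(3) \<Gamma>(3) y(1) by (auto simp: vanishing_def)
  then obtain T where T: "component_of ?Y T" "\<Gamma> \<subseteq> T"
    using component_exists[OF closedin_Int_zero[OF S(1) yR] \<Gamma>(2)] by blast
  note Tc = component_ofD[OF T(1)]
  have "T \<subset> S" using Tc(3) x y(2) by blast
  then have "T \<subseteq> ?D" using inU Tc T(2) by blast
  then have "T = \<Gamma>" using component_ofD(4)[OF comp Tc(2) T(2)] by blast
  then have "component_of ?Y \<Gamma>" using T by simp
  then obtain t where t: "t \<in> R - vanishing \<Gamma>"
    "\<And>g. g \<in> vanishing \<Gamma> \<Longrightarrow> \<exists>n. (t * g) ^ n \<in> {x + y * r | x r. x \<in> vanishing S \<and> r \<in> R}"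
    using component_radical[OF S(1) yR] by blast
  let ?E = "{x + y * r | x r. x \<in> vanishing S \<and> r \<in> R}"
  have E: "ideal_in R ?E" by (rule ideal_in_add_principal[OF vanishing_ideal yR])
  obtain B where B: "finite B" "B \<subseteq> vanishing \<Gamma>" "vanishing \<Gamma> \<subseteq> ideal_gen R B"
    using noetherian vanishing_ideal[of \<Gamma>] unfolding noetherian_def by blast
  \<comment> \<open>One exponent for all \<open>g\<close>: the \<open>g\<close> used in the tangency
    argument involves a function unknown when the exponents of the hypersurfaces are fixed.\<close>
  have "\<exists>c. \<forall>g\<in>ideal_gen R B. (t * g) ^ c \<in> ?E"
  proof (rule uniform_power[OF E B(1)])
    show "B \<subseteq> R" using B(2) by (auto simp: vanishing_def)
    show "\<exists>n. (t * b) ^ n \<in> ?E" if "b \<in> B" for b using t(2) that B(2) by blast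
    show "t \<in> R" using t by blast
  qed
  then obtain c where c: "\<And>g. g \<in> vanishing \<Gamma> \<Longrightarrow> (t * g) ^ c \<in> ?E" using B(3) by blast
  have rad: "\<exists>e\<in>R. \<forall>x\<in>S. (t x * g x) ^ c = y x * e x" if "g \<in> vanishing \<Gamma>" for g
  proof -
    obtain v r where v: "(t * g) ^ c = v + y * r" "v \<in> vanishing S" "r \<in> R" using c[OF \<open>g \<in> vanishing \<Gamma>\<close>] by blast
    have "(t x * g x) ^ c = y x * r x" if "x \<in> S" for x
      using fun_cong[OF v(1), of x] v(2) that by (simp add: power_fun_apply vanishing_def)
    then show ?thesis using v(3) by blast
  qed
  have "\<Gamma> \<subset> S" using \<open>T \<subset> S\<close> \<open>T = \<Gamma>\<close> by simp
  then show ?thesis using S(1,2) y(1) t(1) rad by blast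
qed

text \<open>On the curve \<open>f\<close> has finitely many zeros. A \<open>v\<close> vanishing at
  those other than \<open>p\<close> makes \<open>v * b\<close> vanish at all of them, and the
  Nullstellensatz gives a power of it as a multiple of \<open>f\<close>. The factor
  \<open>u = v ^ n\<close> is a unit at \<open>p\<close>.\<close>

lemma curve_divides_power:
  assumes \<Gamma>: "curve \<Gamma>" and p: "p \<in> \<Gamma>" and b: "b \<in> R" "b p = 0" and f: "f \<in> R" "f \<notin> vanishing \<Gamma>"
  shows "\<exists>M. \<exists>u\<in>R. \<exists>e\<in>R. u p \<noteq> 0 \<and> (\<forall>x\<in>\<Gamma>. u x * b x ^ M = f x * e x)"
proof -
  have \<Gamma>P: "\<Gamma> \<subseteq> Pt" using closedin_sub[OF irreducible_curveD(1)[OF \<Gamma>]] .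
  define D where "D = \<Gamma> \<inter> {x \<in> Pt. f x = 0} - {p}"
  have "finite (\<Gamma> \<inter> {x \<in> Pt. f x = 0})"
    by (rule curve_Int_finite[OF \<Gamma> closedin_zero[OF f(1)]]) (use f in \<open>auto simp: vanishing_def\<close>)
  then have "finite D" by (simp add: D_def)
  then have "closedin Zar (\<Union>x\<in>D. {x})"
    by (intro closedin_Union) (auto intro!: closedin_point simp: D_def)
  then have D: "closedin Zar D" by simp
  obtain v where v: "v \<in> vanishing D" "v p \<noteq> 0"
    using closedin_separate[OF D, of p] p \<Gamma>P by (auto simp: D_def)
  have vR: "v \<in> R" using v by (simp add: vanishing_def)
  let ?E = "{x + f * r | x r. x \<in> vanishing \<Gamma> \<and> r \<in> R}"
  have "\<exists>n. (v * b) ^ n \<in> ?E"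
  proof (rule zero_locus_closed[OF irreducible_curveD(1)[OF \<Gamma>] _ add_principal_incl])
    show "ideal_in R ?E" by (rule ideal_in_add_principal[OF vanishing_ideal f(1)])
    show "v * b \<in> R" using vR b(1) by (rule mult_closed)
    fix x assume x: "x \<in> \<Gamma>" "\<forall>g\<in>?E. g x = 0"
    have "f x = 0" using x(2) add_principal_mem[OF vanishing_ideal[of \<Gamma>], of f] by blast
    then have "x = p \<or> x \<in> D" using x(1) \<Gamma>P by (auto simp: D_def)
    then show "(v * b) x = 0" using b(2) v(1) by (auto simp: vanishing_def)
  qed
  then obtain n w r where n: "(v * b) ^ n = w + f * r" "w \<in> vanishing \<Gamma>" "r \<in> R" by blast
  have "(v ^ n) x * b x ^ n = f x * r x" if "x \<in> \<Gamma>" for x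
    using fun_cong[OF n(1), of x] n(2) that
    by (simp add: power_fun_apply vanishing_def power_mult_distrib)
  moreover have "(v ^ n) p \<noteq> 0" using v(2) by (simp add: power_fun_apply)
  ultimately show ?thesis using power_closed[OF vR] n(3) by blast
qed

text \<open>On a component \<open>T\<close> of \<open>b ^ N + y = 0\<close> through \<open>p\<close>, which by Krull's theorem is not just a point,
  \<open>f\<close> vanishes and \<open>(t u b ^ M) ^ c\<close> is a multiple of \<open>y = - b ^ N\<close>.\<close>

lemma tangency_bound:
  assumes S: "closedin Zar S" "irreducible_in Zar S" "\<Gamma> \<subset> S" and \<Gamma>: "curve \<Gamma>" and p: "p \<in> \<Gamma>"
    and y: "y \<in> vanishing \<Gamma>" and t: "t \<in> R" "t p \<noteq> 0"
    and rad: "\<And>g. g \<in> vanishing \<Gamma> \<Longrightarrow> \<exists>e\<in>R. \<forall>x\<in>S. (t x * g x) ^ c = y x * e x"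
    and b: "b \<in> R" "b p = 0" "b \<notin> vanishing \<Gamma>" and N: "N > 0"
    and f: "f \<in> R" "\<And>x. x \<in> Pt \<Longrightarrow> b x ^ N + y x = 0 \<Longrightarrow> f x = 0"
    and u: "u \<in> R" "e \<in> R" "u p \<noteq> 0" "\<And>x. x \<in> \<Gamma> \<Longrightarrow> u x * b x ^ M = f x * e x"
  shows "N \<le> c * M"
proof (rule ccontr)
  assume "\<not> N \<le> c * M"
  then have NM: "c * M < N" by simp
  have yR: "y \<in> R" using y by (simp add: vanishing_def)
  define q where "q = b ^ N + y"
  have qR: "q \<in> R" using b yR by (simp add: q_def closed)
  have q: "q x = b x ^ N + y x" for x by (simp add: q_def power_fun_apply)
  have pS: "p \<in> {x \<in> S. q x = 0}" using p S(3) b N y by (auto simp: q vanishing_def)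
  obtain T where T: "component_of {x \<in> S. q x = 0} T" "p \<in> T"
    using component_through_point[OF closedin_Int_zero[OF S(1) qR] pS] .
  note Tc = component_ofD[OF T(1)]
  have TP: "T \<subseteq> Pt" using closedin_sub[OF Tc(1)] .
  have Tp: "T \<noteq> {p}"
  proof
    assume "T = {p}"
    then have "T \<subset> \<Gamma>" using p irreducible_curveD(3)[OF \<Gamma>] by blast
    then show False using hypersurface_codim_one[OF S(1,2) qR T(1) irreducible_curveD(1,2)[OF \<Gamma>]] S(3) by blast
  qed
  \<comment> \<open>Otherwise \<open>y\<close> vanishes on \<open>T\<close> as well because
    \<open>N > 0\<close>, and \<open>rad\<close> with \<open>t p \<noteq> 0\<close> forces
    \<open>T \<subseteq> \<Gamma>\<close>. The inclusion is proper since \<open>b\<close> is not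
    zero on \<open>\<Gamma>\<close>, so \<open>T\<close> would be the point
    \<open>p\<close>.\<close>
  have bT: "\<not> (\<forall>x\<in>T. b x = 0)"
  proof
    assume b0: "\<forall>x\<in>T. b x = 0"
    have y0: "y x = 0" if "x \<in> T" for x
    proof -
      have "q x = 0" using Tc(3) that by blast
      then show ?thesis using b0 that N by (simp add: q zero_power)
    qed
    have "vanishing \<Gamma> \<subseteq> vanishing T"
    proof
      fix g assume g: "g \<in> vanishing \<Gamma>"
      then obtain e' where e': "\<And>x. x \<in> S \<Longrightarrow> (t x * g x) ^ c = y x * e' x" using rad by blast
      have "t x * g x = 0" if "x \<in> T" for x
        using e'[of x] y0[OF that] Tc(3) that power_eq_0_iff by auto
      then have "(\<forall>x\<in>T. t x = 0) \<or> (\<forall>x\<in>T. g x = 0)"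
        using g by (intro irreducible_mult_zero[OF Tc(2) t(1)]) (auto simp: vanishing_def)
      then show "g \<in> vanishing T" using t(2) T(2) g by (auto simp: vanishing_def)
    qed
    then have "T \<subseteq> \<Gamma>" by (rule closedin_vanishing_subset[OF irreducible_curveD(1)[OF \<Gamma>] TP])
    moreover have "T \<noteq> \<Gamma>" using b0 b(1,3) by (auto simp: vanishing_def)
    ultimately obtain p' where "T = {p'}" using irreducible_curve_subsetD[OF \<Gamma> Tc(1,2)] by blast
    then show False using Tp T(2) by simp
  qed
  \<comment> \<open>Zero on \<open>\<Gamma>\<close>, so \<open>rad\<close> applies; on
    \<open>T\<close>, where \<open>f\<close> vanishes, it is \<open>u * b ^ M\<close>.\<close>
  define g where "g = u * b ^ M - f * e"
  have "g \<in> vanishing \<Gamma>"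
    using u b f by (auto simp: vanishing_def g_def power_fun_apply closed)
  then obtain e' where e': "e' \<in> R" "\<And>x. x \<in> S \<Longrightarrow> (t x * g x) ^ c = y x * e' x" using rad by blast
  \<comment> \<open>The relation \<open>(t u b ^ M) ^ c + b ^ N e' = 0\<close> on \<open>T\<close>
    divided by \<open>b ^ (c * M)\<close>, which is legitimate as \<open>T\<close> is irreducible
    and \<open>b\<close> is not zero on it. As \<open>c * M < N\<close>, only the first summand
    survives at \<open>p\<close>, where it is nonzero.\<close>
  define k where "k = (t * u) ^ c + b ^ (N - c * M) * e'"
  have kR: "k \<in> R" unfolding k_def by (intro closed t u b e')
  have "(b ^ (c * M)) x * k x = 0" if x: "x \<in> T" for x
  proof -
    have xS: "x \<in> S" and "q x = 0" using Tc(3) x by auto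
    then have yx: "y x = - (b x ^ N)" by (simp add: q eq_neg_iff_add_eq_0 add.commute)
    have "f x = 0" using f(2)[of x] \<open>q x = 0\<close> TP x by (auto simp: q)
    then have "(t x * (u x * b x ^ M)) ^ c = - (b x ^ N) * e' x"
      using e'(2)[OF xS] by (simp add: g_def power_fun_apply yx)
    moreover have "b x ^ N = b x ^ (c * M) * b x ^ (N - c * M)"
      using NM by (simp add: power_add[symmetric])
    moreover have "(t x * (u x * b x ^ M)) ^ c = b x ^ (c * M) * (t x * u x) ^ c"
      by (simp add: power_mult_distrib power_mult[symmetric] mult.commute[of c M])
    ultimately have eq: "b x ^ (c * M) * (t x * u x) ^ c = - (b x ^ (c * M) * b x ^ (N - c * M)) * e' x"
      by (simp only:)
    have "(b ^ (c * M)) x * k x =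
        b x ^ (c * M) * (t x * u x) ^ c + (b x ^ (c * M) * b x ^ (N - c * M)) * e' x"
      by (simp add: k_def power_fun_apply distrib_left mult.assoc)
    also have "\<dots> = 0" unfolding eq by simp
    finally show ?thesis .
  qed
  then have "(\<forall>x\<in>T. (b ^ (c * M)) x = 0) \<or> (\<forall>x\<in>T. k x = 0)"
    by (intro irreducible_mult_zero[OF Tc(2) power_closed[OF b(1)] kR])
  moreover have "k p \<noteq> 0"
    using t(2) u(3) b(2) NM by (simp add: k_def power_fun_apply zero_power)
  moreover obtain x where x: "x \<in> T" "b x \<noteq> 0" using bT by blast
  moreover have "(b ^ (c * M)) x \<noteq> 0" using x(2) by (simp add: power_fun_apply)
  ultimately show False using T(2) by blast
qed

end

section \<open>Dimension and local rings\<close>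

lemma irreducible_in_subtopology:
  assumes C: "closedin T C" and S: "S \<subseteq> C"
  shows "irreducible_in (subtopology T C) S \<longleftrightarrow> irreducible_in T S"
proof -
  have CT: "C \<subseteq> topspace T" using C by (rule closedin_subset)
  have sub: "closedin (subtopology T C) A \<longleftrightarrow> closedin T A \<and> A \<subseteq> C" for A
    using C by (rule closedin_closed_subtopology)
  have top: "S \<subseteq> topspace (subtopology T C) \<longleftrightarrow> S \<subseteq> topspace T"
    using S CT by auto
  show ?thesis
  proof
    assume L: "irreducible_in (subtopology T C) S"
    show "irreducible_in T S"
      unfolding irreducible_in_def
    proof (intro conjI allI impI)
      show "S \<subseteq> topspace T" "S \<noteq> {}" using L top by (auto simp: irreducible_in_def)
      fix A B assume AB: "closedin T A" "closedin T B" "S \<subseteq> A \<union> B"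
      have "S \<subseteq> A \<inter> C \<or> S \<subseteq> B \<inter> C"
        by (rule irreducible_in_Un[OF L]) (use AB S C in \<open>auto simp: sub intro: closedin_Int\<close>)
      then show "S \<subseteq> A \<or> S \<subseteq> B" by blast
    qed
  next
    assume "irreducible_in T S"
    then show "irreducible_in (subtopology T C) S"
      using top sub unfolding irreducible_in_def by metis
  qed
qed

definition chain_in :: "'p topology \<Rightarrow> 'p set \<Rightarrow> nat \<Rightarrow> (nat \<Rightarrow> 'p set) \<Rightarrow> bool" where
  "chain_in T C n Z \<longleftrightarrow>
     (\<forall>i\<le>n. closedin T (Z i) \<and> irreducible_in T (Z i) \<and> Z i \<subseteq> C) \<and> (\<forall>i<n. Z i \<subset> Z (Suc i))"

lemma krull_dim_subtopology:
  assumes C: "closedin T C"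
  shows "krull_dim (subtopology T C) = Sup {enat n | n. \<exists>Z. chain_in T C n Z}"
proof -
  have "((\<forall>i\<le>n. closedin (subtopology T C) (Z i) \<and> irreducible_in (subtopology T C) (Z i)) \<and>
      (\<forall>i<n. Z i \<subset> Z (Suc i))) \<longleftrightarrow> chain_in T C n Z" for n Z
    unfolding chain_in_def using irreducible_in_subtopology[OF C] closedin_closed_subtopology[OF C]
    by metis
  then show ?thesis unfolding krull_dim_def by simp
qed

lemma chain_in_krull_dim:
  assumes "closedin T C" "chain_in T C n Z"
  shows "enat n \<le> krull_dim (subtopology T C)"
  unfolding krull_dim_subtopology[OF assms(1)] using assms(2) by (intro Sup_upper) blast

lemma krull_dim_le:
  assumes "closedin T C" "\<And>n Z. chain_in T C n Z \<Longrightarrow> enat n \<le> d"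
  shows "krull_dim (subtopology T C) \<le> d"
  unfolding krull_dim_subtopology[OF assms(1)] using assms(2) by (intro Sup_least) blast

context affine_functions
begin

section \<open>Bounding dimension by counting monomials\<close>

lemma span_F_mono: "D \<le> D' \<Longrightarrow> f \<in> fun_vs.span (F D) \<Longrightarrow> f \<in> fun_vs.span (F D')"
  using fun_vs.span_mono[OF F_mono] by blast

lemma span_F_mult: "f \<in> fun_vs.span (F D) \<Longrightarrow> g \<in> fun_vs.span (F D') \<Longrightarrow> f * g \<in> fun_vs.span (F (D + D'))"
  by (rule span_mult[OF _ _ F_mult])

lemma span_F_power:
  assumes "f \<in> fun_vs.span (F D)"
  shows "f ^ j \<in> fun_vs.span (F (j * D))"
proof (induction j)
  case 0
  show ?case unfolding power_0 mult_0 by (rule fun_vs.span_base[OF F_one])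
next
  case (Suc j)
  show ?case unfolding power_Suc mult_Suc by (rule span_F_mult[OF assms Suc])
qed

lemma span_F_prod:
  "(\<And>i. i < (n::nat) \<Longrightarrow> f i \<in> fun_vs.span (F (d i))) \<Longrightarrow> (\<Prod>i<n. f i) \<in> fun_vs.span (F (\<Sum>i<n. d i))"
proof (induction n)
  case 0
  show ?case using fun_vs.span_base[OF F_one] by (simp only: lessThan_0 prod.empty sum.empty)
next
  case (Suc n)
  then have "(\<Prod>i<n. f i) * f n \<in> fun_vs.span (F ((\<Sum>i<n. d i) + d n))"
    by (intro span_F_mult) auto
  then show ?case by (simp only: prod.lessThan_Suc sum.lessThan_Suc)
qed

text \<open>On \<open>Z\<close>, where \<open>f\<close> vanishes, only the lowest coefficient
  survives; so it is zero there and by assumption on all of \<open>Z'\<close>. A factor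
  \<open>f\<close> can then be cancelled because \<open>Z'\<close> is irreducible.\<close>

lemma power_combination_zero:
  assumes Z': "irreducible_in Zar Z'" and sub: "Z \<subseteq> Z'"
    and f: "f \<in> R" "\<And>x. x \<in> Z \<Longrightarrow> f x = 0" "x0 \<in> Z'" "f x0 \<noteq> 0"
    and a: "\<And>j. a j \<in> R" "\<And>j. (\<forall>x\<in>Z. a j x = 0) \<Longrightarrow> (\<forall>x\<in>Z'. a j x = 0)"
    and zero: "\<And>x. x \<in> Z' \<Longrightarrow> (\<Sum>j\<le>J. a j x * f x ^ j) = 0"
    and j: "j \<le> J" "x \<in> Z"
  shows "a j x = 0"
  using a zero j
proof (induction J arbitrary: a j x)
  case 0
  then show ?case using sub by force
next
  case (Suc J)
  have a0: "a 0 y = 0" if "y \<in> Z" for y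
  proof -
    have "(\<Sum>j\<le>Suc J. a j y * f y ^ j) = a 0 y"
      using f(2)[OF that] by (subst sum.atMost_Suc_shift) simp
    then show ?thesis using Suc.prems(3)[of y] sub that by auto
  qed
  then have a0': "a 0 y = 0" if "y \<in> Z'" for y using Suc.prems(2)[of 0] that by blast
  let ?h = "\<Sum>j\<le>J. a (Suc j) * f ^ j"
  have hR: "?h \<in> R" using Suc.prems(1) f(1) by (intro sum_closed closed) auto
  have "f y * ?h y = 0" if "y \<in> Z'" for y
  proof -
    have "f y * ?h y = (\<Sum>j\<le>Suc J. a j y * f y ^ j)"
      using a0'[OF that]
      by (subst sum.atMost_Suc_shift) (simp add: fun_apply sum_distrib_left mult_ac)
    then show ?thesis using Suc.prems(3)[OF that] by simp
  qed
  then have "(\<forall>y\<in>Z'. f y = 0) \<or> (\<forall>y\<in>Z'. ?h y = 0)" by (rule irreducible_mult_zero[OF Z' f(1) hR])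
  then have h0: "?h y = 0" if "y \<in> Z'" for y using f that by blast
  have IH: "a (Suc i) y = 0" if "i \<le> J" "y \<in> Z" for i y
    by (rule Suc.IH[of "\<lambda>j. a (Suc j)"])
      (use Suc.prems(1,2) h0 that in \<open>auto simp: fun_apply\<close>)
  show ?case
  proof (cases j)
    case 0
    then show ?thesis using a0 Suc.prems(5) by simp
  next
    case (Suc i)
    then show ?thesis using IH Suc.prems by simp
  qed
qed

text \<open>Induction along the chain: a relation on \<open>Z (Suc k)\<close> is a polynomial in
  \<open>f k\<close> whose coefficients are combinations of earlier monomials. By induction such a
  coefficient vanishes on \<open>Z k\<close> only if it is the trivial combination, which is the
  assumption that \<open>power_combination_zero\<close> makes on coefficients.\<close>

lemma chain_monomials_independent:
  assumes Z: "\<And>i. i \<le> n \<Longrightarrow> irreducible_in Zar (Z i)" "\<And>i. i < n \<Longrightarrow> Z i \<subseteq> Z (Suc i)"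
    and f: "\<And>i. i < n \<Longrightarrow> f i \<in> R" "\<And>i x. i < n \<Longrightarrow> x \<in> Z i \<Longrightarrow> f i x = 0"
      "\<And>i. i < n \<Longrightarrow> \<exists>x\<in>Z (Suc i). f i x \<noteq> 0"
    and k: "k \<le> n"
    and zero: "\<And>x. x \<in> Z k \<Longrightarrow> (\<Sum>l\<in>PiE {..<k} (\<lambda>_. {..J}). c l * (\<Prod>i<k. f i x ^ l i)) = 0"
    and l: "l \<in> PiE {..<k} (\<lambda>_. {..J})"
  shows "c l = 0"
  using k zero l
proof (induction k arbitrary: c l)
  case 0
  obtain x where "x \<in> Z 0" using Z(1)[of 0] by (auto simp: irreducible_in_def)
  then show ?case using 0 by auto
next
  case (Suc k)
  let ?P = "PiE {..<k} (\<lambda>_. {..J})"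
  let ?mon = "\<lambda>g x. \<Prod>i<k. f i x ^ g i"
  define a where "a j = (\<lambda>x. \<Sum>g\<in>?P. c (g(k := j)) * ?mon g x)" for j
  have finP: "finite ?P" by (simp add: finite_PiE)
  have mono: "Z k \<subseteq> Z (Suc k)" using Z(2) Suc.prems(1) by auto
  \<comment> \<open>Sorts the monomials by the exponent \<open>j\<close> of the last function
    \<open>f k\<close>.\<close>
  have split: "(\<Sum>l\<in>PiE {..<Suc k} (\<lambda>_. {..J}). c l * (\<Prod>i<Suc k. f i x ^ l i)) =
      (\<Sum>j\<le>J. a j x * f k x ^ j)" for x
  proof -
    have inj: "inj_on (\<lambda>(y, g). g(k := y)) ({..J} \<times> ?P)"
      by (rule inj_combinator) simp
    have "PiE {..<Suc k} (\<lambda>_. {..J}) = (\<lambda>(y, g). g(k := y)) ` ({..J} \<times> ?P)"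
      unfolding lessThan_Suc by (rule PiE_insert_eq)
    from sum.reindex[OF inj, of "\<lambda>l. c l * (\<Prod>i<Suc k. f i x ^ l i)", folded this]
    have "(\<Sum>l\<in>PiE {..<Suc k} (\<lambda>_. {..J}). c l * (\<Prod>i<Suc k. f i x ^ l i)) =
        (\<Sum>(j, g)\<in>{..J} \<times> ?P. c (g(k := j)) * (\<Prod>i<Suc k. f i x ^ (g(k := j)) i))"
      by (simp only: o_def case_prod_unfold)
    also have "\<dots> = (\<Sum>j\<le>J. \<Sum>g\<in>?P. c (g(k := j)) * (\<Prod>i<Suc k. f i x ^ (g(k := j)) i))"
      by (simp add: sum.cartesian_product)
    also have "\<dots> = (\<Sum>j\<le>J. a j x * f k x ^ j)"
    proof (rule sum.cong[OF refl])
      fix j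
      have "(\<Prod>i<Suc k. f i x ^ (g(k := j)) i) = ?mon g x * f k x ^ j" for g
        by simp
      then show "(\<Sum>g\<in>?P. c (g(k := j)) * (\<Prod>i<Suc k. f i x ^ (g(k := j)) i)) = a j x * f k x ^ j"
        by (simp only: a_def sum_distrib_right mult.assoc)
    qed
    finally show ?thesis .
  qed
  have aR: "a j \<in> R" for j
  proof -
    have "a j = (\<Sum>g\<in>?P. (\<lambda>_. c (g(k := j))) * (\<Prod>i<k. f i ^ g i))"
      by (auto simp: a_def fun_apply)
    also have "\<dots> \<in> R"
      using f(1) Suc.prems(1) by (intro sum_closed mult_closed const_closed prod_closed power_closed) auto
    finally show ?thesis .
  qed
  have coeff: "c (g(k := j)) = 0" if "\<forall>x\<in>Z k. a j x = 0" "g \<in> ?P" for j g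
    by (rule Suc.IH[of "\<lambda>g. c (g(k := j))"]) (use that Suc.prems(1) in \<open>auto simp: a_def\<close>)
  obtain x0 where x0: "x0 \<in> Z (Suc k)" "f k x0 \<noteq> 0" using f(3)[of k] Suc.prems(1) by auto
  have "a j x = 0" if "j \<le> J" "x \<in> Z k" for j x
  proof (rule power_combination_zero[OF Z(1)[of "Suc k"] mono f(1)[of k] _ x0 aR])
    show "\<forall>x\<in>Z (Suc k). a j x = 0" if "\<forall>x\<in>Z k. a j x = 0" for j
    proof -
      have "a j x = 0" for x unfolding a_def using coeff[OF that] by (intro sum.neutral) auto
      then show ?thesis by blast
    qed
    show "(\<Sum>j\<le>J. a j x * f k x ^ j) = 0" if "x \<in> Z (Suc k)" for x
      using Suc.prems(2)[OF that] unfolding split .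
    show "f k x = 0" if "x \<in> Z k" for x using f(2)[of k x] Suc.prems(1) that by auto
  qed (use Suc.prems(1) that in auto)
  then have all: "c (g(k := j)) = 0" if "j \<le> J" "g \<in> ?P" for j g using coeff that by blast
  have "l \<in> (\<lambda>(y, g). g(k := y)) ` ({..J} \<times> ?P)"
    using Suc.prems(3) unfolding lessThan_Suc PiE_insert_eq .
  then show ?case using all by auto
qed

text \<open>Functions \<open>f i\<close> that vanish on \<open>Z i\<close> but not on \<open>Z (Suc i)\<close> are algebraically independent, so
  there are \<open>(J + 1) ^ n\<close> independent monomials in them, while their degree grows linearly in \<open>J\<close>.\<close>

lemma chain_length_bound:
  assumes "chain_in Zar C n Z"
  shows "n \<le> m"
proof (rule ccontr)
  assume "\<not> n \<le> m"
  then have nm: "Suc m \<le> n" by simp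
  have Z: "\<And>i. i \<le> n \<Longrightarrow> closedin Zar (Z i) \<and> irreducible_in Zar (Z i)"
    "\<And>i. i < n \<Longrightarrow> Z i \<subset> Z (Suc i)"
    using assms by (auto simp: chain_in_def)
  have "\<exists>f. f \<in> vanishing (Z i) \<and> (\<exists>x\<in>Z (Suc i). f x \<noteq> 0)" if i: "i < n" for i
  proof -
    obtain x where "x \<in> Z (Suc i)" "x \<notin> Z i" using Z(2)[OF i] by blast
    moreover have "Z (Suc i) \<subseteq> Pt" using closedin_sub Z(1)[of "Suc i"] i by auto
    ultimately show ?thesis using closedin_separate[of "Z i" x] Z(1)[of i] i by auto
  qed
  then obtain f where f: "\<And>i. i < n \<Longrightarrow> f i \<in> vanishing (Z i)"
    "\<And>i. i < n \<Longrightarrow> \<exists>x\<in>Z (Suc i). f i x \<noteq> 0" by metis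
  have fR: "f i \<in> R" if "i < n" for i using f(1)[OF that] by (simp add: vanishing_def)
  have "\<exists>d. f i \<in> fun_vs.span (F d)" if "i < n" for i using F_span[OF fR[OF that]] .
  then obtain d where d: "\<And>i. i < n \<Longrightarrow> f i \<in> fun_vs.span (F (d i))" by metis
  define e where "e = (\<Sum>i<n. d i)"
  have bound: "(J + 1) ^ n \<le> (J * e + 1) ^ m" for J
  proof (rule ccontr)
    assume "\<not> (J + 1) ^ n \<le> (J * e + 1) ^ m"
    moreover have "card (PiE {..<n} (\<lambda>_. {..J})) = (J + 1) ^ n" by (simp add: card_PiE)
    ultimately have card: "card (F (J * e)) < card (PiE {..<n} (\<lambda>_. {..J}))"
      using card_F[of "J * e"] by linarith
    have span: "(\<Prod>i<n. f i ^ l i) \<in> fun_vs.span (F (J * e))" if l: "l \<in> PiE {..<n} (\<lambda>_. {..J})" for l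
    proof -
      have "(\<Prod>i<n. f i ^ l i) \<in> fun_vs.span (F (\<Sum>i<n. l i * d i))"
        by (intro span_F_prod span_F_power d)
      moreover have "(\<Sum>i<n. l i * d i) \<le> J * e"
        unfolding e_def sum_distrib_left by (intro sum_mono mult_right_mono) (use l in auto)
      ultimately show ?thesis using span_F_mono by blast
    qed
    have "\<exists>c. (\<exists>l\<in>PiE {..<n} (\<lambda>_. {..J}). c l \<noteq> 0) \<and>
        (\<forall>x. (\<Sum>l\<in>PiE {..<n} (\<lambda>_. {..J}). c l * (\<Prod>i<n. f i ^ l i) x) = 0)"
      by (rule family_dependent[OF _ finite_F card]) (use span in \<open>auto simp: finite_PiE\<close>)
    then obtain c l where c: "l \<in> PiE {..<n} (\<lambda>_. {..J})" "c l \<noteq> 0"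
      "\<And>x. (\<Sum>l\<in>PiE {..<n} (\<lambda>_. {..J}). c l * (\<Prod>i<n. f i x ^ l i)) = 0"
      by (auto simp: fun_apply)
    have "c l = 0"
    proof (rule chain_monomials_independent[where n = n and Z = Z and f = f and k = n and J = J and c = c])
      show "f i x = 0" if "i < n" "x \<in> Z i" for i x using f(1)[OF that(1)] that(2) by (simp add: vanishing_def)
    qed (use Z fR f(2) c in auto)
    then show False using c(2) by simp
  qed
  \<comment> \<open>Makes \<open>((e + 1) * (J + 1)) ^ m\<close> equal to
    \<open>J * (J + 1) ^ m\<close>, which is less than \<open>(J + 1) ^ Suc m\<close>.\<close>
  define J where "J = (e + 1) ^ m"
  have "(J + 1) ^ Suc m \<le> (J + 1) ^ n" using nm by (intro power_increasing) auto
  also have "\<dots> \<le> (J * e + 1) ^ m" by (rule bound)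
  also have "\<dots> \<le> ((e + 1) * (J + 1)) ^ m" by (intro power_mono) (auto simp: algebra_simps)
  also have "((e + 1) * (J + 1)) ^ m = J * (J + 1) ^ m" by (simp only: J_def power_mult_distrib)
  finally show False by simp
qed

lemma krull_dim_bound:
  assumes "closedin Zar C"
  shows "krull_dim (subtopology Zar C) \<le> enat m"
  using krull_dim_le[OF assms] chain_length_bound by simp

text \<open>Take \<open>f\<close> zero on \<open>C\<close> but not on \<open>C'\<close>, and
  \<open>g\<close> zero on every other component but not on \<open>C\<close>. The product is zero on
  \<open>V\<close>, so one factor is zero in the local ring, killed by some \<open>u\<close> with
  \<open>u x \<noteq> 0\<close>. Irreducibility of \<open>C'\<close> or \<open>C\<close> then forces
  \<open>u\<close> to vanish at \<open>x\<close>.\<close>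

lemma domain_unique_component:
  assumes dom: "domain (local_ring V x)" and x: "x \<in> Pt"
    and C: "component_of Pt C" "x \<in> C" and C': "component_of Pt C'" "x \<in> C'"
  shows "C = C'"
proof (rule ccontr)
  assume ne: "C \<noteq> C'"
  have PtC: "closedin Zar Pt" using topspace_Zar by (metis closedin_topspace)
  note Cc = component_ofD[OF C(1)] and C'c = component_ofD[OF C'(1)]
  define D where "D = \<Union>({T. component_of Pt T} - {C})"
  have D: "closedin Zar D"
    unfolding D_def using finite_components[OF PtC] component_ofD(1) by (intro closedin_Union) auto
  have nCD: "\<not> C \<subseteq> D"
  proof
    assume "C \<subseteq> D"
    then obtain T where T: "T \<in> {T. component_of Pt T} - {C}" "C \<subseteq> T"
      using irreducible_finite_union[OF Cc(2), of "{T. component_of Pt T} - {C}"]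
        finite_components[OF PtC] component_ofD(1) unfolding D_def by blast
    then show False using Cc(4)[of T] component_ofD(2,3)[of Pt T] by auto
  qed
  have nC'C: "\<not> C' \<subseteq> C" using C'c(4)[OF Cc(2) _ Cc(3)] ne by blast
  obtain y where y: "y \<in> C'" "y \<notin> C" using nC'C by blast
  then obtain f where f: "f \<in> vanishing C" "f y \<noteq> 0"
    using closedin_separate[OF Cc(1), of y] C'c(3) by blast
  obtain z where z: "z \<in> C" "z \<notin> D" using nCD by blast
  then obtain g where g: "g \<in> vanishing D" "g z \<noteq> 0"
    using closedin_separate[OF D, of z] Cc(3) by blast
  have fR: "f \<in> R" and gR: "g \<in> R" using f g by (auto simp: vanishing_def)
  have fg: "f v * g v = 0" if v: "v \<in> Pt" for v
  proof -
    obtain T where T: "component_of Pt T" "v \<in> T" using component_through_point[OF PtC v] .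
    show ?thesis
    proof (cases "T = C")
      case True
      then show ?thesis using f(1) T(2) by (simp add: vanishing_def)
    next
      case False
      then have "v \<in> D" using T unfolding D_def by blast
      then show ?thesis using g(1) by (simp add: vanishing_def)
    qed
  qed
  let ?A = "coordinate_ring V"
  let ?S = "{f \<in> regular V. f x \<noteq> 0}"
  let ?r = "\<lambda>f. restrict f Pt"
  interpret M: mult_set ?A ?S by (rule mult_set_local_ring[OF fun_algebra x])
  interpret L: domain "localization ?A ?S" using dom by (simp add: local_ring_def)
  have cA: "carrier ?A = regular V" by (simp add: coordinate_ring_def)
  have r: "?r h \<in> carrier ?A" if "h \<in> R" for h using that by (auto simp: cA regular)
  have one: "\<one>\<^bsub>?A\<^esub> \<in> ?S" by (rule M.one_S)
  \<comment> \<open>Spells out that the fraction \<open>h / 1\<close> is zero in the local ring,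
    with the annihilator lifted to a total function.\<close>
  have frac0: "\<exists>u\<in>R. u x \<noteq> 0 \<and> (\<forall>v\<in>Pt. u v * h v = 0)"
    if h: "h \<in> R" and eq: "loc_frac ?A ?S (?r h) \<one>\<^bsub>?A\<^esub> = \<zero>\<^bsub>localization ?A ?S\<^esub>" for h
  proof -
    have "loc_frac ?A ?S (?r h) \<one>\<^bsub>?A\<^esub> = loc_frac ?A ?S \<zero>\<^bsub>?A\<^esub> \<one>\<^bsub>?A\<^esub>"
      using eq by (simp add: localization_def)
    then obtain u where u: "u \<in> ?S"
      "u \<otimes>\<^bsub>?A\<^esub> (\<one>\<^bsub>?A\<^esub> \<otimes>\<^bsub>?A\<^esub> ?r h \<ominus>\<^bsub>?A\<^esub> \<one>\<^bsub>?A\<^esub> \<otimes>\<^bsub>?A\<^esub> \<zero>\<^bsub>?A\<^esub>) = \<zero>\<^bsub>?A\<^esub>"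
      using M.loc_frac_eq_iff[OF r[OF h] one M.zero_closed one] by blast
    have "u \<otimes>\<^bsub>?A\<^esub> ?r h = \<zero>\<^bsub>?A\<^esub>"
      using u(2) r[OF h] by (simp add: M.minus_eq)
    then have *: "restrict (\<lambda>v. u v * ?r h v) Pt = restrict (\<lambda>_. 0) Pt"
      by (simp add: coordinate_ring_def)
    have "u v * h v = 0" if "v \<in> Pt" for v using fun_cong[OF *, of v] that by simp
    moreover obtain u' where "u' \<in> R" "u = ?r u'" using u(1) by (auto simp: regular)
    ultimately show ?thesis using u(1) x by (intro bexI[of _ u']) auto
  qed
  have "?r f \<otimes>\<^bsub>?A\<^esub> ?r g = \<zero>\<^bsub>?A\<^esub>"
    using fg by (auto simp: coordinate_ring_def restrict_def)
  then have "loc_frac ?A ?S (?r f) \<one>\<^bsub>?A\<^esub> \<otimes>\<^bsub>localization ?A ?S\<^esub> loc_frac ?A ?S (?r g) \<one>\<^bsub>?A\<^esub> =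
      \<zero>\<^bsub>localization ?A ?S\<^esub>"
    using M.mult_localization[OF r[OF fR] one r[OF gR] one] by (simp add: localization_def)
  moreover have "loc_frac ?A ?S (?r h) \<one>\<^bsub>?A\<^esub> \<in> carrier (localization ?A ?S)" if "h \<in> R" for h
    using r[OF that] one by (auto simp: M.carrier_localization)
  ultimately consider "loc_frac ?A ?S (?r f) \<one>\<^bsub>?A\<^esub> = \<zero>\<^bsub>localization ?A ?S\<^esub>"
    | "loc_frac ?A ?S (?r g) \<one>\<^bsub>?A\<^esub> = \<zero>\<^bsub>localization ?A ?S\<^esub>"
    using L.integral fR gR by blast
  then show False
  proof cases
    case 1
    then obtain u where u: "u \<in> R" "u x \<noteq> 0" "\<And>v. v \<in> Pt \<Longrightarrow> u v * f v = 0" using frac0[OF fR] by blast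
    then have "(\<forall>v\<in>C'. u v = 0) \<or> (\<forall>v\<in>C'. f v = 0)"
      using C'c(3) by (intro irreducible_mult_zero[OF C'c(2) u(1) fR]) auto
    then show False using u(2) C'(2) f(2) y(1) by blast
  next
    case 2
    then obtain u where u: "u \<in> R" "u x \<noteq> 0" "\<And>v. v \<in> Pt \<Longrightarrow> u v * g v = 0" using frac0[OF gR] by blast
    then have "(\<forall>v\<in>C. u v = 0) \<or> (\<forall>v\<in>C. g v = 0)"
      using Cc(3) by (intro irreducible_mult_zero[OF Cc(2) u(1) gR]) auto
    then show False using u(2) C(2) g(2) z(1) by blast
  qed
qed

text \<open>The sum of the two vanishing ideals has no zero on \<open>A\<close>, so it contains
  \<open>1\<close> by the Nullstellensatz; the summand from \<open>vanishing B\<close> is the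
  required function.\<close>

lemma disjoint_closed_idempotent:
  assumes A: "closedin Zar A" and B: "closedin Zar B" and "A \<inter> B = {}"
  shows "\<exists>e\<in>R. (\<forall>x\<in>A. e x = 1) \<and> (\<forall>x\<in>B. e x = 0)"
proof -
  let ?E = "{f + g | f g. f \<in> vanishing A \<and> g \<in> vanishing B}"
  have E: "ideal_in R ?E"
    unfolding ideal_in_def
  proof (intro conjI ballI)
    show "?E \<subseteq> R" by (auto simp: vanishing_def closed)
    have "(0 :: 'p \<Rightarrow> 'k) = 0 + 0 \<and> 0 \<in> vanishing A \<and> 0 \<in> vanishing B"
      using ideal_inD(2)[OF vanishing_ideal] by simp
    then show "0 \<in> ?E" by blast
  next
    fix a b assume "a \<in> ?E" "b \<in> ?E"
    then obtain f g f' g' where "a = f + g" "b = f' + g'" "f \<in> vanishing A" "f' \<in> vanishing A"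
      "g \<in> vanishing B" "g' \<in> vanishing B" by blast
    then have "a + b = (f + f') + (g + g')" "f + f' \<in> vanishing A" "g + g' \<in> vanishing B"
      using ideal_inD(3)[OF vanishing_ideal] by (auto simp: algebra_simps)
    then show "a + b \<in> ?E" by blast
  next
    fix r a assume r: "r \<in> R" and "a \<in> ?E"
    then obtain f g where "a = f + g" "f \<in> vanishing A" "g \<in> vanishing B" by blast
    then have "r * a = r * f + r * g" "r * f \<in> vanishing A" "r * g \<in> vanishing B"
      using ideal_inD(4)[OF vanishing_ideal r] by (simp_all only: distrib_left)
    then show "r * a \<in> ?E" by blast
  qed
  have subA: "vanishing A \<subseteq> ?E"
  proof
    fix f assume "f \<in> vanishing A"
    then have "f = f + 0 \<and> f \<in> vanishing A \<and> 0 \<in> vanishing B"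
      using ideal_inD(2)[OF vanishing_ideal] by simp
    then show "f \<in> ?E" by blast
  qed
  have subB: "vanishing B \<subseteq> ?E"
  proof
    fix f assume "f \<in> vanishing B"
    then have "f = 0 + f \<and> 0 \<in> vanishing A \<and> f \<in> vanishing B"
      using ideal_inD(2)[OF vanishing_ideal] by simp
    then show "f \<in> ?E" by blast
  qed
  have "\<exists>n. 1 ^ n \<in> ?E"
  proof (rule zero_locus_closed[OF A E subA one_closed])
    fix x assume x: "x \<in> A" "\<forall>f\<in>?E. f x = 0"
    have "x \<in> B" using closedin_separate[OF B, of x] subB x closedin_sub[OF A] by blast
    then show "(1 :: 'p \<Rightarrow> 'k) x = 0" using x(1) assms(3) by blast
  qed
  then obtain f g where fg: "1 = f + g" "f \<in> vanishing A" "g \<in> vanishing B" by auto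
  have "f x + g x = 1" for x using fun_cong[OF fg(1), of x] by simp
  then have "g x = 1" if "x \<in> A" for x using fg(2) that by (metis (mono_tags, lifting) add_0 mem_Collect_eq vanishing_def)
  then show ?thesis using fg(3) by (intro bexI[of _ g]) (auto simp: vanishing_def)
qed

end

section \<open>Affine ind-varieties\<close>

lemma topology_eq_closedin:
  assumes "topspace S = topspace T" "\<And>C. closedin S C \<longleftrightarrow> closedin T C"
  shows "S = T"
  unfolding topology_eq using assms openin_closedin_eq by metis

lemma zeros_restrict:
  assumes "points V \<subseteq> points W"
  shows "zeros V ((\<lambda>f. restrict f (points V)) ` E) = zeros W E \<inter> points V"
  using assms by (auto simp: zeros_def)

lemma zariski_subtopology:
  fixes V W :: "('p, 'k::field) fun_space"
  assumes V: "fun_algebra V" and W: "fun_algebra W" and sub: "points V \<subseteq> points W"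
    and reg: "regular V = (\<lambda>f. restrict f (points V)) ` regular W"
  shows "zariski_topology V = subtopology (zariski_topology W) (points V)"
proof (rule topology_eq_closedin)
  show "topspace (zariski_topology V) = topspace (subtopology (zariski_topology W) (points V))"
    using sub by (auto simp: topspace_zariski_topology[OF V] topspace_zariski_topology[OF W])
  fix C
  have "closedin (zariski_topology V) C \<longleftrightarrow>
      (\<exists>E\<subseteq>regular W. C = zeros V ((\<lambda>f. restrict f (points V)) ` E))"
    unfolding closedin_zariski_topology[OF V] reg by (auto simp: subset_image_iff)
  also have "\<dots> \<longleftrightarrow> (\<exists>D. closedin (zariski_topology W) D \<and> C = D \<inter> points V)"
    unfolding closedin_zariski_topology[OF W] zeros_restrict[OF sub] by blast
  finally show "closedin (zariski_topology V) C \<longleftrightarrow>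
      closedin (subtopology (zariski_topology W) (points V)) C"
    by (simp add: closedin_subtopology)
qed

lemma irreducible_curve_subtopology:
  assumes C: "closedin T C" and S: "irreducible_curve (subtopology T C) \<Gamma>"
  shows "irreducible_curve T \<Gamma>"
proof -
  note \<Gamma> = irreducible_curveD[OF S]
  have \<Gamma>C: "closedin T \<Gamma>" "\<Gamma> \<subseteq> C"
    using \<Gamma>(1) closedin_closed_subtopology[OF C] by auto
  have "\<exists>p. U = {p}" if U: "closedin T U" "irreducible_in T U" "U \<subset> \<Gamma>" for U
  proof (rule irreducible_curve_subsetD[OF S _ _ U(3)])
    have "U \<subseteq> C" using U(3) \<Gamma>C(2) by blast
    then show "closedin (subtopology T C) U" "irreducible_in (subtopology T C) U"
      using U irreducible_in_subtopology[OF C] closedin_closed_subtopology[OF C] by auto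
  qed
  moreover have "irreducible_in T \<Gamma>" using \<Gamma>(2) irreducible_in_subtopology[OF C \<Gamma>C(2)] by simp
  ultimately show ?thesis using \<Gamma>(3) \<Gamma>C(1) by (simp add: irreducible_curve_def)
qed

locale normal_ind_variety =
  fixes X :: "nat \<Rightarrow> ('p, 'k::alg_closed_field) fun_space"
  assumes uncountable_field: "uncountable (UNIV :: 'k set)"
    and ind_variety: "affine_ind_variety X"
    and normal_infinite: "infinite {n. normal_variety (X n)}"
begin

abbreviation "Pt n \<equiv> points (X n)"
abbreviation "Zar n \<equiv> zariski_topology (X n)"

section \<open>Passing between the levels of the filtration\<close>

lemma affine_variety: "affine_variety (X n)"
  using ind_variety by (simp add: affine_ind_variety_def)

lemma fun_algebra: "fun_algebra (X n)"
  by (rule fun_algebra_affine_variety[OF affine_variety])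

lemma topspace_Zar: "topspace (Zar n) = Pt n"
  by (rule topspace_zariski_topology[OF fun_algebra])

lemmas points_mono = points_mono_affine_ind_variety[OF ind_variety]

lemma embedding:
  "closedin (Zar (Suc n)) (Pt n)" "regular (X n) = (\<lambda>f. restrict f (Pt n)) ` regular (X (Suc n))"
proof -
  have "closed_embedding (X n) (X (Suc n))" using ind_variety unfolding affine_ind_variety_def by blast
  then show "closedin (Zar (Suc n)) (Pt n)"
    "regular (X n) = (\<lambda>f. restrict f (Pt n)) ` regular (X (Suc n))"
    unfolding closed_embedding_def by blast+
qed

lemma regular_restrict:
  assumes "m \<le> n"
  shows "regular (X m) = (\<lambda>f. restrict f (Pt m)) ` regular (X n)"
  using assms
proof (induction n rule: dec_induct)
  case base
  have "restrict f (Pt m) = f" if "f \<in> regular (X m)" for f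
    using fun_algebra[of m] that by (auto simp: fun_algebra_def extensional_restrict)
  then show ?case by simp
next
  case (step n)
  have "regular (X m) = (\<lambda>f. restrict f (Pt m)) ` (\<lambda>f. restrict f (Pt n)) ` regular (X (Suc n))"
    unfolding step(3) embedding(2)[of n, symmetric] ..
  moreover have "Pt n \<inter> Pt m = Pt m" using points_mono[OF step(1)] by blast
  then have "(\<lambda>f. restrict f (Pt m)) ` (\<lambda>f. restrict f (Pt n)) ` A = (\<lambda>f. restrict f (Pt m)) ` A" for A
    by (simp add: image_image)
  ultimately show ?case by (simp only:)
qed

lemma Zar_subtopology:
  assumes "m \<le> n"
  shows "Zar m = subtopology (Zar n) (Pt m)"
  by (rule zariski_subtopology[OF fun_algebra fun_algebra points_mono[OF assms] regular_restrict[OF assms]])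

lemma closedin_points:
  assumes "m \<le> n"
  shows "closedin (Zar n) (Pt m)"
  using assms
proof (induction n rule: dec_induct)
  case base
  show ?case using closedin_topspace[of "Zar m"] by (simp add: topspace_Zar)
next
  case (step n)
  show ?case
    using step(3) closedin_closed_subtopology[OF embedding(1)[of n]] unfolding Zar_subtopology[OF le_SucI[OF order_refl], of n]
    by blast
qed

lemma closedin_level: "m \<le> n \<Longrightarrow> closedin (Zar m) A \<longleftrightarrow> closedin (Zar n) A \<and> A \<subseteq> Pt m"
  using closedin_closed_subtopology[OF closedin_points] Zar_subtopology by metis

lemma irreducible_level:
  "m \<le> n \<Longrightarrow> S \<subseteq> Pt m \<Longrightarrow> irreducible_in (Zar m) S \<longleftrightarrow> irreducible_in (Zar n) S"
  using irreducible_in_subtopology[OF closedin_points] Zar_subtopology by metis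

lemma curve_level: "m \<le> n \<Longrightarrow> irreducible_curve (Zar m) \<Gamma> \<Longrightarrow> irreducible_curve (Zar n) \<Gamma>"
  using irreducible_curve_subtopology[OF closedin_points] Zar_subtopology by metis

lemma subtopology_level: "m \<le> n \<Longrightarrow> C \<subseteq> Pt m \<Longrightarrow> subtopology (Zar m) C = subtopology (Zar n) C"
  by (simp add: Zar_subtopology[of m n] subtopology_subtopology Int_absorb1)

lemma infinite_normal: "\<exists>n\<ge>m. normal_variety (X n)"
  using normal_infinite by (metis infinite_nat_iff_unbounded_le mem_Collect_eq)

text \<open>Restriction from each level to the one below is surjective, so extensions can be chosen
  recursively to form an element of the inverse limit.\<close>

lemma extend_regular:
  assumes "g \<in> regular (X n)"
  shows "\<exists>f\<in>regular (ind_limit X). restrict f (Pt n) = g"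
proof -
  have "\<exists>h'. h' \<in> regular (X (Suc k)) \<and> restrict h' (Pt k) = h" if "h \<in> regular (X k)" for k h
    using that regular_restrict[of k "Suc k"] by auto
  then have "\<forall>k h. \<exists>h'. h \<in> regular (X k) \<longrightarrow> h' \<in> regular (X (Suc k)) \<and> restrict h' (Pt k) = h"
    by blast
  then obtain ext where ext: "\<And>k h. h \<in> regular (X k) \<Longrightarrow>
      ext k h \<in> regular (X (Suc k)) \<and> restrict (ext k h) (Pt k) = h"
    unfolding choice_iff by blast
  define G where "G = rec_nat g (\<lambda>i. ext (n + i))"
  have G0: "G 0 = g" and GS: "G (Suc i) = ext (n + i) (G i)" for i by (simp_all add: G_def)
  have GR: "G i \<in> regular (X (n + i))" for i
    by (induction i) (use assms ext in \<open>auto simp: G0 GS\<close>)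
  \<comment> \<open>The inverse limit asks for an entry at every level: extensions from
    \<open>n\<close> upwards, restrictions of \<open>g\<close> below.\<close>
  define H where "H k = (if n \<le> k then G (k - n) else restrict g (Pt k))" for k
  have HR: "H k \<in> regular (X k)" for k
  proof (cases "n \<le> k")
    case True
    then show ?thesis using GR[of "k - n"] by (simp add: H_def)
  next
    case False
    then show ?thesis using regular_restrict[of k n] assms by (simp add: H_def)
  qed
  have Hn: "H n = g" by (simp add: H_def G0)
  have Hr: "restrict (H (Suc k)) (Pt k) = H k" for k
  proof (cases "n \<le> k")
    case True
    then show ?thesis
      using ext[OF GR[of "k - n"]] by (simp add: H_def Suc_diff_le GS)
  next
    case False
    then have "H (Suc k) = restrict g (Pt (Suc k))"
      using Hn HR[of n] fun_algebra[of n]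
      by (cases "n = Suc k") (auto simp: H_def G0 fun_algebra_def extensional_restrict)
    then show ?thesis using False points_mono[of k "Suc k"] by (simp add: H_def Int_absorb1)
  qed
  have "H \<in> (\<lambda>f n. restrict f (Pt n)) ` regular (ind_limit X)"
    using bij_betw_imp_surj_on[OF bij_betw_inverse_limit[OF ind_variety]] HR Hr by blast
  then show ?thesis using Hn by auto
qed

lemma ind_limit_points: "x \<in> Pt n \<Longrightarrow> x \<in> points (ind_limit X)"
  by (auto simp: ind_limit_def)

lemma ind_limit_regular: "f \<in> regular (ind_limit X) \<Longrightarrow> restrict f (Pt n) \<in> regular (X n)"
  by (simp add: ind_limit_def)

lemma zariski_closed_imp_ind_closed:
  assumes "closedin (zariski_topology (ind_limit X)) Y"
  shows "closedin (ind_topology X) Y"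
proof -
  obtain E where E: "E \<subseteq> regular (ind_limit X)" "Y = zeros (ind_limit X) E"
    using assms unfolding closedin_zariski_topology[OF fun_algebra_ind_limit[OF ind_variety]] by blast
  have "closedin (Zar n) (Y \<inter> Pt n)" for n
  proof -
    have eq: "Y \<inter> Pt n = zeros (X n) ((\<lambda>f. restrict f (Pt n)) ` E)"
      unfolding E(2) by (rule zeros_restrict[symmetric]) (auto simp: ind_limit_def)
    have "(\<lambda>f. restrict f (Pt n)) ` E \<subseteq> regular (X n)"
      using E(1) ind_limit_regular by (intro image_subsetI) auto
    then show ?thesis
      unfolding closedin_zariski_topology[OF fun_algebra] eq
      by (intro exI[of _ "(\<lambda>f. restrict f (Pt n)) ` E"] conjI) (assumption, rule refl)
  qed
  moreover have "Y \<subseteq> points (ind_limit X)" unfolding E(2) by (auto simp: zeros_def)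
  ultimately show ?thesis by (simp add: closedin_ind_topology[OF ind_variety])
qed

text \<open>One fixed choice per level of total functions, number of generators and spanning sets.
  The choices at different levels are unrelated, so functions are moved between levels through
  \<open>ind_limit X\<close>.\<close>

definition repr :: "nat \<Rightarrow> ('p \<Rightarrow> 'k) set \<times> nat \<times> (nat \<Rightarrow> ('p \<Rightarrow> 'k) set)" where
  "repr n = (SOME (Q, m, F). affine_functions Q (X n) m F)"

abbreviation "R n \<equiv> fst (repr n)"

sublocale A: affine_functions "R n" "X n" "fst (snd (repr n))" "snd (snd (repr n))" for n
proof -
  have "\<exists>r. case r of (Q, m, F) \<Rightarrow> affine_functions Q (X n) m F"
    using affine_functions_exist[OF uncountable_field affine_variety[of n]] by auto
  from someI_ex[OF this]
  show "affine_functions (R n) (X n) (fst (snd (repr n))) (snd (snd (repr n)))"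
    unfolding repr_def by (simp add: case_prod_unfold)
qed

lemma R_regular: "r \<in> R n \<Longrightarrow> restrict r (Pt n) \<in> regular (X n)"
  using A.regular[of n] by blast

lemma regular_R:
  assumes "g \<in> regular (X n)"
  shows "\<exists>r\<in>R n. \<forall>x\<in>Pt n. r x = g x"
  using assms A.regular[of n] by auto

lemma ind_regular_R:
  assumes "f \<in> regular (ind_limit X)"
  shows "\<exists>r\<in>R n. \<forall>x\<in>Pt n. r x = f x"
  using regular_R[OF ind_limit_regular[OF assms], of n] by auto

lemma extend_R:
  assumes "r \<in> R n"
  shows "\<exists>f\<in>regular (ind_limit X). \<forall>x\<in>Pt n. f x = r x"
proof -
  obtain f where "f \<in> regular (ind_limit X)" "restrict f (Pt n) = restrict r (Pt n)"
    using extend_regular[OF R_regular[OF assms]] by blast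
  then show ?thesis by (metis restrict_apply')
qed

section \<open>The component through a point at normal levels\<close>

definition cmp :: "nat \<Rightarrow> 'p \<Rightarrow> 'p set" where
  "cmp n x = (THE C. A.component_of n (Pt n) C \<and> x \<in> C)"

text \<open>At a normal level the local ring at \<open>x\<close> is a domain. This makes the
  description in \<open>cmp\<close> definite at such levels.\<close>

lemma component_unique:
  assumes "normal_variety (X n)" "x \<in> Pt n"
    "A.component_of n (Pt n) C" "x \<in> C" "A.component_of n (Pt n) C'" "x \<in> C'"
  shows "C = C'"
  using assms A.domain_unique_component[of n x C C']
  by (auto simp: normal_variety_def normal_domain_def)

lemma cmp:
  assumes "normal_variety (X n)" "x \<in> Pt n"
  shows "A.component_of n (Pt n) (cmp n x)" "x \<in> cmp n x"
proof -
  have "closedin (Zar n) (Pt n)" by (rule closedin_points) simp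
  then obtain C where C: "A.component_of n (Pt n) C" "x \<in> C"
    using A.component_through_point[of n "Pt n" x] assms(2) by blast
  have "A.component_of n (Pt n) (cmp n x) \<and> x \<in> cmp n x"
    unfolding cmp_def by (rule theI[of _ C]) (use C component_unique[OF assms] in auto)
  then show "A.component_of n (Pt n) (cmp n x)" "x \<in> cmp n x" by auto
qed

lemma cmp_closed:
  assumes "normal_variety (X n)" "x \<in> Pt n"
  shows "closedin (Zar n) (cmp n x)" "irreducible_in (Zar n) (cmp n x)" "cmp n x \<subseteq> Pt n"
  using A.component_ofD(1,2,3)[OF cmp(1)[OF assms]] by auto

lemma irreducible_subset_cmp:
  assumes n: "normal_variety (X n)" and S: "irreducible_in (Zar n) S" "x \<in> S"
  shows "S \<subseteq> cmp n x"
proof -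
  have SP: "S \<subseteq> Pt n" using S(1) topspace_Zar by (auto simp: irreducible_in_def)
  have "closedin (Zar n) (Pt n)" by (rule closedin_points) simp
  then obtain C where C: "A.component_of n (Pt n) C" "S \<subseteq> C"
    using A.component_exists[of n "Pt n" S] S(1) SP by blast
  then have "C = cmp n x" using component_unique[OF n _ C(1)] cmp[OF n] S(2) SP by blast
  then show ?thesis using C by simp
qed

lemma cmp_mono:
  assumes "normal_variety (X n)" "normal_variety (X n')" "n \<le> n'" "x \<in> Pt n"
  shows "cmp n x \<subseteq> cmp n' x"
  using irreducible_subset_cmp[OF assms(2)] irreducible_level[OF assms(3)]
    cmp_closed[OF assms(1,4)] cmp(2)[OF assms(1,4)] by blast

text \<open>Stationarity is demanded along the normal levels, where \<open>cmp\<close> is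
  meaningful; other levels are reached by embedding them in a normal one.\<close>

definition stable :: "'p \<Rightarrow> bool" where
  "stable x \<longleftrightarrow> (\<exists>n0. normal_variety (X n0) \<and> x \<in> Pt n0 \<and>
     (\<forall>n\<ge>n0. normal_variety (X n) \<longrightarrow> cmp n x = cmp n0 x))"

lemma unstable_sequence:
  assumes x: "x \<in> points (ind_limit X)" and "\<not> stable x"
  shows "\<exists>s. \<forall>k. normal_variety (X (s k)) \<and> x \<in> Pt (s k) \<and> s k < s (Suc k) \<and>
      cmp (s k) x \<subset> cmp (s (Suc k)) x"
proof -
  have "\<exists>n'. normal_variety (X n') \<and> x \<in> Pt n' \<and> n < n' \<and> cmp n x \<subset> cmp n' x"
    if n: "normal_variety (X n)" "x \<in> Pt n" for n
  proof -
    obtain n' where n': "n' \<ge> n" "normal_variety (X n')" "cmp n' x \<noteq> cmp n x"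
      using assms(2) n unfolding stable_def by blast
    then have "cmp n x \<subset> cmp n' x" "n \<noteq> n'" using cmp_mono[OF n(1) n'(2,1) n(2)] by auto
    then show ?thesis using n' n points_mono[OF n'(1)] by (intro exI[of _ n']) auto
  qed
  then obtain nxt where nxt: "\<And>n. normal_variety (X n) \<Longrightarrow> x \<in> Pt n \<Longrightarrow>
      normal_variety (X (nxt n)) \<and> x \<in> Pt (nxt n) \<and> n < nxt n \<and> cmp n x \<subset> cmp (nxt n) x" by metis
  obtain k where "x \<in> Pt k" using x by (auto simp: ind_limit_def)
  moreover obtain n0 where n0: "n0 \<ge> k" "normal_variety (X n0)" using infinite_normal by blast
  ultimately have x0: "x \<in> Pt n0" using points_mono by blast
  define s where "s k = (nxt ^^ k) n0" for k
  have "normal_variety (X (s k)) \<and> x \<in> Pt (s k)" for k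
    by (induction k) (use n0 x0 nxt in \<open>auto simp: s_def\<close>)
  then show ?thesis using nxt by (intro exI[of _ s]) (auto simp: s_def)
qed

section \<open>Stability and bounded local dimension\<close>

lemma krull_dim_le_local_dim:
  assumes "normal_variety (X n)" "x \<in> Pt n"
  shows "krull_dim (subtopology (Zar n) (cmp n x)) \<le> local_dim (X n) x"
  unfolding local_dim_def A.irreducible_components_eq
  by (rule Sup_upper) (use cmp[OF assms] in auto)

text \<open>Without stability, the components through \<open>x\<close> at normal levels themselves
  form chains of any length.\<close>

lemma bounded_imp_stable:
  assumes x: "x \<in> points (ind_limit X)"
    and bounded: "\<And>n. x \<in> Pt n \<Longrightarrow> local_dim (X n) x \<le> enat c"
  shows "stable x"
proof (rule ccontr)
  assume "\<not> stable x"
  then obtain s where s: "\<And>k. normal_variety (X (s k))" "\<And>k. x \<in> Pt (s k)" "\<And>k. s k < s (Suc k)"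
    "\<And>k. cmp (s k) x \<subset> cmp (s (Suc k)) x" using unstable_sequence[OF x] by metis
  have smono: "i \<le> j \<Longrightarrow> s i \<le> s j" for i j by (rule lift_Suc_mono_le) (use s(3) less_imp_le in auto)
  \<comment> \<open>The components with indices \<open>0\<close> to \<open>Suc c\<close> give a
    chain of length \<open>Suc c\<close>, one more than the bound allows.\<close>
  define N where "N = s (Suc c)"
  have "chain_in (Zar N) (cmp N x) (Suc c) (\<lambda>i. cmp (s i) x)"
    unfolding chain_in_def
  proof (intro conjI allI impI s(4))
    fix i assume i: "i \<le> Suc c"
    then have iN: "s i \<le> N" by (simp add: N_def smono)
    show "closedin (Zar N) (cmp (s i) x)" using cmp_closed(1)[OF s(1,2)] closedin_level[OF iN] by blast
    show "irreducible_in (Zar N) (cmp (s i) x)"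
      using cmp_closed(2,3)[OF s(1,2)] irreducible_level[OF iN] by blast
    show "cmp (s i) x \<subseteq> cmp N x" using cmp_mono[OF s(1) _ iN s(2)] s(1) by (simp add: N_def)
  qed
  then have "enat (Suc c) \<le> krull_dim (subtopology (Zar N) (cmp N x))"
    using chain_in_krull_dim cmp_closed(1) s(1,2) unfolding N_def by blast
  also have "\<dots> \<le> local_dim (X N) x" using krull_dim_le_local_dim s(1,2) unfolding N_def by blast
  also have "\<dots> \<le> enat c" using bounded s(2) unfolding N_def by blast
  finally show False by simp
qed

text \<open>Any component through \<open>x\<close>, at any level, remains irreducible at a higher
  normal level and so lies in the stationary component, whose dimension is bounded by the number of
  generators of its coordinate ring.\<close>

lemma stable_imp_bounded:
  assumes "stable x"
  shows "\<exists>c::nat. \<forall>n. x \<in> Pt n \<longrightarrow> local_dim (X n) x \<le> enat c"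
proof -
  obtain n0 where n0: "normal_variety (X n0)" "x \<in> Pt n0"
    "\<And>n. n \<ge> n0 \<Longrightarrow> normal_variety (X n) \<Longrightarrow> cmp n x = cmp n0 x"
    using assms unfolding stable_def by blast
  define d where "d = fst (snd (repr n0))"
  have C: "closedin (Zar n0) (cmp n0 x)" "cmp n0 x \<subseteq> Pt n0" using cmp_closed[OF n0(1,2)] by auto
  have "local_dim (X n) x \<le> enat d" if x: "x \<in> Pt n" for n
    unfolding local_dim_def A.irreducible_components_eq
  proof (rule Sup_least)
    fix e assume "e \<in> {krull_dim (subtopology (Zar n) D) |D. D \<in> {T. A.component_of n (Pt n) T} \<and> x \<in> D}"
    then obtain D where D: "A.component_of n (Pt n) D" "x \<in> D" "e = krull_dim (subtopology (Zar n) D)"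
      by blast
    note Dc = A.component_ofD[OF D(1)]
    \<comment> \<open>Level \<open>n\<close> need not be normal, nor at least \<open>n0\<close>;
      \<open>D\<close> is compared with the stationary component at a normal level above
      both.\<close>
    obtain n' where n': "n' \<ge> max n n0" "normal_variety (X n')" using infinite_normal by blast
    then have le: "n \<le> n'" "n0 \<le> n'" by auto
    have "irreducible_in (Zar n') D" using Dc(2,3) irreducible_level[OF le(1)] by blast
    then have DC: "D \<subseteq> cmp n0 x" using irreducible_subset_cmp[OF n'(2) _ D(2)] n0(3)[OF le(2) n'(2)] by simp
    have Dcl: "closedin (Zar n') D" using Dc(1) closedin_level[OF le(1)] by blast
    have Ccl: "closedin (Zar n') (cmp n0 x)" using C(1) closedin_level[OF le(2)] by blast
    have "krull_dim (subtopology (Zar n') D) \<le> krull_dim (subtopology (Zar n') (cmp n0 x))"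
    proof (rule krull_dim_le[OF Dcl])
      fix k Z assume "chain_in (Zar n') D k Z"
      then have "chain_in (Zar n') (cmp n0 x) k Z" using DC unfolding chain_in_def by blast
      then show "enat k \<le> krull_dim (subtopology (Zar n') (cmp n0 x))" by (rule chain_in_krull_dim[OF Ccl])
    qed
    also have "\<dots> = krull_dim (subtopology (Zar n0) (cmp n0 x))"
      using subtopology_level[OF le(2) C(2)] by simp
    also have "\<dots> \<le> enat d" unfolding d_def by (rule A.krull_dim_bound[OF C(1)])
    finally show "e \<le> enat d" using D(3) subtopology_level[OF le(1) Dc(3)] by simp
  qed
  then show ?thesis by blast
qed

text \<open>A function at level \<open>n0\<close> separating \<open>x\<close> from \<open>Y\<close>
  is extended by zero outside the stationary component \<open>C\<close>. The result is regular,
  because at every later normal level the other components form a closed set disjoint from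
  \<open>C\<close>.\<close>

lemma stable_separate:
  assumes "stable x" and Y: "closedin (ind_topology X) Y" and xY: "x \<notin> Y"
  shows "\<exists>f\<in>regular (ind_limit X). (\<forall>y\<in>Y. f y = 0) \<and> f x \<noteq> 0"
proof -
  obtain n0 where n0: "normal_variety (X n0)" "x \<in> Pt n0"
    "\<And>n. n \<ge> n0 \<Longrightarrow> normal_variety (X n) \<Longrightarrow> cmp n x = cmp n0 x"
    using assms(1) unfolding stable_def by blast
  define C where "C = cmp n0 x"
  have CP: "C \<subseteq> Pt n0" and xC: "x \<in> C"
    using cmp_closed(3)[OF n0(1,2)] cmp(2)[OF n0(1,2)] by (auto simp: C_def)
  have Yc: "closedin (Zar n0) (Y \<inter> Pt n0)" and YX: "Y \<subseteq> points (ind_limit X)"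
    using Y by (auto simp: closedin_ind_topology[OF ind_variety])
  obtain g where g: "g \<in> A.vanishing n0 (Y \<inter> Pt n0)" "g x \<noteq> 0"
    using A.closedin_separate[OF Yc n0(2)] xY by blast
  have gR: "g \<in> R n0" and gY: "\<And>y. y \<in> Y \<Longrightarrow> y \<in> Pt n0 \<Longrightarrow> g y = 0"
    using g(1) by (auto simp: A.vanishing_def)
  define f where "f = restrict (\<lambda>z. if z \<in> C then g z else 0) (points (ind_limit X))"
  have "restrict f (Pt n) \<in> regular (X n)" for n
  proof -
    \<comment> \<open>Regularity is shown at a normal level \<open>n'\<close> and then restricted to
      \<open>n\<close>. At level \<open>n'\<close>, \<open>f\<close> is the product of the
      idempotent of \<open>C\<close> and an extension of \<open>g\<close>.\<close>
    obtain n' where n': "n' \<ge> max n n0" "normal_variety (X n')" using infinite_normal by blast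
    then have le: "n \<le> n'" "n0 \<le> n'" by auto
    have xn': "x \<in> Pt n'" using n0(2) points_mono[OF le(2)] by blast
    have Cn': "C = cmp n' x" using n0(3)[OF le(2) n'(2)] by (simp add: C_def)
    have Cc: "A.component_of n' (Pt n') C" using cmp(1)[OF n'(2) xn'] by (simp add: Cn')
    have Pc: "closedin (Zar n') (Pt n')" by (rule closedin_points) simp
    define B where "B = \<Union>({T. A.component_of n' (Pt n') T} - {C})"
    have B: "closedin (Zar n') B"
      unfolding B_def using A.finite_components[OF Pc] A.component_ofD(1)
      by (intro closedin_Union) auto
    have disj: "C \<inter> B = {}"
    proof (rule ccontr)
      assume "C \<inter> B \<noteq> {}"
      then obtain z T where z: "z \<in> C" "z \<in> T" "A.component_of n' (Pt n') T" "T \<noteq> C"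
        unfolding B_def by blast
      have "z \<in> Pt n'" using A.component_ofD(3)[OF Cc] z(1) by blast
      then show False using component_unique[OF n'(2) _ Cc z(1) z(3,2)] z(4) by blast
    qed
    have cover: "z \<in> B" if "z \<in> Pt n'" "z \<notin> C" for z
      using A.component_through_point[OF Pc that(1)] that(2) unfolding B_def by blast
    obtain e where e: "e \<in> R n'" "\<And>z. z \<in> C \<Longrightarrow> e z = 1" "\<And>z. z \<in> B \<Longrightarrow> e z = 0"
      using A.disjoint_closed_idempotent[OF A.component_ofD(1)[OF Cc] B disj] by blast
    obtain h where h: "h \<in> regular (ind_limit X)" "\<And>z. z \<in> Pt n0 \<Longrightarrow> h z = g z"
      using extend_R[OF gR] by blast
    obtain g' where g': "g' \<in> R n'" "\<And>z. z \<in> Pt n' \<Longrightarrow> g' z = h z"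
      using ind_regular_R[OF h(1), of n'] by blast
    have "f z = (e * g') z" if z: "z \<in> Pt n'" for z
    proof (cases "z \<in> C")
      case True
      then show ?thesis using e(2) g'(2)[OF z] h(2) CP ind_limit_points[OF z] by (auto simp: f_def)
    next
      case False
      then show ?thesis using e(3)[OF cover[OF z False]] ind_limit_points[OF z] by (simp add: f_def)
    qed
    then have "restrict f (Pt n') = restrict (e * g') (Pt n')" by (auto simp: restrict_def)
    then have "restrict f (Pt n') \<in> regular (X n')" using R_regular[OF A.mult_closed[OF e(1) g'(1)]] by simp
    then have "restrict (restrict f (Pt n')) (Pt n) \<in> regular (X n)"
      using regular_restrict[OF le(1)] by blast
    then show ?thesis using points_mono[OF le(1)] by (simp add: Int_absorb1)
  qed
  then have "f \<in> regular (ind_limit X)" by (auto simp: ind_limit_def f_def)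
  moreover have "f y = 0" if "y \<in> Y" for y using that YX gY CP by (auto simp: f_def)
  moreover have "f x \<noteq> 0" using g(2) xC ind_limit_points[OF n0(2)] by (simp add: f_def)
  ultimately show ?thesis by blast
qed

lemma stable_imp_topologies_eq:
  assumes "\<And>x. x \<in> points (ind_limit X) \<Longrightarrow> stable x"
  shows "ind_topology X = zariski_topology (ind_limit X)"
proof (rule topology_eq_closedin)
  note fa = fun_algebra_ind_limit[OF ind_variety]
  show "topspace (ind_topology X) = topspace (zariski_topology (ind_limit X))"
    by (simp add: topspace_ind_topology[OF ind_variety] topspace_zariski_topology[OF fa])
  show "closedin (ind_topology X) Y \<longleftrightarrow> closedin (zariski_topology (ind_limit X)) Y" for Y
  proof
    assume Y: "closedin (ind_topology X) Y"
    let ?E = "{f \<in> regular (ind_limit X). \<forall>y\<in>Y. f y = 0}"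
    have YX: "Y \<subseteq> points (ind_limit X)" using Y by (simp add: closedin_ind_topology[OF ind_variety])
    have "Y = zeros (ind_limit X) ?E"
    proof (intro equalityI subsetI)
      fix x assume x: "x \<in> zeros (ind_limit X) ?E"
      then have xX: "x \<in> points (ind_limit X)" by (simp add: zeros_def)
      show "x \<in> Y"
      proof (rule ccontr)
        assume "x \<notin> Y"
        from stable_separate[OF assms[OF xX] Y this] obtain f where "f \<in> ?E" "f x \<noteq> 0" by blast
        then show False using x unfolding zeros_def by blast
      qed
    next
      fix x assume "x \<in> Y"
      then show "x \<in> zeros (ind_limit X) ?E" using YX by (auto simp: zeros_def)
    qed
    moreover have "?E \<subseteq> regular (ind_limit X)" by blast
    ultimately show "closedin (zariski_topology (ind_limit X)) Y"
      unfolding closedin_zariski_topology[OF fa] by (intro exI[of _ ?E] conjI)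
  qed (rule zariski_closed_imp_ind_closed)
qed

section \<open>Unstable points: an ind-closed set that is not Zariski closed\<close>

lemma ind_closed_cofinal:
  assumes "Y \<subseteq> points (ind_limit X)" "\<And>k. k \<le> s k" "\<And>k. closedin (Zar (s k)) (Y \<inter> Pt (s k))"
  shows "closedin (ind_topology X) Y"
  unfolding closedin_ind_topology[OF ind_variety]
proof (intro conjI allI assms(1))
  fix n
  have "Y \<inter> Pt n = (Y \<inter> Pt (s n)) \<inter> Pt n" using points_mono[OF assms(2)[of n]] by blast
  moreover have "closedin (Zar (s n)) ((Y \<inter> Pt (s n)) \<inter> Pt n)"
    using assms(3) closedin_points[OF assms(2)] by (rule closedin_Int)
  ultimately show "closedin (Zar n) (Y \<inter> Pt n)"
    unfolding closedin_level[OF assms(2)[of n]] by simp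
qed

lemma unstable_imp_topologies_ne:
  assumes x: "x \<in> points (ind_limit X)" and "\<not> stable x"
  shows "ind_topology X \<noteq> zariski_topology (ind_limit X)"
proof -
  obtain s0 where s0: "\<And>k. normal_variety (X (s0 k))" "\<And>k. x \<in> Pt (s0 k)" "\<And>k. s0 k < s0 (Suc k)"
    "\<And>k. cmp (s0 k) x \<subset> cmp (s0 (Suc k)) x" using unstable_sequence[OF assms] by metis
  \<comment> \<open>The sequence starts one index later, so that \<open>W 0\<close> strictly
    contains a component through \<open>x\<close>; it is therefore not a point and contains a
    curve.\<close>
  define s where "s k = s0 (Suc k)" for k
  define W where "W k = cmp (s k) x" for k
  have norm: "normal_variety (X (s k))" and xs: "x \<in> Pt (s k)" and slt: "s k < s (Suc k)"
    and Wlt: "W k \<subset> W (Suc k)" for k using s0 by (auto simp: s_def W_def)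
  have sm: "strict_mono s" using slt by (simp add: strict_mono_Suc_iff)
  have smono: "i \<le> j \<Longrightarrow> s i \<le> s j" for i j using sm by (simp add: strict_mono_less_eq)
  have sk: "k \<le> s k" for k by (rule strict_mono_imp_increasing[OF sm])
  have Wc: "closedin (Zar (s k)) (W k)" "irreducible_in (Zar (s k)) (W k)" "W k \<subseteq> Pt (s k)" for k
    using cmp_closed[OF norm xs] by (auto simp: W_def)
  have Wmono: "W 0 \<subseteq> W k" for k using lift_Suc_mono_le[of W 0 k] Wlt by blast
  \<comment> \<open>An irreducible set through \<open>x\<close> within level \<open>s k\<close>
    would be part of \<open>W k\<close>. Hence \<open>W (Suc k)\<close> can start the search for
    \<open>S k\<close> with the previous level as \<open>U\<close>.\<close>
  have nW: "\<not> W (Suc k) \<subseteq> Pt (s k)" for k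
  proof
    assume "W (Suc k) \<subseteq> Pt (s k)"
    then have "irreducible_in (Zar (s k)) (W (Suc k))"
      using irreducible_level[OF less_imp_le[OF slt]] Wc(2) by blast
    moreover have "x \<in> W (Suc k)" using cmp(2)[OF norm xs] by (simp add: W_def)
    ultimately have "W (Suc k) \<subseteq> W k" using irreducible_subset_cmp[OF norm] by (simp add: W_def)
    then show False using Wlt by blast
  qed
  have "W 0 \<noteq> {p}" for p
    using s0(4)[of 0] cmp(2)[OF s0(1,2), of 0] by (auto simp: W_def s_def)
  then obtain \<Gamma> where \<Gamma>W: "\<Gamma> \<subseteq> W 0" and \<Gamma>0: "irreducible_curve (Zar (s 0)) \<Gamma>"
    using A.curve_exists[OF Wc(1,2)[of 0]] by blast
  have \<Gamma>: "irreducible_curve (Zar (s k)) \<Gamma>" for k using curve_level[OF smono \<Gamma>0] by simp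
  note \<Gamma>c = irreducible_curveD[OF \<Gamma>]
  have \<Gamma>P: "\<Gamma> \<subseteq> Pt (s k)" for k using A.closedin_sub[OF \<Gamma>c(1)] .
  have inf: "infinite (UNIV :: 'k set)" using uncountable_field countable_finite by blast
  have "\<exists>S y t c. closedin (Zar (s (Suc k))) S \<and> irreducible_in (Zar (s (Suc k))) S \<and> \<Gamma> \<subset> S \<and>
      y \<in> A.vanishing (s (Suc k)) (Pt (s k)) \<and>
      t \<in> R (s (Suc k)) - A.vanishing (s (Suc k)) \<Gamma> \<and>
      (\<forall>g\<in>A.vanishing (s (Suc k)) \<Gamma>. \<exists>e\<in>R (s (Suc k)). \<forall>x\<in>S. (t x * g x) ^ c = y x * e x)" for k
    by (rule A.transversal_hypersurface[OF inf closedin_points[OF less_imp_le[OF slt]] \<Gamma>c(1,2) \<Gamma>P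
          Wc(1,2) _ nW]) (use \<Gamma>W Wmono in blast)
  then obtain S y t c where
    S: "\<And>k. closedin (Zar (s (Suc k))) (S k)" "\<And>k. irreducible_in (Zar (s (Suc k))) (S k)" "\<And>k. \<Gamma> \<subset> S k"
    and y: "\<And>k. y k \<in> A.vanishing (s (Suc k)) (Pt (s k))"
    and t: "\<And>k. t k \<in> R (s (Suc k)) - A.vanishing (s (Suc k)) \<Gamma>"
    and rad: "\<And>k g. g \<in> A.vanishing (s (Suc k)) \<Gamma> \<Longrightarrow>
      \<exists>e\<in>R (s (Suc k)). \<forall>x\<in>S k. (t k x * g x) ^ c k = y k x * e x"
    by metis
  \<comment> \<open>Each \<open>t k\<close> excludes finitely many points of the curve, and all of
    them together countably many, whereas the curve is uncountable.\<close>
  have tfin: "finite {x \<in> \<Gamma>. t k x = 0}" for k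
  proof -
    have "{x \<in> \<Gamma>. t k x = 0} = \<Gamma> \<inter> {x \<in> Pt (s (Suc k)). t k x = 0}" using \<Gamma>P by blast
    moreover have "\<not> \<Gamma> \<subseteq> {x \<in> Pt (s (Suc k)). t k x = 0}" using t by (auto simp: A.vanishing_def)
    ultimately show ?thesis using A.curve_Int_finite[OF \<Gamma> A.closedin_zero] t by auto
  qed
  have "countable (\<Union>k. {x \<in> \<Gamma>. t k x = 0})" using tfin by (auto intro: countable_finite)
  moreover have "uncountable \<Gamma>" by (rule A.uncountable_irreducible[OF uncountable_field \<Gamma>c])
  ultimately have "\<not> \<Gamma> \<subseteq> (\<Union>k. {x \<in> \<Gamma>. t k x = 0})" using countable_subset by blast
  then obtain p where p: "p \<in> \<Gamma>" "\<And>k. t k p \<noteq> 0" by auto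
  obtain p1 where p1: "p1 \<in> \<Gamma>" "p1 \<noteq> p" using \<Gamma>c(3)[of p] p(1) by blast
  have pP: "p \<in> Pt (s 0)" "p1 \<in> Pt (s 0)" using \<Gamma>P p p1 by auto
  \<comment> \<open>\<open>b\<close> has to vanish at \<open>p\<close> but not on the whole curve;
    \<open>p1\<close> will be the point of \<open>\<Gamma>\<close> outside \<open>Y\<close>.\<close>
  obtain b0 where b0: "b0 \<in> A.vanishing (s 0) {p}" "b0 p1 \<noteq> 0"
    using A.closedin_separate[OF A.closedin_point[OF pP(1)] pP(2)] p1(2) by blast
  obtain b where b: "b \<in> regular (ind_limit X)" "\<And>x. x \<in> Pt (s 0) \<Longrightarrow> b x = b0 x"
    using extend_R[of b0 "s 0"] b0(1) by (auto simp: A.vanishing_def)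
  have bp: "b p = 0" "b p1 \<noteq> 0" using b0 b(2) pP by (auto simp: A.vanishing_def)
  have "\<exists>r\<in>R n. \<forall>x\<in>Pt n. r x = b x" for n by (rule ind_regular_R[OF b(1)])
  then obtain bb where bb: "\<And>n. bb n \<in> R n" "\<And>n x. x \<in> Pt n \<Longrightarrow> bb n x = b x" by metis
  \<comment> \<open>One more than the bound \<open>c k * M\<close> from
    \<open>tangency_bound\<close> at \<open>M = k\<close>; also positive, as the closedness of
    \<open>Y\<close> requires.\<close>
  define N where "N k = c k * k + 1" for k
  define Z where "Z k = {x \<in> Pt (s (Suc k)). b x ^ N k + y k x = 0}" for k
  define H where "H = {x \<in> points (ind_limit X). b x = 0}"
  define Y where "Y = H \<union> (\<Union>k. Z k)"
  have y0: "y k x = 0" if "x \<in> Pt (s k)" for k x using y that by (auto simp: A.vanishing_def)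
  have yR: "y k \<in> R (s (Suc k))" for k using y by (auto simp: A.vanishing_def)
  have YX: "Y \<subseteq> points (ind_limit X)" by (auto simp: Y_def H_def Z_def ind_limit_def)
  \<comment> \<open>For \<open>k \<ge> j\<close> the function \<open>y k\<close> vanishes on level
    \<open>s j\<close>, where \<open>Z k\<close> therefore contributes only zeros of
    \<open>b\<close>. At each level \<open>Y\<close> is thus a finite union of closed sets, although
    infinitely many \<open>Z k\<close> occur.\<close>
  have closedY: "closedin (Zar (s j)) (Y \<inter> Pt (s j))" for j
  proof -
    have ZH: "x \<in> H" if "x \<in> Z k" "x \<in> Pt (s j)" "j \<le> k" for x k
    proof -
      have "y k x = 0" using y0 points_mono[OF smono[OF that(3)]] that(2) by blast
      then show ?thesis using that(1) ind_limit_points[OF that(2)] by (simp add: Z_def H_def)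
    qed
    have ZP: "Z k \<subseteq> Pt (s j)" if "k < j" for k
      using points_mono[OF smono[of "Suc k" j]] that by (auto simp: Z_def)
    have eq: "Y \<inter> Pt (s j) = (H \<inter> Pt (s j)) \<union> (\<Union>k<j. Z k)"
    proof (intro equalityI subsetI)
      fix x assume x: "x \<in> Y \<inter> Pt (s j)"
      show "x \<in> (H \<inter> Pt (s j)) \<union> (\<Union>k<j. Z k)"
      proof (cases "x \<in> H")
        case False
        then obtain k where "x \<in> Z k" using x by (auto simp: Y_def)
        moreover from this have "k < j" using ZH[of x k] x False by (meson IntD2 not_less)
        ultimately show ?thesis by blast
      qed (use x in blast)
    qed (use ZP in \<open>auto simp: Y_def\<close>)
    have "H \<inter> Pt (s j) = {x \<in> Pt (s j). bb (s j) x = 0}"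
      using bb(2) ind_limit_points by (auto simp: H_def)
    then have "closedin (Zar (s j)) (H \<inter> Pt (s j))" using A.closedin_zero[OF bb(1)] by simp
    moreover have "closedin (Zar (s j)) (Z k)" if "k < j" for k
    proof -
      let ?q = "bb (s (Suc k)) ^ N k + y k"
      have "?q \<in> R (s (Suc k))" by (intro A.add_closed A.power_closed bb yR)
      then have "closedin (Zar (s (Suc k))) {x \<in> Pt (s (Suc k)). ?q x = 0}" by (rule A.closedin_zero)
      moreover have "{x \<in> Pt (s (Suc k)). ?q x = 0} = Z k"
        using bb(2) by (auto simp: Z_def power_fun_apply)
      ultimately show ?thesis using closedin_level[OF smono[of "Suc k" j]] that by auto
    qed
    ultimately show ?thesis unfolding eq by (intro closedin_Un closedin_Union) auto
  qed
  have "closedin (ind_topology X) Y" by (rule ind_closed_cofinal[OF YX sk closedY])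
  moreover have "\<not> closedin (zariski_topology (ind_limit X)) Y"
  proof
    assume "closedin (zariski_topology (ind_limit X)) Y"
    then obtain E where E: "E \<subseteq> regular (ind_limit X)" "Y = zeros (ind_limit X) E"
      unfolding closedin_zariski_topology[OF fun_algebra_ind_limit[OF ind_variety]] by blast
    have "p1 \<notin> Z k" for k
      using y0[OF subsetD[OF \<Gamma>P p1(1)], of k] bp(2) by (auto simp: Z_def)
    then have "p1 \<notin> Y" using bp(2) by (auto simp: Y_def H_def)
    then obtain f where f: "f \<in> E" "f p1 \<noteq> 0"
      using E(2) ind_limit_points[OF pP(2)] by (auto simp: zeros_def)
    have fY: "f x = 0" if "x \<in> Y" for x using that f(1) unfolding E(2) by (auto simp: zeros_def)
    have fX: "f \<in> regular (ind_limit X)" using f(1) E(1) by blast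
    obtain f0 where f0: "f0 \<in> R (s 0)" "\<And>x. x \<in> Pt (s 0) \<Longrightarrow> f0 x = f x" using ind_regular_R[OF fX] by blast
    have "f0 p1 \<noteq> 0" using f(2) f0(2)[OF pP(2)] by simp
    then have "f0 \<notin> A.vanishing (s 0) \<Gamma>" using p1(1) unfolding A.vanishing_def by blast
    moreover have "bb (s 0) p = 0" using bb(2) pP bp by simp
    ultimately obtain M u0 e0 where u0: "u0 \<in> R (s 0)" "e0 \<in> R (s 0)" "u0 p \<noteq> 0"
      "\<And>x. x \<in> \<Gamma> \<Longrightarrow> u0 x * bb (s 0) x ^ M = f0 x * e0 x"
      using A.curve_divides_power[OF \<Gamma> p(1) bb(1) _ f0(1)] by blast
    \<comment> \<open>\<open>u0\<close> and \<open>e0\<close> belong to level \<open>s 0\<close>,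
      while the tangency bound needs a higher level; extensions to the limit carry the relation on
      \<open>\<Gamma>\<close> over.\<close>
    obtain u e where ue: "u \<in> regular (ind_limit X)" "\<And>x. x \<in> Pt (s 0) \<Longrightarrow> u x = u0 x"
      "e \<in> regular (ind_limit X)" "\<And>x. x \<in> Pt (s 0) \<Longrightarrow> e x = e0 x"
      using extend_R[OF u0(1)] extend_R[OF u0(2)] by metis
    \<comment> \<open>The diagonal choice: the exponent \<open>M\<close> found for \<open>f\<close>
      selects the hypersurface \<open>Z M\<close>, which lives at this level.\<close>
    let ?n = "s (Suc M)"
    obtain f1 where f1: "f1 \<in> R ?n" "\<And>x. x \<in> Pt ?n \<Longrightarrow> f1 x = f x" using ind_regular_R[OF fX] by blast
    obtain u1 where u1: "u1 \<in> R ?n" "\<And>x. x \<in> Pt ?n \<Longrightarrow> u1 x = u x" using ind_regular_R[OF ue(1)] by blast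
    obtain e1 where e1: "e1 \<in> R ?n" "\<And>x. x \<in> Pt ?n \<Longrightarrow> e1 x = e x" using ind_regular_R[OF ue(3)] by blast
    have "N M \<le> c M * M"
    proof (rule A.tangency_bound[OF S \<Gamma> p(1) _ _ p(2) rad bb(1) _ _ _ f1(1) _ u1(1) e1(1)])
      have pn: "p \<in> Pt ?n" "p1 \<in> Pt ?n" using \<Gamma>P p p1 by auto
      show "y M \<in> A.vanishing ?n \<Gamma>" 
        using A.vanishing_antimono[OF \<Gamma>P] y by blast
      show "t M \<in> R ?n" using t by blast
      show "bb ?n p = 0" using bb(2) pn bp by simp
      have "bb ?n p1 \<noteq> 0" using bb(2)[OF pn(2)] bp(2) by simp
      then show "bb ?n \<notin> A.vanishing ?n \<Gamma>" using p1(1) unfolding A.vanishing_def by blast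
      show "0 < N M" by (simp add: N_def)
      show "f1 x = 0" if "x \<in> Pt ?n" "bb ?n x ^ N M + y M x = 0" for x
        using that fY[of x] f1(2) bb(2) by (auto simp: Y_def Z_def)
      show "u1 p \<noteq> 0" using u1(2) ue(2) u0(3) pn pP by simp
      show "u1 x * bb ?n x ^ M = f1 x * e1 x" if "x \<in> \<Gamma>" for x
      proof -
        have "x \<in> Pt ?n" "x \<in> Pt (s 0)" using \<Gamma>P that by auto
        then show ?thesis using u0(4)[OF that] u1(2) ue f1(2) f0(2) e1(2) bb(2) by simp
      qed
    qed
    then show False by (simp add: N_def)
  qed
  ultimately show ?thesis by metis
qed

end

theorem corollary2:
  fixes X :: "nat \<Rightarrow> ('p, 'k::{alg_closed_field, field_char_0}) fun_space"
  assumes "uncountable (UNIV :: 'k set)"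
    and "affine_ind_variety X"
    and "infinite {n. normal_variety (X n)}"
  shows "ind_topology X = zariski_topology (ind_limit X) \<longleftrightarrow>
           (\<forall>x \<in> points (ind_limit X). \<exists>c::nat. \<forall>n. x \<in> points (X n) \<longrightarrow>
              local_dim (X n) x \<le> enat c)"
proof -
  interpret normal_ind_variety X by (rule normal_ind_variety.intro[OF assms])
  show ?thesis
    using unstable_imp_topologies_ne stable_imp_topologies_eq stable_imp_bounded bounded_imp_stable
    by metis
qed

end
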